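(* Let $\mathbb{K}$ be a field of characteristic zero and let $\Delta$ be a $d$-dimensional Cohen-Macaulay (over $\mathbb{K}$) collapsible simplicial complex on vertex set $[n]$ with Stanley-Reisner ideal $I_\Delta\subset R=\mathbb{K}[x_1,\dots,x_n]$. Let $a>0$ be a fixed integer. Then for every integer $t>d(a-1)$, $I_\Delta$ does not admit a homogeneous system of parameters $\theta_1,\dots,\theta_{d+1}$ satisfying all of the following: (1) $x_1^a,\dots,x_n^a\in I_\Delta+(\theta_1,\dots,\theta_{d+1})$ and $x_1+\dots+x_n\in I_\Delta+(\theta_1,\dots,\theta_{d+1})$; (2) $\deg\theta_1+\dots+\deg\theta_{d+1}+\deg h_\Delta(x)-d-1=t$; (3) $\dim_{\mathbb{K}}A_\Delta(a)_{t-1}\ge\dim_{\mathbb{K}}A_\Delta(a)_t$, where $A_\Delta(a)=R/(I_\Delta+(x_1^a,\dots,x_n^a))$. In other words, $\Delta$ has no $a$-unexpected system of parameters of total degree $t>d(a-1)$.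
   Context: $I_\Delta=(\prod_{i\in\sigma}x_i:\sigma\notin\Delta)$. $\Delta$ is Cohen-Macaulay over $\mathbb{K}$ if for every $\sigma\in\Delta$, $\tilde H_i(\mathrm{link}_\Delta(\sigma);\mathbb{K})=0$ for all $i<\dim \mathrm{link}_\Delta(\sigma)$ (equivalently, $R/I_\Delta$ is Cohen-Macaulay). $h_\Delta(x)=\sum_i h_ix^i$ is the $h$-polynomial: the Hilbert series of $R/I_\Delta$ is $h_\Delta(x)/(1-x)^{d+1}$. A homogeneous system of parameters of $I_\Delta$ is a sequence of homogeneous elements $\theta_1,\dots,\theta_{d+1}\in R$ such that $R/(I_\Delta+(\theta_1,\dots,\theta_{d+1}))$ is a finite dimensional $\mathbb{K}$-vector space. A face $\sigma$ of $\Delta$ is free if it is strictly contained in exactly one other face $\tau$ of $\Delta$; an elementary collapse deletes such a pair $\sigma,\tau$. $\Delta$ is collapsible if a single vertex can be obtained from $\Delta$ by a sequence of elementary collapses.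
   Formalization: The elements of a homogeneous system of parameters are required to have positive degree; if nonzero constants were allowed, e.g. θ_1=1, θ_2=x_1^N for an edge, the claim would be false. *)

theory Defs
  imports
    "HOL-Library.Poly_Mapping"
    "HOL-Computational_Algebra.Polynomial_FPS"
    "HOL-Algebra.Embedded_Algebras"
    "HOL-Algebra.QuotRing"
begin

section \<open>Simplicial complexes\<close>

text \<open>Complexes contain the empty face, and every element of the vertex set is a vertex.\<close>

definition simplicial_complex_on :: "nat set \<Rightarrow> nat set set \<Rightarrow> bool" where
  "simplicial_complex_on V \<Delta> \<longleftrightarrow>
     finite V \<and> \<Delta> \<subseteq> Pow V \<and> {} \<in> \<Delta> \<and> (\<forall>v\<in>V. {v} \<in> \<Delta>) \<and>
     (\<forall>\<sigma>\<in>\<Delta>. \<forall>\<tau>. \<tau> \<subseteq> \<sigma> \<longrightarrow> \<tau> \<in> \<Delta>)"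

definition face_dim :: "nat set \<Rightarrow> int" where
  "face_dim \<sigma> = int (card \<sigma>) - 1"

definition complex_dim :: "nat set set \<Rightarrow> int" where
  "complex_dim \<Delta> = Max (face_dim ` \<Delta>)"

definition link :: "nat set set \<Rightarrow> nat set \<Rightarrow> nat set set" where
  "link \<Delta> \<sigma> = {\<tau> \<in> \<Delta>. \<tau> \<inter> \<sigma> = {} \<and> \<tau> \<union> \<sigma> \<in> \<Delta>}"

definition elementary_collapse :: "nat set set \<Rightarrow> nat set set \<Rightarrow> bool" where
  "elementary_collapse \<Delta> \<Delta>' \<longleftrightarrow>
     (\<exists>\<sigma>\<in>\<Delta>. \<exists>\<tau>. {\<rho> \<in> \<Delta>. \<sigma> \<subset> \<rho>} = {\<tau>} \<and> \<Delta>' = \<Delta> - {\<sigma>, \<tau>})"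

definition collapsible :: "nat set set \<Rightarrow> bool" where
  "collapsible \<Delta> \<longleftrightarrow> (\<exists>v. elementary_collapse\<^sup>*\<^sup>* \<Delta> {{}, {v}})"


section \<open>Reduced simplicial homology and Cohen-Macaulay complexes\<close>

text \<open>
  Chains are formal linear combinations of faces, each face oriented by the order of its
  vertices. The empty face spans the chains of degree \<open>-1\<close>, so this is the augmented complex.
\<close>

definition chains :: "nat set set \<Rightarrow> int \<Rightarrow> (nat set \<Rightarrow>\<^sub>0 'k::field) set" where
  "chains \<Delta> i = {c. \<forall>\<sigma>\<in>Poly_Mapping.keys c. \<sigma> \<in> \<Delta> \<and> face_dim \<sigma> = i}"

definition boundary :: "(nat set \<Rightarrow>\<^sub>0 'k::field) \<Rightarrow> (nat set \<Rightarrow>\<^sub>0 'k)" where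
  "boundary c = (\<Sum>\<sigma>\<in>Poly_Mapping.keys c. \<Sum>v\<in>\<sigma>.
     Poly_Mapping.single (\<sigma> - {v}) ((-1) ^ card {u \<in> \<sigma>. u < v} * Poly_Mapping.lookup c \<sigma>))"

definition cycles :: "nat set set \<Rightarrow> int \<Rightarrow> (nat set \<Rightarrow>\<^sub>0 'k::field) set" where
  "cycles \<Delta> i = {c \<in> chains \<Delta> i. boundary c = 0}"

definition boundaries :: "nat set set \<Rightarrow> int \<Rightarrow> (nat set \<Rightarrow>\<^sub>0 'k::field) set" where
  "boundaries \<Delta> i = boundary ` chains \<Delta> (i + 1)"

text \<open>
  Vanishing of the quotient of cycles by boundaries. The coefficient field is passed as a type
  argument, here and below.
\<close>

definition reduced_homology_vanishes :: "'k::field itself \<Rightarrow> nat set set \<Rightarrow> int \<Rightarrow> bool" where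
  "reduced_homology_vanishes K \<Delta> i \<longleftrightarrow>
     (cycles \<Delta> i :: (nat set \<Rightarrow>\<^sub>0 'k) set) = boundaries \<Delta> i"

definition Cohen_Macaulay_complex :: "'k::field itself \<Rightarrow> nat set set \<Rightarrow> bool" where
  "Cohen_Macaulay_complex K \<Delta> \<longleftrightarrow>
     (\<forall>\<sigma>\<in>\<Delta>. \<forall>i < complex_dim (link \<Delta> \<sigma>). reduced_homology_vanishes K (link \<Delta> \<sigma>) i)"


section \<open>The polynomial ring and its graded quotients\<close>

text \<open>
  A polynomial is a finitely supported map from exponent vectors to coefficients;
  \<open>mpoly_ring n\<close> is the ring of those in which only the variables with index in \<open>{1..n}\<close> occur.
\<close>

type_synonym 'k mpoly = "(nat \<Rightarrow>\<^sub>0 nat) \<Rightarrow>\<^sub>0 'k"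

definition mpoly_ring :: "nat \<Rightarrow> ('k::field mpoly) ring" where
  "mpoly_ring n =
     \<lparr>carrier = {p. \<forall>m\<in>Poly_Mapping.keys p. Poly_Mapping.keys m \<subseteq> {1..n}},
      mult = (*), one = 1, zero = 0, add = (+)\<rparr>"

definition Const :: "'k::field \<Rightarrow> 'k mpoly" where
  "Const c = Poly_Mapping.single 0 c"

definition Var :: "nat \<Rightarrow> 'k::field mpoly" where
  "Var i = Poly_Mapping.single (Poly_Mapping.single i 1) 1"

definition monomial_degree :: "(nat \<Rightarrow>\<^sub>0 nat) \<Rightarrow> nat" where
  "monomial_degree m = (\<Sum>i\<in>Poly_Mapping.keys m. Poly_Mapping.lookup m i)"

definition total_degree :: "'k::field mpoly \<Rightarrow> nat" where
  "total_degree p = Max (insert 0 (monomial_degree ` Poly_Mapping.keys p))"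

definition homogeneous :: "nat \<Rightarrow> 'k::field mpoly \<Rightarrow> bool" where
  "homogeneous e p \<longleftrightarrow> (\<forall>m\<in>Poly_Mapping.keys p. monomial_degree m = e)"

text \<open>
  Elements of a quotient ring are cosets, so its scalars and graded pieces are sets of cosets;
  dimensions are over \<open>quot_scalars n J\<close>, the image of the coefficient field.
\<close>

definition quot_scalars :: "nat \<Rightarrow> ('k::field mpoly) set \<Rightarrow> ('k mpoly) set set" where
  "quot_scalars n J = (\<lambda>c. J +>\<^bsub>mpoly_ring n\<^esub> Const c) ` UNIV"

definition quot_graded :: "nat \<Rightarrow> ('k::field mpoly) set \<Rightarrow> nat \<Rightarrow> ('k mpoly) set set" where
  "quot_graded n J t =
     (\<lambda>p. J +>\<^bsub>mpoly_ring n\<^esub> p) ` {p \<in> carrier (mpoly_ring n). homogeneous t p}"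

definition hilbert_function :: "nat \<Rightarrow> ('k::field mpoly) set \<Rightarrow> nat \<Rightarrow> nat" where
  "hilbert_function n J t =
     ring.dim (mpoly_ring n Quot J) (quot_scalars n J) (quot_graded n J t)"

definition hilbert_series :: "nat \<Rightarrow> ('k::field mpoly) set \<Rightarrow> int fps" where
  "hilbert_series n J = Abs_fps (\<lambda>t. int (hilbert_function n J t))"


section \<open>Stanley-Reisner ideals\<close>

definition stanley_reisner_ideal :: "nat \<Rightarrow> nat set set \<Rightarrow> ('k::field mpoly) set" where
  "stanley_reisner_ideal n \<Delta> = Idl\<^bsub>mpoly_ring n\<^esub> {\<Prod>i\<in>\<sigma>. Var i |\<sigma>. \<sigma> \<subseteq> {1..n} \<and> \<sigma> \<notin> \<Delta>}"

text \<open>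
  The Hilbert series of the Stanley-Reisner ring is \<open>h(x) / (1 - x)^(d+1)\<close> with
  \<open>d = complex_dim \<Delta>\<close>; the defining equation clears the denominator.
\<close>

definition h_polynomial :: "'k::field itself \<Rightarrow> nat \<Rightarrow> nat set set \<Rightarrow> int poly" where
  "h_polynomial K n \<Delta> =
     (THE h. hilbert_series n (stanley_reisner_ideal n \<Delta> :: ('k mpoly) set)
               * (1 - fps_X) ^ nat (complex_dim \<Delta> + 1) = fps_of_poly h)"

definition SR_plus :: "nat \<Rightarrow> nat set set \<Rightarrow> ('k::field mpoly) set \<Rightarrow> ('k mpoly) set" where
  "SR_plus n \<Delta> S = stanley_reisner_ideal n \<Delta> <+>\<^bsub>mpoly_ring n\<^esub> Idl\<^bsub>mpoly_ring n\<^esub> S"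

text \<open>
  As usual, the elements of a homogeneous system of parameters have positive degree; otherwise
  any sequence containing a nonzero constant would qualify.
\<close>

definition hsop :: "nat \<Rightarrow> nat set set \<Rightarrow> nat \<Rightarrow> (nat \<Rightarrow> 'k::field mpoly) \<Rightarrow> bool" where
  "hsop n \<Delta> d \<theta> \<longleftrightarrow>
     (\<forall>i\<in>{1..d+1}. \<theta> i \<in> carrier (mpoly_ring n) \<and> (\<exists>e>0. homogeneous e (\<theta> i))) \<and>
     (let J = SR_plus n \<Delta> (\<theta> ` {1..d+1}); A = mpoly_ring n Quot J
      in ring.finite_dimension A (quot_scalars n J) (carrier A))"

definition A_ideal :: "nat \<Rightarrow> nat set set \<Rightarrow> nat \<Rightarrow> ('k::field mpoly) set" where
  "A_ideal n \<Delta> a = SR_plus n \<Delta> ((\<lambda>i. Var i ^ a) ` {1..n})"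

end

theory Submission
  imports Defs "HOL-Library.Function_Algebras"
begin

text \<open>
  If \<open>\<theta>\<close> satisfies (1), the quotient by \<open>J = I\<^sub>\<Delta> + (\<theta>)\<close> vanishes in every degree
  \<open>t > d (a - 1)\<close>: deleting a free pair \<open>\<sigma> \<subset> \<tau> = \<sigma> \<union> {v}\<close>, the relation \<open>x\<^sub>1 + \<dots> + x\<^sub>n \<in> J\<close> trades
  \<open>x\<^sub>v\<close> for variables of \<open>\<sigma>\<close>, and a monomial of degree \<open>t\<close> in at most \<open>d\<close> variables is divisible by
  some \<open>x\<^sub>i\<^sup>a\<close>. Collapsing down to nothing, every monomial of degree \<open>t\<close> lies in \<open>J\<close>.

  On the other hand \<open>\<theta>\<close> is a regular sequence on the Cohen-Macaulay ring \<open>R/I\<^sub>\<Delta>\<close>, so the Hilbert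
  series of \<open>R/J\<close> is \<open>h\<^sub>\<Delta>(x)\<close> times all \<open>1 + x + \<dots> + x\<^bsup>deg \<theta>\<^sub>j - 1\<^esup>\<close>, whose leading term has the
  degree \<open>t\<close> of (2). Regularity is Reisner's theorem. Its proof uses the partition complex
  of Adiprasito and Yashfe, in the dual setting of functionals on \<open>R\<close> that vanish on \<open>I\<^sub>\<Delta>\<close>, where
  duals of stars embed into the dual of the whole complex and simplicial homology appears directly.
\<close>

section \<open>Exterior operators and Koszul complexes\<close>

text \<open>Passing to functionals turns regularity into a vanishing statement: in the Koszul
  cochain complex of the dual of R/I_\<Delta>, degree 0 cohomology consists of the functionals
  killed by all \<theta>_j, the dual of R/J, and regularity is exactness in positive degrees. In
  degree t the collapses kill the degree 0 cohomology too, so the Euler characteristic of a finite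
  complex is 0, while counting monomials evaluates the same number as a leading coefficient. The
  obstacle is that an induction over links keeps \<theta> fixed, although \<theta> has more elements
  than the dimension of a link allows. Exactness is therefore claimed in degrees above s - r, for s
  parameters and a depth bound r. A cone point raises r by one: x_v acts surjectively on the dual of
  a cone, and by (1) a power of x_v acts as an element of (\<theta>), which annihilates Koszul
  cohomology. Stars of nonempty faces reach the full bound in this way, and the partition complex
  carries it over to \<Delta>.\<close>

lemma sum_fun_apply: "(\<Sum>i\<in>A. f i) x = (\<Sum>i\<in>A. f i x)"
  by (induction A rule: infinite_finite_induct) simp_all

text \<open>The terms off the diagonal cancel in pairs. The diagonal is a separate hypothesis
  because a = -a does not force a = 0 in an arbitrary abelian group.\<close>

lemma sum_alternating_eq_0:
  fixes a :: "'i \<Rightarrow> 'i \<Rightarrow> 'b::ab_group_add"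
  assumes "finite S" "\<And>j. a j j = 0" "\<And>j k. a j k = - a k j"
  shows "(\<Sum>j\<in>S. \<Sum>k\<in>S. a j k) = 0"
  using assms(1)
proof induction
  case (insert x S)
  have "(\<Sum>j\<in>insert x S. \<Sum>k\<in>insert x S. a j k) =
      (\<Sum>k\<in>S. a x k) + (\<Sum>j\<in>S. a j x) + (\<Sum>j\<in>S. \<Sum>k\<in>S. a j k)"
    using insert assms(2) by (simp add: sum.distrib)
  also have "(\<Sum>j\<in>S. a j x) = - (\<Sum>k\<in>S. a x k)"
    using assms(3) by (metis (mono_tags, lifting) sum.cong sum_negf)
  finally show ?case
    using insert.IH by simp
qed simp

text \<open>The sign of moving j past the smaller elements of T, as in \<open>boundary\<close>.
  Counting strictly below j makes it blind to whether j lies in T, so one expression serves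
  insertion and removal.\<close>

definition ksign :: "nat \<Rightarrow> nat set \<Rightarrow> 'r::comm_ring_1" where
  "ksign j T = (-1) ^ card {u \<in> T. u < j}"

lemma ksign_mult_self [simp]: "ksign j T * ksign j T = 1"
  by (simp add: ksign_def flip: power_mult_distrib)

lemma ksign_insert:
  assumes "k \<notin> T"
  shows "ksign j (insert k T) = (if k < j then - ksign j T else ksign j T)"
proof (cases "k < j")
  case True
  have "{u \<in> insert k T. u < j} = insert k {u \<in> T. u < j}"
    using True by auto
  then show ?thesis
    using True assms by (simp add: ksign_def)
next
  case False
  then have "{u \<in> insert k T. u < j} = {u \<in> T. u < j}"
    by auto
  then show ?thesis
    using False by (simp add: ksign_def)
qed

lemma ksign_insert_self [simp]: "ksign j (insert j T) = ksign j T"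
proof -
  have "{u \<in> insert j T. u < j} = {u \<in> T. u < j}"
    by auto
  then show ?thesis
    by (simp add: ksign_def)
qed

lemma ksign_remove:
  assumes "k \<in> T"
  shows "(ksign j (T - {k}) :: 'r::comm_ring_1) = (if k < j then - ksign j T else ksign j T)"
proof -
  have "(ksign j (insert k (T - {k})) :: 'r) = (if k < j then - ksign j (T - {k}) else ksign j (T - {k}))"
    by (rule ksign_insert) simp
  moreover have "insert k (T - {k}) = T"
    using assms by auto
  ultimately show ?thesis
    by simp
qed

lemma ksign_remove_self [simp]: "ksign j (T - {j}) = ksign j T"
  by (metis ksign_insert_self insert_Diff_single)

section \<open>Exterior algebra and Koszul differential with coefficients in a module\<close>

locale koszul_module = Modules.module
begin

text \<open>A function \<open>f\<close> stands for an element of the exterior algebra over the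
  module, \<open>f T\<close> being the coefficient of the basis element e_T. Then
  \<open>wedge j\<close> multiplies by e_j from the left, and \<open>contract j\<close> is the
  interior product dual to it.\<close>

definition wedge :: "nat \<Rightarrow> (nat set \<Rightarrow> 'b) \<Rightarrow> nat set \<Rightarrow> 'b" where
  "wedge j f T = (if j \<in> T then ksign j T *s f (T - {j}) else 0)"

definition contract :: "nat \<Rightarrow> (nat set \<Rightarrow> 'b) \<Rightarrow> nat set \<Rightarrow> 'b" where
  "contract j f T = (if j \<in> T then 0 else ksign j T *s f (insert j T))"

lemma wedge_wedge: "wedge j (wedge k f) T = - wedge k (wedge j f) T"
proof (cases "j \<in> T \<and> k \<in> T \<and> j \<noteq> k")
  case True
  have "T - {j} - {k} = T - {k} - {j}"
    by auto
  with True show ?thesis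
    by (auto simp: wedge_def ksign_remove mult.commute)
qed (auto simp: wedge_def)

lemma contract_contract: "contract j (contract k f) T = - contract k (contract j f) T"
  by (auto simp: contract_def ksign_insert insert_commute mult.commute)

lemma wedge_self: "wedge j (wedge j f) T = 0"
  by (simp add: wedge_def)

lemma contract_self: "contract j (contract j f) T = 0"
  by (simp add: contract_def)

text \<open>The canonical anticommutation relation. It is the source of both homotopies used later:
  the annihilation of Koszul cohomology by (\<theta>), and the contraction of a cone.\<close>

lemma wedge_contract:
  "wedge j (contract k f) T + contract k (wedge j f) T = (if j = k then f T else 0)"
proof (cases "j = k")
  case True
  then show ?thesis
    by (auto simp: wedge_def contract_def insert_absorb)
next
  case False
  then have "insert k (T - {j}) = insert k T - {j}"
    by auto
  with False show ?thesis
    by (auto simp: wedge_def contract_def ksign_remove ksign_insert mult.commute)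
qed

lemma wedge_scale: "wedge j (\<lambda>T. c *s f T) T = c *s wedge j f T"
  by (simp add: wedge_def mult.commute)

lemma contract_scale: "contract j (\<lambda>T. c *s f T) T = c *s contract j f T"
  by (simp add: contract_def mult.commute)

lemma wedge_sum: "wedge j (\<lambda>T. \<Sum>i\<in>I. f i T) T = (\<Sum>i\<in>I. wedge j (f i) T)"
  by (simp add: wedge_def scale_sum_right)

lemma contract_sum: "contract j (\<lambda>T. \<Sum>i\<in>I. f i T) T = (\<Sum>i\<in>I. contract j (f i) T)"
  by (simp add: contract_def scale_sum_right)

text \<open>The simplicial boundary operator with coefficients in the module, when the index sets
  are read as faces.\<close>

definition contract_all :: "nat set \<Rightarrow> (nat set \<Rightarrow> 'b) \<Rightarrow> nat set \<Rightarrow> 'b" where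
  "contract_all V f T = (\<Sum>v\<in>V. contract v f T)"

text \<open>Coning with apex v is a contracting homotopy for the boundary operator.\<close>

lemma contract_all_wedge:
  assumes "finite V" "v \<in> V"
  shows "contract_all V (wedge v f) T + wedge v (contract_all V f) T = f T"
proof -
  have "contract_all V (wedge v f) T + wedge v (contract_all V f) T =
      (\<Sum>k\<in>V. wedge v (contract k f) T + contract k (wedge v f) T)"
    by (simp add: contract_all_def[abs_def] wedge_sum sum.distrib add.commute)
  also have "\<dots> = f T"
    using assms by (simp add: wedge_contract)
  finally show ?thesis .
qed

lemma contract_all_contract_all:
  assumes "finite V"
  shows "contract_all V (contract_all V f) T = 0"
proof -
  have "contract_all V (contract_all V f) T = (\<Sum>j\<in>V. \<Sum>k\<in>V. contract j (contract k f) T)"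
    by (simp add: contract_all_def[abs_def] contract_sum)
  also have "\<dots> = 0"
    by (rule sum_alternating_eq_0[OF assms]) (rule contract_self, rule contract_contract)
  finally show ?thesis .
qed

text \<open>Multiplication by the sum of \<theta>_j e_j. This raises the size of T, so cocycles in
  size 0 are the elements killed by all \<theta>_j.\<close>

definition koszul :: "(nat \<Rightarrow> 'a) \<Rightarrow> nat \<Rightarrow> (nat set \<Rightarrow> 'b) \<Rightarrow> nat set \<Rightarrow> 'b" where
  "koszul \<theta> s f T = (\<Sum>j\<in>{1..s}. \<theta> j *s wedge j f T)"

lemma koszul_koszul: "koszul \<theta> s (koszul \<theta> s f) T = 0"
proof -
  have "koszul \<theta> s (koszul \<theta> s f) T =
      (\<Sum>j\<in>{1..s}. \<Sum>k\<in>{1..s}. (\<theta> j * \<theta> k) *s wedge j (wedge k f) T)"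
    by (simp add: koszul_def[abs_def] wedge_sum wedge_scale scale_sum_right)
  also have "\<dots> = 0"
  proof (rule sum_alternating_eq_0)
    fix j k
    show "(\<theta> j * \<theta> k) *s wedge j (wedge k f) T = - ((\<theta> k * \<theta> j) *s wedge k (wedge j f) T)"
      by (subst wedge_wedge) (simp add: mult.commute)
  qed (simp_all add: wedge_self)
  finally show ?thesis .
qed

lemma koszul_zero [simp]: "koszul \<theta> s (\<lambda>T. 0) T = 0"
  by (simp add: koszul_def wedge_def cong: if_cong)

lemma koszul_diff: "koszul \<theta> s (\<lambda>T. f T - g T) T = koszul \<theta> s f T - koszul \<theta> s g T"
proof -
  have "wedge j (\<lambda>T. f T - g T) T = wedge j f T - wedge j g T" for j
    by (simp add: wedge_def scale_right_diff_distrib)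
  then show ?thesis
    by (simp add: koszul_def scale_right_diff_distrib sum_subtractf)
qed

text \<open>The Koszul homology is annihilated by the ideal generated by \<open>\<theta>\<close>.\<close>
lemma koszul_homotopy:
  assumes "\<And>T. koszul \<theta> s f T = 0"
  shows "koszul \<theta> s (\<lambda>T. \<Sum>k\<in>{1..s}. c k *s contract k f T) T =
    (\<Sum>j\<in>{1..s}. c j * \<theta> j) *s f T"
proof -
  let ?h = "\<lambda>f T. \<Sum>k\<in>{1..s}. c k *s contract k f T"
  have 1: "koszul \<theta> s (?h f) T = (\<Sum>j\<in>{1..s}. \<Sum>k\<in>{1..s}. (c k * \<theta> j) *s wedge j (contract k f) T)"
    unfolding koszul_def wedge_sum wedge_scale scale_sum_right scale_scale by (simp only: mult.commute)
  have "?h (koszul \<theta> s f) T = (\<Sum>k\<in>{1..s}. \<Sum>j\<in>{1..s}. (c k * \<theta> j) *s contract k (wedge j f) T)"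
    unfolding koszul_def[abs_def] contract_sum contract_scale scale_sum_right scale_scale by (rule refl)
  also have "\<dots> = (\<Sum>j\<in>{1..s}. \<Sum>k\<in>{1..s}. (c k * \<theta> j) *s contract k (wedge j f) T)"
    by (rule sum.swap)
  finally have 2: "?h (koszul \<theta> s f) T = \<dots>" .
  have "koszul \<theta> s (?h f) T + ?h (koszul \<theta> s f) T =
      (\<Sum>j\<in>{1..s}. \<Sum>k\<in>{1..s}. (c k * \<theta> j) *s (wedge j (contract k f) T + contract k (wedge j f) T))"
    unfolding 1 2 by (simp only: sum.distrib scale_right_distrib)
  also have "\<dots> = (\<Sum>j\<in>{1..s}. (c j * \<theta> j) *s f T)"
    by (rule sum.cong[OF refl]) (simp add: wedge_contract if_distrib cong: if_cong)
  also have "\<dots> = (\<Sum>j\<in>{1..s}. c j * \<theta> j) *s f T"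
    by (simp add: scale_sum_left)
  finally have "koszul \<theta> s (?h f) T + ?h (koszul \<theta> s f) T = (\<Sum>j\<in>{1..s}. c j * \<theta> j) *s f T" .
  moreover have "contract k (koszul \<theta> s f) T = 0" for k
    by (simp add: contract_def assms)
  then have "?h (koszul \<theta> s f) T = 0"
    by simp
  ultimately show ?thesis
    by simp
qed

definition cochains :: "nat \<Rightarrow> nat \<Rightarrow> 'b set \<Rightarrow> (nat set \<Rightarrow> 'b) set" where
  "cochains s i A = {f. \<forall>T. f T \<in> A \<and> (f T \<noteq> 0 \<longrightarrow> T \<subseteq> {1..s} \<and> card T = i)}"

lemma wedge_mem: "subspace A \<Longrightarrow> (\<And>T. f T \<in> A) \<Longrightarrow> wedge j f T \<in> A"
  by (simp add: wedge_def subspace_0 subspace_scale)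

lemma koszul_cochains:
  assumes "subspace A" "f \<in> cochains s i A"
  shows "koszul \<theta> s f \<in> cochains s (Suc i) A"
proof -
  have "koszul \<theta> s f T \<in> A" for T
    using assms unfolding koszul_def cochains_def
    by (auto intro!: subspace_sum subspace_scale wedge_mem)
  moreover have "T \<subseteq> {1..s} \<and> card T = Suc i" if nz: "koszul \<theta> s f T \<noteq> 0" for T
  proof -
    obtain j where j: "j \<in> {1..s}" "wedge j f T \<noteq> 0"
      using nz sum.neutral[of "{1..s}" "\<lambda>j. \<theta> j *s wedge j f T"] unfolding koszul_def by (metis scale_zero_right)
    then have "j \<in> T" and "f (T - {j}) \<noteq> 0"
      by (auto simp: wedge_def split: if_splits)
    then have "T - {j} \<subseteq> {1..s}" "card (T - {j}) = i"
      using assms(2) unfolding cochains_def by blast+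
    moreover from this have "finite T"
      using finite_subset[of "T - {j}" "{1..s}"] by simp
    ultimately have "card T = Suc i"
      using card.remove[of T j] \<open>j \<in> T\<close> by metis
    with \<open>T - {j} \<subseteq> {1..s}\<close> j(1) show ?thesis
      by auto
  qed
  ultimately show ?thesis
    by (auto simp: cochains_def)
qed

text \<open>Exactness of the Koszul complex of \<open>A\<close> in cohomological degree \<open>i + 1\<close>.\<close>
definition koszul_exact :: "(nat \<Rightarrow> 'a) \<Rightarrow> nat \<Rightarrow> 'b set \<Rightarrow> nat \<Rightarrow> bool" where
  "koszul_exact \<theta> s A i \<longleftrightarrow>
     (\<forall>f\<in>cochains s (Suc i) A. koszul \<theta> s f = (\<lambda>T. 0) \<longrightarrow> (\<exists>g\<in>cochains s i A. f = koszul \<theta> s g))"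

text \<open>\<open>{1..s}\<close> has no subset of size \<open>Suc i\<close>. Descending inductions
  on the degree start here.\<close>

lemma koszul_exact_trivial:
  assumes "subspace A" "s < Suc i"
  shows "koszul_exact \<theta> s A i"
proof -
  have "f = (\<lambda>T. 0)" if "f \<in> cochains s (Suc i) A" for f
  proof
    fix T
    show "f T = 0"
    proof (rule ccontr)
      assume "f T \<noteq> 0"
      then have "T \<subseteq> {1..s}" "card T = Suc i"
        using that by (auto simp: cochains_def)
      then show False
        using card_mono[of "{1..s}" T] assms(2) by simp
    qed
  qed
  moreover have "(\<lambda>T. 0) \<in> cochains s i A"
    using assms(1) by (simp add: cochains_def subspace_0)
  moreover have "koszul \<theta> s (\<lambda>T. 0) = (\<lambda>T. 0)"
    by (rule ext) simp
  ultimately show ?thesis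
    unfolding koszul_exact_def by metis
qed

end

section \<open>Koszul cohomology along a short exact sequence\<close>

locale koszul_hom = m1: koszul_module s1 + m2: koszul_module s2 + module_hom s1 s2 \<phi>
  for s1 :: "'r::comm_ring_1 \<Rightarrow> 'b::ab_group_add \<Rightarrow> 'b"
    and s2 :: "'r \<Rightarrow> 'c::ab_group_add \<Rightarrow> 'c" and \<phi> :: "'b \<Rightarrow> 'c"
begin

lemma koszul_comp: "m2.koszul \<theta> s (\<lambda>T. \<phi> (f T)) T = \<phi> (m1.koszul \<theta> s f T)"
  by (simp add: m1.koszul_def m2.koszul_def m1.wedge_def m2.wedge_def sum scale zero if_distrib cong: if_cong)

text \<open>The connecting map of the long exact sequence for \<open>0 \<rightarrow> B \<rightarrow> A \<rightarrow> \<phi> A \<rightarrow> 0\<close> vanishes.\<close>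
lemma cocycle_lift:
  assumes A: "m1.subspace A" and ex: "m1.koszul_exact \<theta> s {x \<in> A. \<phi> x = 0} i"
    and f: "f \<in> m2.cochains s i (\<phi> ` A)" and f0: "m2.koszul \<theta> s f = (\<lambda>T. 0)"
  shows "\<exists>p\<in>m1.cochains s i A. (\<forall>T. \<phi> (p T) = f T) \<and> m1.koszul \<theta> s p = (\<lambda>T. 0)"
proof -
  let ?B = "{x \<in> A. \<phi> x = 0}"
  \<comment> \<open>The value 0 is chosen wherever \<open>f\<close> vanishes, so that the lift stays
    supported on subsets of size i.\<close>
  define p where "p T = (if f T = 0 then 0 else SOME x. x \<in> A \<and> \<phi> x = f T)" for T
  have p: "p T \<in> A \<and> \<phi> (p T) = f T" for T
  proof (cases "f T = 0")
    case True
    then show ?thesis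
      using A by (simp add: p_def m1.subspace_0 zero)
  next
    case False
    have "\<exists>x. x \<in> A \<and> \<phi> x = f T"
      using f unfolding m2.cochains_def by (auto simp: image_iff) metis
    from someI_ex[OF this] False show ?thesis
      by (simp add: p_def)
  qed
  have pc: "p \<in> m1.cochains s i A"
    using p f by (auto simp: m1.cochains_def m2.cochains_def p_def split: if_splits)
  have "\<phi> (m1.koszul \<theta> s p T) = 0" for T
    using koszul_comp[of \<theta> s p T] p f0 by (simp add: fun_eq_iff)
  \<comment> \<open>The differential of the lift is a cocycle with values in the kernel, hence the
    differential of some \<open>q\<close> with values there. The corrected lift \<open>p - q\<close>
    has the same image and is a cocycle.\<close>
  then have "m1.koszul \<theta> s p \<in> m1.cochains s (Suc i) ?B"
    using m1.koszul_cochains[OF A pc, of \<theta>] by (auto simp: m1.cochains_def)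
  moreover have "m1.koszul \<theta> s (m1.koszul \<theta> s p) = (\<lambda>T. 0)"
    by (rule ext) (rule m1.koszul_koszul)
  ultimately obtain q where q: "q \<in> m1.cochains s i ?B" "m1.koszul \<theta> s p = m1.koszul \<theta> s q"
    using ex unfolding m1.koszul_exact_def by blast
  show ?thesis
  proof (intro bexI[of _ "\<lambda>T. p T - q T"] conjI allI ext)
    show "(\<lambda>T. p T - q T) \<in> m1.cochains s i A"
      unfolding m1.cochains_def
    proof (intro CollectI allI conjI impI)
      fix T
      show "p T - q T \<in> A"
        using pc q(1) A by (simp add: m1.cochains_def m1.subspace_diff)
      assume "p T - q T \<noteq> 0"
      then have "p T \<noteq> 0 \<or> q T \<noteq> 0"
        by auto
      then show "T \<subseteq> {1..s}" "card T = i"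
        using pc q(1) unfolding m1.cochains_def by blast+
    qed
    show "\<phi> (p T - q T) = f T" for T
      using p q(1) by (auto simp: m1.cochains_def diff)
    show "m1.koszul \<theta> s (\<lambda>T. p T - q T) T = 0" for T
      using q(2) by (simp add: m1.koszul_diff)
  qed
qed

text \<open>In the long exact sequence, degree i + 1 of the image lies between degree i + 1 of
  \<open>A\<close> and degree i + 2 of the kernel.\<close>

lemma koszul_exact_image:
  assumes A: "m1.subspace A" and exB: "m1.koszul_exact \<theta> s {x \<in> A. \<phi> x = 0} (Suc i)"
    and exA: "m1.koszul_exact \<theta> s A i"
  shows "m2.koszul_exact \<theta> s (\<phi> ` A) i"
proof -
  show ?thesis
    unfolding m2.koszul_exact_def
  proof (intro ballI impI)
    fix f
    assume "f \<in> m2.cochains s (Suc i) (\<phi> ` A)" "m2.koszul \<theta> s f = (\<lambda>T. 0)"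
    from cocycle_lift[OF A exB this] obtain p where
      p: "p \<in> m1.cochains s (Suc i) A" "\<And>T. \<phi> (p T) = f T" "m1.koszul \<theta> s p = (\<lambda>T. 0)"
      by blast
    then obtain r where r: "r \<in> m1.cochains s i A" "p = m1.koszul \<theta> s r"
      using exA unfolding m1.koszul_exact_def by blast
    show "\<exists>g\<in>m2.cochains s i (\<phi> ` A). f = m2.koszul \<theta> s g"
    proof (intro bexI[of _ "\<lambda>T. \<phi> (r T)"] ext)
      show "f T = m2.koszul \<theta> s (\<lambda>T. \<phi> (r T)) T" for T
        using koszul_comp[of \<theta> s r T] p(2) r(2) by simp
      show "(\<lambda>T. \<phi> (r T)) \<in> m2.cochains s i (\<phi> ` A)"
        unfolding m2.cochains_def
      proof (intro CollectI allI conjI impI)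
        fix T
        show "\<phi> (r T) \<in> \<phi> ` A"
          using r(1) by (simp add: m1.cochains_def)
        assume "\<phi> (r T) \<noteq> 0"
        then have "r T \<noteq> 0"
          using zero by metis
        then show "T \<subseteq> {1..s}" "card T = i"
          using r(1) unfolding m1.cochains_def by blast+
      qed
    qed
  qed
qed

end

text \<open>Surjectivity of x and exactness of its kernel one degree higher make every cocycle
  divisible by x among cocycles, hence divisible by x^N. But x^N acts as an element of the ideal
  (\<theta>), which maps cocycles to coboundaries.\<close>

lemma (in koszul_module) koszul_exact_of_kernel:
  assumes A: "subspace A" and surj: "(\<lambda>y. x *s y) ` A = A"
    and ex: "koszul_exact \<theta> s {y \<in> A. x *s y = 0} (Suc i)"
    and nil: "\<And>y. y \<in> A \<Longrightarrow> x ^ N *s y = (\<Sum>j\<in>{1..s}. c j * \<theta> j) *s y"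
  shows "koszul_exact \<theta> s A i"
  unfolding koszul_exact_def
proof (intro ballI impI)
  fix f
  assume f: "f \<in> cochains s (Suc i) A" "koszul \<theta> s f = (\<lambda>T. 0)"
  interpret hom: koszul_hom scale scale "\<lambda>y. x *s y"
    by unfold_locales (simp_all add: scale_right_distrib mult.commute)
  have "\<exists>p\<in>cochains s (Suc i) A. (\<forall>T. x ^ k *s p T = f T) \<and> koszul \<theta> s p = (\<lambda>T. 0)" for k
  proof (induction k)
    case 0
    then show ?case
      using f by auto
  next
    case (Suc k)
    then obtain p where p: "p \<in> cochains s (Suc i) ((\<lambda>y. x *s y) ` A)" "\<And>T. x ^ k *s p T = f T"
      "koszul \<theta> s p = (\<lambda>T. 0)"
      using surj by auto
    from hom.cocycle_lift[OF A ex p(1,3)] obtain q where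
      q: "q \<in> cochains s (Suc i) A" "\<And>T. x *s q T = p T" "koszul \<theta> s q = (\<lambda>T. 0)"
      by blast
    have "x ^ Suc k *s q T = f T" for T
      using p(2)[of T] q(2)[of T, symmetric] by (simp add: mult.commute)
    with q show ?case
      by blast
  qed
  from this[of N] obtain p where p: "p \<in> cochains s (Suc i) A" "\<And>T. x ^ N *s p T = f T"
    "koszul \<theta> s p = (\<lambda>T. 0)"
    by blast
  \<comment> \<open>The guarded form displays the support that \<open>cochains\<close> asks for. It
    agrees with the homotopy formula because \<open>p\<close> lives on subsets of size
    \<open>Suc i\<close>.\<close>
  let ?g = "\<lambda>T. if T \<subseteq> {1..s} \<and> card T = i then \<Sum>k\<in>{1..s}. c k *s contract k p T else 0"
  have g: "?g = (\<lambda>T. \<Sum>k\<in>{1..s}. c k *s contract k p T)"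
  proof
    fix T
    have "contract k p T = 0" if "\<not> (T \<subseteq> {1..s} \<and> card T = i)" for k
    proof (rule ccontr)
      assume "contract k p T \<noteq> 0"
      then have "k \<notin> T" "p (insert k T) \<noteq> 0"
        by (auto simp: contract_def split: if_splits)
      then have "insert k T \<subseteq> {1..s}" "card (insert k T) = Suc i"
        using p(1) by (auto simp: cochains_def)
      with \<open>k \<notin> T\<close> that show False
        using finite_subset[of "insert k T" "{1..s}"] by auto
    qed
    then show "?g T = (\<Sum>k\<in>{1..s}. c k *s contract k p T)"
      by auto
  qed
  show "\<exists>g\<in>cochains s i A. f = koszul \<theta> s g"
  proof (intro bexI[of _ ?g] ext)
    show "f T = koszul \<theta> s ?g T" for T
      unfolding g using koszul_homotopy[of \<theta> s p c T] p nil[of "p T"]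
      by (simp add: cochains_def fun_eq_iff)
    have "(\<Sum>k\<in>{1..s}. c k *s contract k p T) \<in> A" for T
      using p(1) A unfolding cochains_def contract_def
      by (auto intro!: subspace_sum subspace_scale simp: subspace_0)
    then show "?g \<in> cochains s i A"
      using A by (auto simp: cochains_def subspace_0)
  qed
qed

section \<open>The contraction action of polynomials on functionals\<close>

lemma keys_add_nat: "Poly_Mapping.keys (m + m' :: 'a \<Rightarrow>\<^sub>0 nat) = Poly_Mapping.keys m \<union> Poly_Mapping.keys m'"
  by (auto simp: in_keys_iff lookup_add)

text \<open>A functional on polynomials is stored by its values on monomials, with no finiteness of
  support. The formula is then q \<mapsto> \<phi>(p q), evaluated at the monomial m: the module
  structure of the full linear dual.\<close>

definition contraction :: "'k::field mpoly \<Rightarrow> ((nat \<Rightarrow>\<^sub>0 nat) \<Rightarrow> 'k) \<Rightarrow> (nat \<Rightarrow>\<^sub>0 nat) \<Rightarrow> 'k" where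
  "contraction p \<phi> m = (\<Sum>m'\<in>Poly_Mapping.keys p. Poly_Mapping.lookup p m' * \<phi> (m' + m))"

lemma contraction_superset:
  assumes "finite A" "Poly_Mapping.keys p \<subseteq> A"
  shows "contraction p \<phi> m = (\<Sum>m'\<in>A. Poly_Mapping.lookup p m' * \<phi> (m' + m))"
  unfolding contraction_def
  by (rule sum.mono_neutral_left[OF assms]) (simp add: in_keys_iff)

lemma contraction_add_left: "contraction (p + q) \<phi> m = contraction p \<phi> m + contraction q \<phi> m"
proof -
  let ?A = "Poly_Mapping.keys p \<union> Poly_Mapping.keys q"
  have "Poly_Mapping.keys (p + q) \<subseteq> ?A"
    by (rule Poly_Mapping.keys_add)
  then show ?thesis
    by (simp add: contraction_superset[of ?A] lookup_add algebra_simps sum.distrib)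
qed

lemma contraction_single: "contraction (Poly_Mapping.single u c) \<phi> m = c * \<phi> (u + m)"
  by (simp add: contraction_superset[of "{u}"])

lemma contraction_zero_left: "contraction 0 \<phi> m = 0"
  by (simp add: contraction_def)

lemma mpoly_sum_monomials:
  fixes p :: "'a \<Rightarrow>\<^sub>0 'b::comm_monoid_add"
  shows "p = (\<Sum>m\<in>Poly_Mapping.keys p. Poly_Mapping.single m (Poly_Mapping.lookup p m))"
  by (rule poly_mapping_eqI) (simp add: lookup_sum lookup_single when_def in_keys_iff)

lemma mpoly_induct [case_names zero single add]:
  fixes p :: "'a \<Rightarrow>\<^sub>0 'b::comm_monoid_add"
  assumes "P 0" "\<And>u c. P (Poly_Mapping.single u c)" "\<And>p q. P p \<Longrightarrow> P q \<Longrightarrow> P (p + q)"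
  shows "P p"
proof -
  have "P (\<Sum>m\<in>A. Poly_Mapping.single m (Poly_Mapping.lookup p m))" if "finite A" for A
    using that by induction (auto intro: assms)
  from this[OF finite_keys] show ?thesis
    using mpoly_sum_monomials[of p] by metis
qed

lemma contraction_add_right: "contraction p (\<phi> + \<psi>) = contraction p \<phi> + contraction p \<psi>"
  by (rule ext) (simp add: contraction_def algebra_simps sum.distrib)

lemma contraction_mult: "contraction (p * q) \<phi> m = contraction p (contraction q \<phi>) m"
proof (induction p arbitrary: m rule: mpoly_induct)
  case zero
  then show ?case
    by (simp add: contraction_zero_left)
next
  case (single u c)
  show ?case
  proof (induction q rule: mpoly_induct)
    case zero
    then show ?case
      by (simp add: contraction_zero_left contraction_single)
  next
    case (single v d)
    then show ?case
      by (simp add: contraction_single mult_single mult.assoc add.assoc add.left_commute)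
  next
    case (add p q)
    then show ?case
      by (simp add: contraction_single contraction_add_left distrib_left)
  qed
next
  case (add p q)
  then show ?case
    by (simp add: contraction_add_left distrib_right)
qed

global_interpretation contr: koszul_module "contraction :: 'k::field mpoly \<Rightarrow> _ \<Rightarrow> _"
proof unfold_locales
  fix a b :: "'k mpoly" and x y :: "(nat \<Rightarrow>\<^sub>0 nat) \<Rightarrow> 'k"
  show "contraction a (x + y) = contraction a x + contraction a y"
    by (rule contraction_add_right)
  show "contraction (a + b) x = contraction a x + contraction b x"
    by (rule ext) (simp add: contraction_add_left)
  show "contraction a (contraction b x) = contraction (a * b) x"
    by (rule ext) (simp add: contraction_mult)
  show "contraction 1 x = x"
    by (rule ext) (simp add: contraction_single flip: single_one)
qed

text \<open>The pointwise action on families indexed by faces. The face index \<tau> and the index T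
  of a Koszul cochain are the two directions of a double complex.\<close>

definition contraction_family ::
    "'k::field mpoly \<Rightarrow> (nat set \<Rightarrow> (nat \<Rightarrow>\<^sub>0 nat) \<Rightarrow> 'k) \<Rightarrow> nat set \<Rightarrow> (nat \<Rightarrow>\<^sub>0 nat) \<Rightarrow> 'k" where
  "contraction_family p w \<tau> = contraction p (w \<tau>)"

global_interpretation family: koszul_module "contraction_family :: 'k::field mpoly \<Rightarrow> _ \<Rightarrow> _"
  by unfold_locales (auto simp: fun_eq_iff contraction_family_def contr.scale_right_distrib
      contr.scale_left_distrib)

text \<open>The functionals on the polynomial ring that vanish on the Stanley-Reisner ideal of \<open>\<Delta>\<close>.\<close>
definition SR_dual :: "nat set set \<Rightarrow> ((nat \<Rightarrow>\<^sub>0 nat) \<Rightarrow> 'k::field) set" where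
  "SR_dual \<Delta> = {\<phi>. \<forall>m. \<phi> m \<noteq> 0 \<longrightarrow> Poly_Mapping.keys m \<in> \<Delta>}"

text \<open>A complex without a condition on vertices: links, stars and partially collapsed
  complexes need not retain all vertices.\<close>

definition down_closed :: "nat set set \<Rightarrow> bool" where
  "down_closed \<Delta> \<longleftrightarrow> (\<forall>\<sigma>\<in>\<Delta>. \<forall>\<tau>. \<tau> \<subseteq> \<sigma> \<longrightarrow> \<tau> \<in> \<Delta>)"

lemma down_closedD: "down_closed \<Delta> \<Longrightarrow> \<sigma> \<in> \<Delta> \<Longrightarrow> \<tau> \<subseteq> \<sigma> \<Longrightarrow> \<tau> \<in> \<Delta>"
  by (auto simp: down_closed_def)

lemma contraction_SR_dual:
  assumes "down_closed \<Delta>" "\<phi> \<in> SR_dual \<Delta>"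
  shows "contraction p \<phi> \<in> SR_dual \<Delta>"
  unfolding SR_dual_def
proof (intro CollectI allI impI)
  fix m
  assume "contraction p \<phi> m \<noteq> 0"
  then obtain m' where "\<phi> (m' + m) \<noteq> 0"
    unfolding contraction_def by (metis (no_types, lifting) mult_zero_right sum.neutral)
  then have "Poly_Mapping.keys (m' + m) \<in> \<Delta>"
    using assms(2) by (auto simp: SR_dual_def)
  then show "Poly_Mapping.keys m \<in> \<Delta>"
    using assms(1) by (auto simp: keys_add_nat intro: down_closedD)
qed

lemma subspace_SR_dual: "down_closed \<Delta> \<Longrightarrow> contr.subspace (SR_dual \<Delta>)"
  by (intro contr.subspaceI contraction_SR_dual) (auto simp: SR_dual_def, metis add.right_neutral)

lemma contraction_Var: "contraction (Var v) \<phi> m = \<phi> (Poly_Mapping.single v 1 + m)"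
  by (simp add: Var_def contraction_single)

lemma keys_single_add [simp]:
  "Poly_Mapping.keys (Poly_Mapping.single v (Suc 0) + m) = insert v (Poly_Mapping.keys m)"
  by (auto simp: keys_add_nat)

lemma exponent_remove:
  assumes "v \<in> Poly_Mapping.keys m"
  shows "Poly_Mapping.single v (Suc 0) + (m - Poly_Mapping.single v (Suc 0)) = m"
  using assms by (intro poly_mapping_eqI) (auto simp: lookup_add lookup_minus lookup_single when_def in_keys_iff)

section \<open>Vanishing of Koszul homology for Cohen-Macaulay complexes\<close>

text \<open>For functionals the scalars are polynomials, so the signs in \<open>wedge\<close> and
  \<open>contract\<close> are constant polynomials. They act as the same signs in the field.\<close>

lemma contraction_ksign: "contraction (ksign v \<tau>) \<phi> m = ksign v \<tau> * \<phi> m"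
proof -
  have "contraction ((-1) ^ k) \<phi> = (\<lambda>m. (-1) ^ k * \<phi> m)" for k
  proof (induction k)
    case (Suc k)
    have "contraction ((-1) ^ Suc k) \<phi> = - contraction ((-1) ^ k) \<phi>"
      by simp
    then show ?case
      by (simp add: Suc fun_eq_iff)
  qed simp
  then show ?thesis
    by (simp add: ksign_def)
qed

text \<open>At a fixed exponent m this is the coefficient formula for the simplicial boundary, to be
  compared with \<open>lookup_boundary\<close>.\<close>

lemma contract_all_eval:
  assumes "finite V"
  shows "contr.contract_all V w \<tau> m = (\<Sum>v\<in>V - \<tau>. ksign v \<tau> * w (insert v \<tau>) m)"
proof -
  have "contr.contract_all V w \<tau> m = (\<Sum>v\<in>V. if v \<in> \<tau> then 0 else ksign v \<tau> * w (insert v \<tau>) m)"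
    unfolding contr.contract_all_def sum_fun_apply
    by (rule sum.cong[OF refl]) (simp add: contr.contract_def contraction_ksign)
  also have "\<dots> = (\<Sum>v\<in>V - \<tau>. ksign v \<tau> * w (insert v \<tau>) m)"
    by (rule sum.mono_neutral_cong_right) (use assms in auto)
  finally show ?thesis .
qed

text \<open>The dual form of the statement that every x_v lies in the radical of I_\<Delta> +
  (\<theta>). It restricts to subcomplexes with the same \<theta>, since their functionals are among
  those of \<Delta>.\<close>

definition nilpotent_mod :: "(nat \<Rightarrow> 'k::field mpoly) \<Rightarrow> nat \<Rightarrow> nat set set \<Rightarrow> bool" where
  "nilpotent_mod \<theta> s \<Delta> \<longleftrightarrow> (\<forall>v. {v} \<in> \<Delta> \<longrightarrow> (\<exists>N c. \<forall>\<phi>\<in>SR_dual \<Delta>.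
     contraction (Var v ^ N) \<phi> = contraction (\<Sum>j\<in>{1..s}. c j * \<theta> j) \<phi>))"

lemma SR_dual_mono: "\<Gamma> \<subseteq> \<Delta> \<Longrightarrow> SR_dual \<Gamma> \<subseteq> SR_dual \<Delta>"
  by (auto simp: SR_dual_def)

lemma nilpotent_mod_mono: "nilpotent_mod \<theta> s \<Delta> \<Longrightarrow> \<Gamma> \<subseteq> \<Delta> \<Longrightarrow> nilpotent_mod \<theta> s \<Gamma>"
  unfolding nilpotent_mod_def using SR_dual_mono[of \<Gamma> \<Delta>] by (meson subsetD)

text \<open>On a cone with apex v, x_v is a nonzerodivisor modulo the face ideal. Dually it acts
  surjectively, and its kernel consists of the functionals supported on the base. Exactness for the
  cone starts one degree lower than for the base.\<close>

lemma koszul_exact_cone: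
  fixes \<theta> :: "nat \<Rightarrow> 'k::field mpoly"
  assumes "down_closed \<Gamma>" "{} \<in> \<Gamma>" and cone: "\<And>\<rho>. \<rho> \<in> \<Gamma> \<Longrightarrow> insert v \<rho> \<in> \<Gamma>"
    and nil: "nilpotent_mod \<theta> s \<Gamma>"
    and ex: "contr.koszul_exact \<theta> s (SR_dual {\<rho> \<in> \<Gamma>. v \<notin> \<rho>}) (Suc i)"
  shows "contr.koszul_exact \<theta> s (SR_dual \<Gamma>) i"
proof -
  have "{v} \<in> \<Gamma>"
    using cone[OF assms(2)] by simp
  then obtain N c where N: "\<And>\<phi>. \<phi> \<in> SR_dual \<Gamma> \<Longrightarrow>
      contraction (Var v ^ N) \<phi> = contraction (\<Sum>j\<in>{1..s}. c j * \<theta> j) \<phi>"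
    using nil unfolding nilpotent_mod_def by meson
  have surj: "\<phi> \<in> contraction (Var v) ` SR_dual \<Gamma>" if "\<phi> \<in> SR_dual \<Gamma>" for \<phi> :: "_ \<Rightarrow> 'k"
  proof
    \<comment> \<open>The preimage shifts \<phi> by x_v and vanishes on monomials without x_v. Its
      support consists of faces because adding v to a face gives a face.\<close>
    let ?\<psi> = "\<lambda>m. if v \<in> Poly_Mapping.keys m then \<phi> (m - Poly_Mapping.single v (Suc 0)) else 0"
    show "\<phi> = contraction (Var v) ?\<psi>"
      by (rule ext) (simp add: contraction_Var)
    show "?\<psi> \<in> SR_dual \<Gamma>"
      unfolding SR_dual_def
    proof (intro CollectI allI impI)
      fix m
      assume *: "?\<psi> m \<noteq> 0"
      let ?m = "m - Poly_Mapping.single v (Suc 0)"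
      from * have "v \<in> Poly_Mapping.keys m" "\<phi> ?m \<noteq> 0"
        by (auto split: if_splits)
      then have "insert v (Poly_Mapping.keys ?m) \<in> \<Gamma>"
        using that cone by (auto simp: SR_dual_def)
      then show "Poly_Mapping.keys m \<in> \<Gamma>"
        using exponent_remove[OF \<open>v \<in> Poly_Mapping.keys m\<close>] keys_single_add[of v ?m] by simp
    qed
  qed
  have ker: "{\<phi> :: _ \<Rightarrow> 'k. \<phi> \<in> SR_dual \<Gamma> \<and> contraction (Var v) \<phi> = 0} = SR_dual {\<rho> \<in> \<Gamma>. v \<notin> \<rho>}"
  proof (intro equalityI subsetI)
    fix \<phi>
    assume \<phi>: "\<phi> \<in> {\<phi>. \<phi> \<in> SR_dual \<Gamma> \<and> contraction (Var v) \<phi> = 0}"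
    have "v \<notin> Poly_Mapping.keys m" if "\<phi> m \<noteq> 0" for m
    proof
      assume "v \<in> Poly_Mapping.keys m"
      then have "\<phi> m = contraction (Var v) \<phi> (m - Poly_Mapping.single v (Suc 0))"
        by (simp add: contraction_Var exponent_remove)
      with \<phi> that show False
        by simp
    qed
    then show "\<phi> \<in> SR_dual {\<rho> \<in> \<Gamma>. v \<notin> \<rho>}"
      using \<phi> by (auto simp: SR_dual_def)
  next
    fix \<phi> :: "(nat \<Rightarrow>\<^sub>0 nat) \<Rightarrow> 'k"
    assume \<phi>: "\<phi> \<in> SR_dual {\<rho> \<in> \<Gamma>. v \<notin> \<rho>}"
    then have "\<phi> (Poly_Mapping.single v 1 + m) = 0" for m
      by (auto simp: SR_dual_def)
    with \<phi> show "\<phi> \<in> {\<phi>. \<phi> \<in> SR_dual \<Gamma> \<and> contraction (Var v) \<phi> = 0}"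
      by (auto simp: SR_dual_def contraction_Var fun_eq_iff)
  qed
  show ?thesis
  proof (rule contr.koszul_exact_of_kernel[where x = "Var v" and N = N and c = c])
    show "contr.subspace (SR_dual \<Gamma> :: (_ \<Rightarrow> 'k) set)"
      using assms(1) by (rule subspace_SR_dual)
    show "contraction (Var v) ` SR_dual \<Gamma> = (SR_dual \<Gamma> :: (_ \<Rightarrow> 'k) set)"
      using surj contraction_SR_dual[OF assms(1)] by auto
    show "contr.koszul_exact \<theta> s {y \<in> SR_dual \<Gamma>. contraction (Var v) y = 0} (Suc i)"
      unfolding ker by fact
    show "contraction (Var v ^ N) y = contraction (\<Sum>j\<in>{1..s}. c j * \<theta> j) y" if "y \<in> SR_dual \<Gamma>" for y
      using N that .
  qed
qed

section \<open>Stars and the partition complex\<close>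

definition star :: "nat set set \<Rightarrow> nat set \<Rightarrow> nat set set" where
  "star \<Delta> \<tau> = {\<rho>. \<rho> \<union> \<tau> \<in> \<Delta>}"

text \<open>The star is the join of the link with the simplex on \<tau>, an iterated cone over the
  link. Each of the \<open>card \<tau>\<close> apexes improves the bound by one.\<close>

lemma koszul_exact_star:
  assumes "down_closed \<Delta>" "\<tau> \<in> \<Delta>" "finite \<tau>" "nilpotent_mod \<theta> s \<Delta>"
    and ex: "\<And>i. s < Suc i + q \<Longrightarrow> contr.koszul_exact \<theta> s (SR_dual (link \<Delta> \<tau>)) i"
    and i: "s < Suc i + (q + card \<tau>)"
  shows "contr.koszul_exact \<theta> s (SR_dual (star \<Delta> \<tau>)) i"
proof -
  \<comment> \<open>The faces of the star that meet \<tau> only inside F: this interpolates between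
    the link for F = {} and the star for F = \<tau>, and adding v to F adds a cone apex.\<close>
  define \<Gamma> where "\<Gamma> F = {\<rho>. \<rho> \<union> \<tau> \<in> \<Delta> \<and> \<rho> \<inter> (\<tau> - F) = {}}" for F
  have "contr.koszul_exact \<theta> s (SR_dual (\<Gamma> F)) i" if "F \<subseteq> \<tau>" "s < Suc i + (q + card F)" for F i
    using finite_subset[OF that(1) \<open>finite \<tau>\<close>] that
  proof (induction F arbitrary: i)
    case empty
    have "\<Gamma> {} = link \<Delta> \<tau>"
      unfolding \<Gamma>_def link_def using assms(1) by (auto intro: down_closedD)
    then show ?case
      using ex[of i] empty by simp
  next
    case (insert v F)
    show ?case
    proof (rule koszul_exact_cone[where v = v])
      show "down_closed (\<Gamma> (insert v F))"
        using assms(1) unfolding \<Gamma>_def down_closed_def by (blast intro: Un_mono)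
      show "{} \<in> \<Gamma> (insert v F)"
        using assms(2) by (simp add: \<Gamma>_def)
      show "insert v \<rho> \<in> \<Gamma> (insert v F)" if "\<rho> \<in> \<Gamma> (insert v F)" for \<rho>
      proof -
        have "insert v \<rho> \<union> \<tau> = \<rho> \<union> \<tau>"
          using insert.prems by auto
        with that show ?thesis
          by (auto simp: \<Gamma>_def)
      qed
      have "\<Gamma> (insert v F) \<subseteq> \<Delta>"
        using assms(1) by (auto simp: \<Gamma>_def intro: down_closedD)
      with assms(4) show "nilpotent_mod \<theta> s (\<Gamma> (insert v F))"
        by (rule nilpotent_mod_mono)
      have "{\<rho> \<in> \<Gamma> (insert v F). v \<notin> \<rho>} = \<Gamma> F"
        using insert by (auto simp: \<Gamma>_def)
      with insert show "contr.koszul_exact \<theta> s (SR_dual {\<rho> \<in> \<Gamma> (insert v F). v \<notin> \<rho>}) (Suc i)"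
        by simp
    qed
  qed
  from this[OF subset_refl i] show ?thesis
    by (simp add: \<Gamma>_def star_def)
qed

text \<open>The term of the partition complex in face size \<open>j\<close>: the product of the duals of the
  stars of the faces of size \<open>j\<close>.\<close>
definition star_family :: "nat set set \<Rightarrow> nat \<Rightarrow> (nat set \<Rightarrow> (nat \<Rightarrow>\<^sub>0 nat) \<Rightarrow> 'k::field) set" where
  "star_family \<Delta> j = {w. \<forall>\<tau> m. w \<tau> m \<noteq> 0 \<longrightarrow> Poly_Mapping.keys m \<union> \<tau> \<in> \<Delta> \<and> card \<tau> = j}"

lemma star_family_mem:
  assumes "down_closed \<Delta>" "w \<in> star_family \<Delta> j" "w \<tau> \<noteq> 0"
  shows "\<tau> \<in> \<Delta>" "card \<tau> = j"
  using assms by (auto simp: star_family_def fun_eq_iff intro: down_closedD)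

lemma star_family_SR_dual: "w \<in> star_family \<Delta> j \<Longrightarrow> w \<tau> \<in> SR_dual (star \<Delta> \<tau>)"
  by (auto simp: star_family_def SR_dual_def star_def)

lemma down_closed_star: "down_closed \<Delta> \<Longrightarrow> down_closed (star \<Delta> \<tau>)"
  unfolding down_closed_def star_def by (blast intro: Un_mono)

lemma subspace_star_family:
  assumes "down_closed \<Delta>"
  shows "family.subspace (star_family \<Delta> j)"
proof (rule family.subspaceI)
  fix w w' :: "nat set \<Rightarrow> (nat \<Rightarrow>\<^sub>0 nat) \<Rightarrow> 'a" and p
  assume w: "w \<in> star_family \<Delta> j"
  show "contraction_family p w \<in> star_family \<Delta> j"
    unfolding star_family_def
  proof (intro CollectI allI impI)
    fix \<tau> m
    assume nz: "contraction_family p w \<tau> m \<noteq> 0"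
    have "contraction p (w \<tau>) \<in> SR_dual (star \<Delta> \<tau>)"
      using contraction_SR_dual[OF down_closed_star star_family_SR_dual] assms w by metis
    moreover have "w \<tau> \<noteq> 0"
      using nz by (auto simp: contraction_family_def)
    ultimately show "Poly_Mapping.keys m \<union> \<tau> \<in> \<Delta> \<and> card \<tau> = j"
      using nz star_family_mem(2)[OF assms w] by (auto simp: SR_dual_def contraction_family_def star_def)
  qed
  assume w': "w' \<in> star_family \<Delta> j"
  show "w + w' \<in> star_family \<Delta> j"
    unfolding star_family_def
  proof (intro CollectI allI impI)
    fix \<tau> m
    assume nz: "(w + w') \<tau> m \<noteq> 0"
    then have "w \<tau> m \<noteq> 0 \<or> w' \<tau> m \<noteq> 0"
      by auto
    then show "Poly_Mapping.keys m \<union> \<tau> \<in> \<Delta> \<and> card \<tau> = j"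
      using w w' by (auto simp: star_family_def)
  qed
qed (simp add: star_family_def)

interpretation family_eval: koszul_hom "contraction_family :: 'k::field mpoly \<Rightarrow> _ \<Rightarrow> _" contraction "\<lambda>w. w \<tau>"
  by unfold_locales (simp_all add: contraction_family_def)

text \<open>Exactness of a product is exactness of the factors: the primitives are chosen for each
  face separately and assembled into one family.\<close>

lemma koszul_exact_star_family:
  assumes "down_closed \<Delta>"
    and ex: "\<And>\<tau>. \<tau> \<in> \<Delta> \<Longrightarrow> card \<tau> = j \<Longrightarrow> contr.koszul_exact \<theta> s (SR_dual (star \<Delta> \<tau>)) i"
  shows "family.koszul_exact \<theta> s (star_family \<Delta> j) i"
  unfolding family.koszul_exact_def
proof (intro ballI impI)
  fix f
  assume f: "f \<in> family.cochains s (Suc i) (star_family \<Delta> j)" "family.koszul \<theta> s f = (\<lambda>T. 0)"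
  have "\<exists>g\<in>contr.cochains s i (SR_dual (star \<Delta> \<tau>)). (\<lambda>T. f T \<tau>) = contr.koszul \<theta> s g"
    if "\<tau> \<in> \<Delta>" "card \<tau> = j" for \<tau>
  proof -
    have "(\<lambda>T. f T \<tau>) \<in> contr.cochains s (Suc i) (SR_dual (star \<Delta> \<tau>))"
      unfolding contr.cochains_def
    proof (intro CollectI allI conjI impI)
      fix T
      show "f T \<tau> \<in> SR_dual (star \<Delta> \<tau>)"
        using f(1) by (auto simp: family.cochains_def intro: star_family_SR_dual)
      assume "f T \<tau> \<noteq> 0"
      then have "f T \<noteq> 0"
        by auto
      then show "T \<subseteq> {1..s}" "card T = Suc i"
        using f(1) unfolding family.cochains_def by blast+
    qed
    moreover have "contr.koszul \<theta> s (\<lambda>T. f T \<tau>) = (\<lambda>T. 0)"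
      using f(2) by (intro ext) (simp add: family_eval.koszul_comp)
    ultimately show ?thesis
      using ex[OF that] unfolding contr.koszul_exact_def by blast
  qed
  then obtain g where g: "\<And>\<tau>. \<tau> \<in> \<Delta> \<Longrightarrow> card \<tau> = j \<Longrightarrow>
      g \<tau> \<in> contr.cochains s i (SR_dual (star \<Delta> \<tau>)) \<and> (\<lambda>T. f T \<tau>) = contr.koszul \<theta> s (g \<tau>)"
    by metis
  define G where "G T \<tau> = (if \<tau> \<in> \<Delta> \<and> card \<tau> = j then g \<tau> T else 0)" for T \<tau>
  show "\<exists>g\<in>family.cochains s i (star_family \<Delta> j). f = family.koszul \<theta> s g"
  proof (intro bexI[of _ G] ext)
    fix T \<tau> m
    have *: "family.koszul \<theta> s G T \<tau> = contr.koszul \<theta> s (\<lambda>T. G T \<tau>) T"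
      by (simp add: family_eval.koszul_comp)
    show "f T \<tau> m = family.koszul \<theta> s G T \<tau> m"
    proof (cases "\<tau> \<in> \<Delta> \<and> card \<tau> = j")
      case True
      then have G: "(\<lambda>T. G T \<tau>) = g \<tau>"
        by (simp add: G_def fun_eq_iff)
      show ?thesis
        unfolding * G using True g[of \<tau>] by (simp add: fun_eq_iff)
    next
      case False
      then have "(\<lambda>T. G T \<tau>) = (\<lambda>T. 0)"
        by (auto simp add: G_def)
      moreover have "f T \<tau> = 0"
        using False f(1) star_family_mem[OF assms(1), of "f T" j \<tau>] by (auto simp: family.cochains_def)
      ultimately show ?thesis
        unfolding * by simp
    qed
  next
    show "G \<in> family.cochains s i (star_family \<Delta> j)"
      unfolding family.cochains_def
    proof (intro CollectI allI conjI impI)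
      fix T
      show "G T \<in> star_family \<Delta> j"
        unfolding star_family_def
      proof (intro CollectI allI impI)
        fix \<tau> m
        assume "G T \<tau> m \<noteq> 0"
        then show "Poly_Mapping.keys m \<union> \<tau> \<in> \<Delta> \<and> card \<tau> = j"
          using g[of \<tau>] by (auto simp: G_def contr.cochains_def SR_dual_def star_def split: if_splits)
      qed
      assume "G T \<noteq> 0"
      then obtain \<tau> where "G T \<tau> \<noteq> 0"
        by (auto simp: fun_eq_iff)
      then have "\<tau> \<in> \<Delta>" "card \<tau> = j" "g \<tau> T \<noteq> 0"
        by (auto simp: G_def split: if_splits)
      then show "T \<subseteq> {1..s}" "card T = i"
        using g[of \<tau>] unfolding contr.cochains_def by blast+
    qed
  qed
qed

section \<open>Reisner's theorem by induction over links\<close>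

text \<open>Reisner's condition with the bound \<open>r - card \<sigma> - 1\<close> in place of the dimension of the link.
  This form passes to links and spares the induction any appeal to purity.\<close>
definition strong_CM :: "'k::field itself \<Rightarrow> nat set set \<Rightarrow> nat \<Rightarrow> bool" where
  "strong_CM K \<Delta> r \<longleftrightarrow> finite \<Delta> \<and> (\<forall>\<sigma>\<in>\<Delta>. finite \<sigma>) \<and> {} \<in> \<Delta> \<and> down_closed \<Delta> \<and>
     (\<forall>\<sigma>\<in>\<Delta>. \<forall>i. i < int r - int (card \<sigma>) - 1 \<longrightarrow> reduced_homology_vanishes K (link \<Delta> \<sigma>) i)"

lemma link_empty: "link \<Delta> {} = \<Delta>"
  by (auto simp: link_def)

lemma link_link:
  assumes "down_closed \<Delta>" "\<sigma> \<in> link \<Delta> \<tau>"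
  shows "link (link \<Delta> \<tau>) \<sigma> = link \<Delta> (\<tau> \<union> \<sigma>)"
proof -
  have "\<rho> \<in> link (link \<Delta> \<tau>) \<sigma> \<longleftrightarrow> \<rho> \<in> link \<Delta> (\<tau> \<union> \<sigma>)" for \<rho>
  proof -
    have "\<rho> \<union> (\<tau> \<union> \<sigma>) = \<rho> \<union> \<sigma> \<union> \<tau>"
      by auto
    moreover have "\<rho> \<union> \<sigma> \<in> \<Delta>" "\<rho> \<union> \<tau> \<in> \<Delta>" if "\<rho> \<union> \<sigma> \<union> \<tau> \<in> \<Delta>"
      using down_closedD[OF assms(1) that] by auto
    ultimately show ?thesis
      using assms(2) by (auto simp: link_def)
  qed
  then show ?thesis
    by blast
qed

lemma down_closed_link:
  assumes dc: "down_closed \<Delta>"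
  shows "down_closed (link \<Delta> \<tau>)"
  unfolding down_closed_def
proof (intro ballI allI impI)
  fix \<sigma> \<rho>
  assume "\<sigma> \<in> link \<Delta> \<tau>" "\<rho> \<subseteq> \<sigma>"
  moreover from this have "\<rho> \<union> \<tau> \<subseteq> \<sigma> \<union> \<tau>" "\<rho> \<subseteq> \<sigma> \<union> \<tau>"
    by auto
  ultimately show "\<rho> \<in> link \<Delta> \<tau>"
    using dc by (auto simp: link_def intro: down_closedD)
qed

text \<open>A link in a link is a link in \<Delta>, and the sizes of the two faces add up, so the
  required bounds are among those for \<Delta>.\<close>

lemma strong_CM_link:
  assumes "strong_CM K \<Delta> r" "\<tau> \<in> \<Delta>" "card \<tau> \<le> r"
  shows "strong_CM K (link \<Delta> \<tau>) (r - card \<tau>)"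
  unfolding strong_CM_def
proof (intro conjI ballI allI impI)
  have dc: "down_closed \<Delta>"
    using assms(1) by (simp add: strong_CM_def)
  show "finite \<sigma>" if "\<sigma> \<in> link \<Delta> \<tau>" for \<sigma>
    using assms(1) that by (auto simp: strong_CM_def link_def)
  show "finite (link \<Delta> \<tau>)"
    using assms(1) by (auto simp: strong_CM_def link_def)
  show "{} \<in> link \<Delta> \<tau>"
    using assms by (auto simp: strong_CM_def link_def)
  show "down_closed (link \<Delta> \<tau>)"
    by (rule down_closed_link[OF dc])
  fix \<sigma> i
  assume \<sigma>: "\<sigma> \<in> link \<Delta> \<tau>" and i: "i < int (r - card \<tau>) - int (card \<sigma>) - 1"
  then have "\<tau> \<union> \<sigma> \<in> \<Delta>" "\<tau> \<inter> \<sigma> = {}"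
    by (auto simp: link_def Un_commute)
  moreover have "card (\<tau> \<union> \<sigma>) = card \<tau> + card \<sigma>"
    using assms \<sigma> by (intro card_Un_disjoint) (auto simp: strong_CM_def link_def)
  ultimately show "reduced_homology_vanishes K (link (link \<Delta> \<tau>) \<sigma>) i"
    using assms(1,3) i unfolding link_link[OF dc \<sigma>] by (simp add: strong_CM_def)
qed

text \<open>Collecting by target instead of by source: \<tau> receives one contribution from each
  coface \<open>insert v \<tau>\<close>.\<close>

lemma lookup_boundary:
  fixes p :: "nat set \<Rightarrow>\<^sub>0 'k::field"
  assumes V: "finite V" "\<And>\<sigma>. \<sigma> \<in> Poly_Mapping.keys p \<Longrightarrow> \<sigma> \<subseteq> V"
  shows "Poly_Mapping.lookup (boundary p) \<tau> =
    (\<Sum>v\<in>V - \<tau>. ksign v \<tau> * Poly_Mapping.lookup p (insert v \<tau>))"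
proof -
  let ?p = "Poly_Mapping.lookup p"
  have "Poly_Mapping.lookup (boundary p) \<tau> =
      (\<Sum>\<sigma>\<in>Poly_Mapping.keys p. \<Sum>v\<in>\<sigma>. (ksign v \<sigma> * ?p \<sigma> when \<sigma> - {v} = \<tau>))"
    by (simp add: boundary_def lookup_sum lookup_single ksign_def)
  also have "\<dots> = (\<Sum>\<sigma>\<in>Poly_Mapping.keys p. \<Sum>v\<in>V. if v \<in> \<sigma> \<and> \<sigma> - {v} = \<tau> then ksign v \<sigma> * ?p \<sigma> else 0)"
    by (intro sum.cong refl sum.mono_neutral_cong_left V(1)) (use V(2) in \<open>auto simp: when_def\<close>)
  also have "\<dots> = (\<Sum>v\<in>V. \<Sum>\<sigma>\<in>Poly_Mapping.keys p. if v \<in> \<sigma> \<and> \<sigma> - {v} = \<tau> then ksign v \<sigma> * ?p \<sigma> else 0)"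
    by (rule sum.swap)
  also have "\<dots> = (\<Sum>v\<in>V. if v \<in> \<tau> then 0 else ksign v \<tau> * ?p (insert v \<tau>))"
  proof (rule sum.cong[OF refl])
    fix v
    have "v \<in> \<sigma> \<and> \<sigma> - {v} = \<tau> \<longleftrightarrow> v \<notin> \<tau> \<and> \<sigma> = insert v \<tau>" for \<sigma>
      by auto
    then have "(\<Sum>\<sigma>\<in>Poly_Mapping.keys p. if v \<in> \<sigma> \<and> \<sigma> - {v} = \<tau> then ksign v \<sigma> * ?p \<sigma> else 0)
      = (\<Sum>\<sigma>\<in>Poly_Mapping.keys p. if \<sigma> = insert v \<tau> then (if v \<in> \<tau> then 0 else ksign v \<sigma> * ?p \<sigma>) else 0)"
      by (intro sum.cong) auto
    also have "\<dots> = (if v \<in> \<tau> then 0 else ksign v \<tau> * ?p (insert v \<tau>))"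
      by (auto simp: in_keys_iff)
    finally show "(\<Sum>\<sigma>\<in>Poly_Mapping.keys p. if v \<in> \<sigma> \<and> \<sigma> - {v} = \<tau> then ksign v \<sigma> * ?p \<sigma> else 0)
      = (if v \<in> \<tau> then 0 else ksign v \<tau> * ?p (insert v \<tau>))" .
  qed
  also have "\<dots> = (\<Sum>v\<in>V - \<tau>. ksign v \<tau> * ?p (insert v \<tau>))"
    by (rule sum.mono_neutral_cong_right) (use V in auto)
  finally show ?thesis .
qed

text \<open>Faces of size j have dimension j - 1, which explains the shift. Coefficient functions
  may replace finitely supported maps because all faces lie in the finite set
  \<open>V\<close>.\<close>

lemma reduced_homology_vanishesD:
  fixes c :: "nat set \<Rightarrow> 'k::field"
  assumes van: "reduced_homology_vanishes TYPE('k) \<Delta> (int j - 1)"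
    and V: "finite V" "\<Delta> \<subseteq> Pow V"
    and c: "\<And>\<tau>. c \<tau> \<noteq> 0 \<Longrightarrow> \<tau> \<in> \<Delta> \<and> card \<tau> = j"
    and cyc: "\<And>\<tau>. (\<Sum>v\<in>V - \<tau>. ksign v \<tau> * c (insert v \<tau>)) = 0"
  shows "\<exists>c'. (\<forall>\<tau>. c' \<tau> \<noteq> 0 \<longrightarrow> \<tau> \<in> \<Delta> \<and> card \<tau> = Suc j) \<and>
    (\<forall>\<tau>. (\<Sum>v\<in>V - \<tau>. ksign v \<tau> * c' (insert v \<tau>)) = c \<tau>)"
proof -
  define p where "p = Abs_poly_mapping c"
  have "finite {\<tau>. c \<tau> \<noteq> 0}"
    by (rule finite_subset[of _ "Pow V"]) (use c V in auto)
  then have p: "Poly_Mapping.lookup p = c"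
    by (simp add: p_def)
  have keys: "\<tau> \<subseteq> V" if "q \<in> chains \<Delta> i" "\<tau> \<in> Poly_Mapping.keys q" for q :: "nat set \<Rightarrow>\<^sub>0 'k" and \<tau> i
    using that V by (auto simp: chains_def)
  have pc: "p \<in> chains \<Delta> (int j - 1)"
    using c by (auto simp: chains_def in_keys_iff p face_dim_def)
  moreover have "boundary p = 0"
    by (rule poly_mapping_eqI) (simp add: lookup_boundary[OF V(1) keys[OF pc]] p cyc)
  ultimately have "p \<in> cycles \<Delta> (int j - 1)"
    by (simp add: cycles_def)
  then obtain q where q: "q \<in> chains \<Delta> (int j)" "p = boundary q"
    using van by (auto simp: reduced_homology_vanishes_def boundaries_def)
  show ?thesis
  proof (intro exI[of _ "Poly_Mapping.lookup q"] conjI allI impI)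
    show "(\<Sum>v\<in>V - \<tau>. ksign v \<tau> * Poly_Mapping.lookup q (insert v \<tau>)) = c \<tau>" for \<tau>
      using lookup_boundary[OF V(1) keys[OF q(1)]] q(2) p by metis
    show "\<tau> \<in> \<Delta>" "card \<tau> = Suc j" if "Poly_Mapping.lookup q \<tau> \<noteq> 0" for \<tau>
    proof -
      have "\<tau> \<in> Poly_Mapping.keys q"
        using that by (simp add: in_keys_iff)
      with q(1) have "\<tau> \<in> \<Delta>" "int (card \<tau>) - 1 = int j"
        by (auto simp: chains_def face_dim_def)
      then show "\<tau> \<in> \<Delta>" "card \<tau> = Suc j"
        by simp_all
    qed
  qed
qed

text \<open>Exactness of the partition complex. For an exponent \<open>m \<noteq> 0\<close> its part is a cone with apex in
  the support of \<open>m\<close>; for \<open>m = 0\<close> it is the chain complex of \<open>\<Delta>\<close>.\<close>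
lemma star_family_exact:
  assumes CM: "strong_CM TYPE('k::field) \<Delta> r" and "j < r" and V: "V = \<Union>\<Delta>"
  shows "contr.contract_all V ` star_family \<Delta> (Suc j) =
    {w :: nat set \<Rightarrow> (nat \<Rightarrow>\<^sub>0 nat) \<Rightarrow> 'k. w \<in> star_family \<Delta> j \<and> contr.contract_all V w = 0}"
    (is "?L = ?R")
proof
  have dc: "down_closed \<Delta>" and finV: "finite V" and fin: "\<And>\<tau>. \<tau> \<in> \<Delta> \<Longrightarrow> finite \<tau>" and \<Delta>V: "\<Delta> \<subseteq> Pow V"
    using CM V by (auto simp: strong_CM_def)
  show "?L \<subseteq> ?R"
  proof
    fix u :: "nat set \<Rightarrow> (nat \<Rightarrow>\<^sub>0 nat) \<Rightarrow> 'k"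
    assume "u \<in> ?L"
    then obtain w where w: "w \<in> star_family \<Delta> (Suc j)" and u: "u = contr.contract_all V w"
      by auto
    have "contr.contract_all V u = 0"
      unfolding u by (rule ext) (simp add: contr.contract_all_contract_all[OF finV])
    moreover have "u \<in> star_family \<Delta> j"
      unfolding star_family_def
    proof (intro CollectI allI impI)
      fix \<tau> m
      assume "u \<tau> m \<noteq> 0"
      then obtain v where v: "v \<in> V - \<tau>" "w (insert v \<tau>) m \<noteq> 0"
        unfolding u contract_all_eval[OF finV] by (metis (no_types, lifting) mult_zero_right sum.neutral)
      then have *: "Poly_Mapping.keys m \<union> insert v \<tau> \<in> \<Delta>" "card (insert v \<tau>) = Suc j"
        using w unfolding star_family_def by blast+
      then have "finite \<tau>"
        using fin[OF *(1)] by simp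
      with * v dc show "Poly_Mapping.keys m \<union> \<tau> \<in> \<Delta> \<and> card \<tau> = j"
        by (auto intro: down_closedD)
    qed
    ultimately show "u \<in> ?R"
      by simp
  qed
  show "?R \<subseteq> ?L"
  proof
    fix w :: "nat set \<Rightarrow> (nat \<Rightarrow>\<^sub>0 nat) \<Rightarrow> 'k"
    assume "w \<in> ?R"
    then have w: "w \<in> star_family \<Delta> j" and w0: "contr.contract_all V w = 0"
      by auto
    \<comment> \<open>The differential moves only the face index, so a preimage can be sought for
      each exponent m separately.\<close>
    have "\<exists>c. (\<forall>\<tau>. c \<tau> \<noteq> 0 \<longrightarrow> Poly_Mapping.keys m \<union> \<tau> \<in> \<Delta> \<and> card \<tau> = Suc j) \<and>
      (\<forall>\<tau>. (\<Sum>v\<in>V - \<tau>. ksign v \<tau> * c (insert v \<tau>)) = w \<tau> m)" for m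
    proof (cases "Poly_Mapping.keys m = {}")
      case True
      \<comment> \<open>j < r is exactly what places degree j - 1 under the bound at the empty
        face.\<close>
      have "reduced_homology_vanishes TYPE('k) \<Delta> (int j - 1)"
        using CM \<open>j < r\<close> by (auto simp: strong_CM_def link_empty dest!: bspec[of _ _ "{}"])
      then show ?thesis
        unfolding True Un_empty_left
      proof (rule reduced_homology_vanishesD[OF _ finV \<Delta>V])
        show "\<tau> \<in> \<Delta> \<and> card \<tau> = j" if "w \<tau> m \<noteq> 0" for \<tau>
        proof -
          have "Poly_Mapping.keys m \<union> \<tau> \<in> \<Delta> \<and> card \<tau> = j"
            using that w unfolding star_family_def by blast
          with True show ?thesis
            by simp
        qed
        show "(\<Sum>v\<in>V - \<tau>. ksign v \<tau> * w (insert v \<tau>) m) = 0" for \<tau>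
          using contract_all_eval[OF finV, of w \<tau> m] w0 by simp
      qed
    next
      case False
      then obtain v where v: "v \<in> Poly_Mapping.keys m"
        by blast
      show ?thesis
      \<comment> \<open>A nonzero value of \<open>w\<close> at m puts the support of m into a face,
        hence v into \<open>V\<close>. Otherwise zero is a preimage.\<close>
      proof (cases "\<exists>\<tau>. w \<tau> m \<noteq> 0")
        case True
        then have "v \<in> V"
          using w v V by (auto simp: star_family_def)
        let ?c = "\<lambda>\<tau>. contr.wedge v w \<tau> m"
        show ?thesis
        proof (intro exI[of _ ?c] conjI allI impI)
          fix \<tau>
          show "(\<Sum>u\<in>V - \<tau>. ksign u \<tau> * ?c (insert u \<tau>)) = w \<tau> m"
          proof -
            have "contr.wedge v (contr.contract_all V w) \<tau> = 0"
              by (simp add: w0 contr.wedge_def)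
            then have "contr.contract_all V (contr.wedge v w) \<tau> m = w \<tau> m"
              using contr.contract_all_wedge[OF finV \<open>v \<in> V\<close>, of w \<tau>] by simp
            then show ?thesis
              by (simp only: contract_all_eval[OF finV])
          qed
          assume "?c \<tau> \<noteq> 0"
          then have \<tau>: "v \<in> \<tau>" "w (\<tau> - {v}) m \<noteq> 0"
            by (auto simp: contr.wedge_def contraction_ksign split: if_splits)
          then have *: "Poly_Mapping.keys m \<union> (\<tau> - {v}) \<in> \<Delta>" "card (\<tau> - {v}) = j"
            using w unfolding star_family_def by blast+
          moreover have "Poly_Mapping.keys m \<union> (\<tau> - {v}) = Poly_Mapping.keys m \<union> \<tau>"
            using v by auto
          ultimately show "Poly_Mapping.keys m \<union> \<tau> \<in> \<Delta>"
            by simp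
          from fin[OF *(1)] have "finite \<tau>"
            by simp
          then show "card \<tau> = Suc j"
            using card.remove[OF _ \<tau>(1)] *(2) by metis
        qed
      next
        case False
        then show ?thesis
          by (intro exI[of _ "\<lambda>\<tau>. 0"]) auto
      qed
    qed
    then obtain c where c: "\<And>m \<tau>. c m \<tau> \<noteq> 0 \<Longrightarrow> Poly_Mapping.keys m \<union> \<tau> \<in> \<Delta> \<and> card \<tau> = Suc j"
      "\<And>m \<tau>. (\<Sum>v\<in>V - \<tau>. ksign v \<tau> * c m (insert v \<tau>)) = w \<tau> m"
      by metis
    show "w \<in> ?L"
    proof
      show "w = contr.contract_all V (\<lambda>\<tau> m. c m \<tau>)"
        by (intro ext) (simp add: contract_all_eval[OF finV] c(2))
      show "(\<lambda>\<tau> m. c m \<tau>) \<in> star_family \<Delta> (Suc j)"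
        using c(1) by (auto simp: star_family_def)
    qed
  qed
qed

text \<open>Koszul cohomology vanishes in the degrees above s - r, the dual form of depth at least
  r. The kernels \<open>?Z j\<close> of the partition complex connect \<open>?Z r\<close>, where
  vanishing is trivial, to \<open>?Z 0\<close>, which is the dual of the whole complex placed at the
  empty face.\<close>

theorem koszul_exact_SR_dual:
  fixes \<theta> :: "nat \<Rightarrow> 'k::field mpoly"
  assumes "strong_CM TYPE('k) \<Delta> r" "nilpotent_mod \<theta> s \<Delta>" "s < Suc i + r"
  shows "contr.koszul_exact \<theta> s (SR_dual \<Delta>) i"
  using assms
proof (induction r arbitrary: \<Delta> i rule: less_induct)
  case (less r)
  define V where "V = \<Union>\<Delta>"
  have dc: "down_closed \<Delta>" and finV: "finite V" and fin: "\<And>\<tau>. \<tau> \<in> \<Delta> \<Longrightarrow> finite \<tau>"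
    using less.prems(1) by (auto simp: strong_CM_def V_def)
  interpret \<delta>: koszul_hom contraction_family contraction_family
    "contr.contract_all V :: (nat set \<Rightarrow> (nat \<Rightarrow>\<^sub>0 nat) \<Rightarrow> 'k) \<Rightarrow> _"
  proof unfold_locales
    fix w w' :: "nat set \<Rightarrow> (nat \<Rightarrow>\<^sub>0 nat) \<Rightarrow> 'k" and p
    show "contr.contract_all V (w + w') = contr.contract_all V w + contr.contract_all V w'"
      by (intro ext) (simp add: contract_all_eval[OF finV] algebra_simps sum.distrib)
    show "contr.contract_all V (contraction_family p w) = contraction_family p (contr.contract_all V w)"
      by (intro ext) (simp add: contr.contract_all_def contraction_family_def[abs_def]
          contr.contract_scale contr.scale_sum_right)
  qed
  \<comment> \<open>The link of a face of size j + 1 satisfies the induction hypothesis for r - (j +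
    1), and coning over the j + 1 vertices of the face restores the bound r.\<close>
  have star: "contr.koszul_exact \<theta> s (SR_dual (star \<Delta> \<tau>)) i" if "\<tau> \<in> \<Delta>" "card \<tau> = Suc j" "Suc j \<le> r" "s < Suc i + r"
    for \<tau> i j
  proof (rule koszul_exact_star[OF dc that(1) fin[OF that(1)] less.prems(2)])
    have CM: "strong_CM TYPE('k) (link \<Delta> \<tau>) (r - Suc j)"
      using strong_CM_link[OF less.prems(1) that(1)] that(2,3) by simp
    have "link \<Delta> \<tau> \<subseteq> \<Delta>"
      by (auto simp: link_def)
    then show "contr.koszul_exact \<theta> s (SR_dual (link \<Delta> \<tau>)) i" if "s < Suc i + (r - Suc j)" for i
      using less.IH[OF _ CM nilpotent_mod_mono[OF less.prems(2)] that] \<open>Suc j \<le> r\<close> by simp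
    show "s < Suc i + (r - Suc j + card \<tau>)"
      using that by simp
  qed
  let ?Z = "\<lambda>j. {w :: nat set \<Rightarrow> (nat \<Rightarrow>\<^sub>0 nat) \<Rightarrow> 'k. w \<in> star_family \<Delta> j \<and> contr.contract_all V w = 0}"
  \<comment> \<open>The differential maps the families of size j + 1 onto \<open>?Z j\<close> with
    kernel \<open>?Z (Suc j)\<close>. Since the families themselves are exact in the whole range,
    each step down extends the range of \<open>?Z\<close> by one degree.\<close>
  have Z: "family.koszul_exact \<theta> s (?Z (r - k)) i" if "k \<le> r" "s < Suc i + k" for k i
    using that
  proof (induction k arbitrary: i)
    case 0
    have "family.subspace (?Z r)"
      by (rule family.subspaceI)
        (auto simp: \<delta>.zero \<delta>.add \<delta>.scale intro: subspace_star_family[OF dc]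
          family.subspace_0 family.subspace_add family.subspace_scale)
    then have "family.koszul_exact \<theta> s (?Z r) i"
      using 0 by (intro family.koszul_exact_trivial) auto
    then show ?case
      by (simp only: diff_zero)
  next
    case (Suc k)
    define j where "j = r - Suc k"
    have j: "r - k = Suc j" "j < r"
      using Suc.prems by (auto simp: j_def)
    have "family.koszul_exact \<theta> s (contr.contract_all V ` star_family \<Delta> (Suc j)) i"
    proof (rule \<delta>.koszul_exact_image)
      show "family.subspace (star_family \<Delta> (Suc j) :: (nat set \<Rightarrow> (nat \<Rightarrow>\<^sub>0 nat) \<Rightarrow> 'k) set)"
        by (rule subspace_star_family[OF dc])
      show "family.koszul_exact \<theta> s (?Z (Suc j)) (Suc i)"
        using Suc.IH[of "Suc i", unfolded j(1)] Suc.prems by linarith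
      show "family.koszul_exact \<theta> s (star_family \<Delta> (Suc j)) i"
      proof (rule koszul_exact_star_family[OF dc])
        show "contr.koszul_exact \<theta> s (SR_dual (star \<Delta> \<tau>)) i" if "\<tau> \<in> \<Delta>" "card \<tau> = Suc j" for \<tau>
          by (rule star[OF that]) (use Suc.prems j(2) in auto)
      qed
    qed
    then show ?case
      unfolding star_family_exact[OF less.prems(1) j(2) V_def] by (simp only: j_def)
  qed
  have "family.koszul_exact \<theta> s (?Z 0) i"
    using Z[OF order_refl less.prems(3)] by (simp only: diff_self_eq_0)
  \<comment> \<open>The differential reads values at \<open>insert v \<tau>\<close>, which is never
    empty, while a family of size 0 lives on the empty face.\<close>
  moreover have "?Z 0 = star_family \<Delta> 0"
  proof -
    have "contr.contract_all V w = 0" if "w \<in> star_family \<Delta> 0" for w :: "nat set \<Rightarrow> (nat \<Rightarrow>\<^sub>0 nat) \<Rightarrow> 'k"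
    proof (intro ext)
      fix \<tau> m
      have "w (insert v \<tau>) m = 0" for v
      proof (rule ccontr)
        assume "w (insert v \<tau>) m \<noteq> 0"
        then have "Poly_Mapping.keys m \<union> insert v \<tau> \<in> \<Delta>" "card (insert v \<tau>) = 0"
          using that unfolding star_family_def by blast+
        with fin show False
          by (metis card_0_eq finite_Un insert_not_empty)
      qed
      then show "contr.contract_all V w \<tau> m = 0 \<tau> m"
        by (simp add: contract_all_eval[OF finV])
    qed
    then show ?thesis
      by auto
  qed
  ultimately have ex0: "family.koszul_exact \<theta> s (star_family \<Delta> 0) i"
    by (simp only:)
  define \<iota> :: "((nat \<Rightarrow>\<^sub>0 nat) \<Rightarrow> 'k) \<Rightarrow> nat set \<Rightarrow> (nat \<Rightarrow>\<^sub>0 nat) \<Rightarrow> 'k"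
    where "\<iota> \<phi> \<tau> = (if \<tau> = {} then \<phi> else 0)" for \<phi> \<tau>
  interpret \<iota>: koszul_hom contraction contraction_family \<iota>
    by unfold_locales (auto simp: \<iota>_def contraction_family_def fun_eq_iff)
  show ?case
    unfolding contr.koszul_exact_def
  proof (intro ballI impI)
    fix f
    assume f: "f \<in> contr.cochains s (Suc i) (SR_dual \<Delta>)" "contr.koszul \<theta> s f = (\<lambda>T. 0)"
    have "(\<lambda>T. \<iota> (f T)) \<in> family.cochains s (Suc i) (star_family \<Delta> 0)"
      unfolding family.cochains_def
    proof (intro CollectI allI conjI impI)
      fix T
      show "\<iota> (f T) \<in> star_family \<Delta> 0"
        using f(1) by (auto simp: star_family_def \<iota>_def contr.cochains_def SR_dual_def split: if_splits)
      assume "\<iota> (f T) \<noteq> 0"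
      then have "f T \<noteq> 0"
        using \<iota>.zero by metis
      then show "T \<subseteq> {1..s}" "card T = Suc i"
        using f(1) unfolding contr.cochains_def by blast+
    qed
    moreover have "family.koszul \<theta> s (\<lambda>T. \<iota> (f T)) = (\<lambda>T. 0)"
      by (rule ext) (simp add: \<iota>.koszul_comp f(2) \<iota>.zero)
    ultimately obtain g where g: "g \<in> family.cochains s i (star_family \<Delta> 0)"
      "(\<lambda>T. \<iota> (f T)) = family.koszul \<theta> s g"
      using ex0 unfolding family.koszul_exact_def by blast
    show "\<exists>g\<in>contr.cochains s i (SR_dual \<Delta>). f = contr.koszul \<theta> s g"
    proof (intro bexI[of _ "\<lambda>T. g T {}"] ext)
      show "f T m = contr.koszul \<theta> s (\<lambda>T. g T {}) T m" for T m
      proof -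
        have "\<iota> (f T) {} m = family.koszul \<theta> s g T {} m"
          by (rule fun_cong[OF fun_cong[OF fun_cong[OF g(2), of T], of "{}"], of m])
        then show ?thesis
          by (simp add: family_eval.koszul_comp \<iota>_def)
      qed
      show "(\<lambda>T. g T {}) \<in> contr.cochains s i (SR_dual \<Delta>)"
        unfolding contr.cochains_def
      proof (intro CollectI allI conjI impI)
        fix T
        show "g T {} \<in> SR_dual \<Delta>"
          using g(1) star_family_SR_dual[of "g T" \<Delta> 0 "{}"] by (simp add: family.cochains_def star_def)
        assume "g T {} \<noteq> 0"
        then have "g T \<noteq> 0"
          by auto
        then show "T \<subseteq> {1..s}" "card T = i"
          using g(1) unfolding family.cochains_def by blast+
      qed
    qed
  qed
qed

section \<open>Purity of Cohen-Macaulay complexes\<close>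

lemma complex_dim_eq:
  assumes "finite \<Delta>" "\<sigma> \<in> \<Delta>" "card \<sigma> = r" "\<And>\<tau>. \<tau> \<in> \<Delta> \<Longrightarrow> card \<tau> \<le> r"
  shows "complex_dim \<Delta> = int r - 1"
  unfolding complex_dim_def
proof (rule Max_eqI)
  show "int r - 1 \<in> face_dim ` \<Delta>"
    using assms(2,3) by (auto simp: face_dim_def)
  show "y \<le> int r - 1" if "y \<in> face_dim ` \<Delta>" for y
  proof -
    obtain \<tau> where "\<tau> \<in> \<Delta>" "y = int (card \<tau>) - 1"
      using \<open>y \<in> face_dim ` \<Delta>\<close> by (auto simp: face_dim_def)
    with assms(4)[of \<tau>] show ?thesis
      by linarith
  qed
qed (use assms(1) in simp)

lemma Cohen_Macaulay_link:
  assumes "Cohen_Macaulay_complex K \<Delta>" "down_closed \<Delta>" "\<tau> \<in> \<Delta>"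
  shows "Cohen_Macaulay_complex K (link \<Delta> \<tau>)"
  unfolding Cohen_Macaulay_complex_def
proof (intro ballI)
  fix \<sigma>
  assume \<sigma>: "\<sigma> \<in> link \<Delta> \<tau>"
  then have "\<tau> \<union> \<sigma> \<in> \<Delta>"
    by (auto simp: link_def Un_commute)
  then show "\<forall>i<complex_dim (link (link \<Delta> \<tau>) \<sigma>). reduced_homology_vanishes K (link (link \<Delta> \<tau>) \<sigma>) i"
    using assms(1) unfolding link_link[OF assms(2) \<sigma>] Cohen_Macaulay_complex_def by blast
qed

lemma ksign_singleton: "ksign v {u} = (if u < v then - 1 else 1)"
  by (subst ksign_insert) (simp_all add: ksign_def)

text \<open>The cycle [a] - [w] bounds a chain of edges. Summed over the vertices of A, its boundary
  is 0, because an edge with one end in A has both ends there and contributes opposite signs; but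
  the sum is the coefficient 1 of a.\<close>

lemma homology_0_connected:
  assumes van: "reduced_homology_vanishes TYPE('k::field) \<Delta> 0"
    and V: "finite V" "\<Delta> \<subseteq> Pow V"
    and A: "a \<in> A" "w \<notin> A" "{a} \<in> \<Delta>" "{w} \<in> \<Delta>"
    and edge: "\<And>u v. {u, v} \<in> \<Delta> \<Longrightarrow> u \<in> A \<Longrightarrow> v \<in> A"
  shows False
proof -
  define c :: "nat set \<Rightarrow> 'k" where "c \<tau> = (if \<tau> = {a} then 1 else if \<tau> = {w} then - 1 else 0)" for \<tau>
  have aw: "a \<noteq> w" "a \<in> V" "w \<in> V"
    using A V by auto
  have "\<exists>c'. (\<forall>\<tau>. c' \<tau> \<noteq> 0 \<longrightarrow> \<tau> \<in> \<Delta> \<and> card \<tau> = Suc 1) \<and>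
    (\<forall>\<tau>. (\<Sum>v\<in>V - \<tau>. ksign v \<tau> * c' (insert v \<tau>)) = c \<tau>)"
  proof (rule reduced_homology_vanishesD[OF _ V])
    show "reduced_homology_vanishes TYPE('k) \<Delta> (int 1 - 1)"
      using van by simp
    show "\<tau> \<in> \<Delta> \<and> card \<tau> = 1" if "c \<tau> \<noteq> 0" for \<tau>
      using that A by (auto simp: c_def split: if_splits)
    fix \<tau>
    show "(\<Sum>v\<in>V - \<tau>. ksign v \<tau> * c (insert v \<tau>)) = 0"
    proof (cases "\<tau> = {}")
      case True
      have "(\<Sum>v\<in>V. ksign v {} * c {v}) = (\<Sum>v\<in>V. (if v = a then 1 else 0) - (if v = w then 1 else 0))"
        using aw(1) by (intro sum.cong) (auto simp: ksign_def c_def)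
      also have "\<dots> = 0"
        using V(1) aw by (simp add: sum_subtractf)
      finally show ?thesis
        using True by simp
    next
      case False
      have "c (insert v \<tau>) = 0" if "v \<notin> \<tau>" for v
        using False that by (auto simp: c_def)
      then show ?thesis
        by (intro sum.neutral) auto
    qed
  qed
  then obtain c' where c': "\<And>\<tau>. c' \<tau> \<noteq> 0 \<Longrightarrow> \<tau> \<in> \<Delta>"
    "\<And>\<tau>. (\<Sum>v\<in>V - \<tau>. ksign v \<tau> * c' (insert v \<tau>)) = c \<tau>"
    by blast
  let ?A = "A \<inter> V"
  \<comment> \<open>The edge coefficients as an antisymmetric matrix: row u sums to the boundary
    coefficient at u.\<close>
  let ?a = "\<lambda>u v. if u = v then 0 else ksign v {u} * c' {v, u}"
  have fin: "finite ?A"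
    using V by simp
  have "(\<Sum>u\<in>?A. c {u}) = (\<Sum>u\<in>?A. \<Sum>v\<in>?A. ?a u v)"
  proof (rule sum.cong[OF refl])
    fix u
    assume u: "u \<in> ?A"
    have "c {u} = (\<Sum>v\<in>V - {u}. ksign v {u} * c' {v, u})"
      by (rule c'(2)[symmetric])
    also have "\<dots> = (\<Sum>v\<in>V. ?a u v)"
      by (rule sum.mono_neutral_cong_left) (use V in auto)
    also have "\<dots> = (\<Sum>v\<in>?A. ?a u v)"
    proof (rule sum.mono_neutral_right[OF V(1)])
      show "\<forall>v\<in>V - ?A. ?a u v = 0"
        using c'(1) edge[of u] u by (auto simp: insert_commute)
    qed simp
    finally show "c {u} = (\<Sum>v\<in>?A. ?a u v)" .
  qed
  also have "\<dots> = 0"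
  proof (rule sum_alternating_eq_0[OF fin])
    fix u v
    show "?a u v = - ?a v u"
      using linorder_cases[of u v] by (auto simp: ksign_singleton insert_commute)
  qed simp
  also have "(\<Sum>u\<in>?A. c {u}) = (\<Sum>u\<in>?A. if u = a then 1 else 0)"
    by (intro sum.cong) (use A aw in \<open>auto simp: c_def\<close>)
  also have "\<dots> = 1"
    using fin A aw by simp
  finally show False
    by simp
qed

text \<open>By induction the link of each vertex v is pure, so the maximal faces through v share one
  size g v. Adjacent vertices have the same g, and connectedness makes g constant.\<close>

lemma Cohen_Macaulay_pure:
  assumes "Cohen_Macaulay_complex TYPE('k::field) \<Delta>" "down_closed \<Delta>" "finite \<Delta>"
    "\<And>\<sigma>. \<sigma> \<in> \<Delta> \<Longrightarrow> finite \<sigma>" "\<And>\<tau>. \<tau> \<in> \<Delta> \<Longrightarrow> card \<tau> \<le> r" "\<exists>\<tau>\<in>\<Delta>. card \<tau> = r" "\<sigma> \<in> \<Delta>"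
  shows "\<exists>\<tau>\<in>\<Delta>. \<sigma> \<subseteq> \<tau> \<and> card \<tau> = r"
  using assms
proof (induction "card \<Delta>" arbitrary: \<Delta> r \<sigma> rule: less_induct)
  case less
  note CM = less.prems(1) and dc = less.prems(2) and fin\<Delta> = less.prems(3) and fin = less.prems(4)
  have "\<exists>g. \<forall>\<rho>\<in>\<Delta>. v \<in> \<rho> \<longrightarrow> card \<rho> \<le> g \<and> (\<exists>\<tau>\<in>\<Delta>. \<rho> \<subseteq> \<tau> \<and> card \<tau> = g)" for v
  proof (cases "{v} \<in> \<Delta>")
    case True
    let ?L = "link \<Delta> {v}"
    have "?L \<subset> \<Delta>"
      using True by (auto simp: link_def)
    then have less_card: "card ?L < card \<Delta>" and finL: "finite ?L"
      using fin\<Delta> by (auto intro: psubset_card_mono finite_subset)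
    have "{} \<in> ?L"
      using True dc by (auto simp: link_def intro: down_closedD)
    then have ne: "?L \<noteq> {}"
      by auto
    define r' where "r' = Max (card ` ?L)"
    have "r' \<in> card ` ?L"
      unfolding r'_def using finL ne by (intro Max_in) auto
    then have r': "\<exists>\<tau>\<in>?L. card \<tau> = r'"
      by auto
    have r'_ge: "card \<tau> \<le> r'" if "\<tau> \<in> ?L" for \<tau>
      unfolding r'_def using finL that by (intro Max_ge) auto
    show ?thesis
    proof (intro exI[of _ "Suc r'"] ballI impI)
      fix \<rho>
      assume \<rho>: "\<rho> \<in> \<Delta>" "v \<in> \<rho>"
      then have \<rho>L: "\<rho> - {v} \<in> ?L"
        using dc by (auto simp: link_def insert_absorb intro: down_closedD)
      have "card \<rho> = Suc (card (\<rho> - {v}))"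
        using card.remove[OF fin[OF \<rho>(1)] \<rho>(2)] .
      with r'_ge[OF \<rho>L] have "card \<rho> \<le> Suc r'"
        by simp
      obtain \<tau> where \<tau>: "\<tau> \<in> ?L" "\<rho> - {v} \<subseteq> \<tau>" "card \<tau> = r'"
        using less.hyps[OF less_card Cohen_Macaulay_link[OF CM dc True] down_closed_link[OF dc] finL _ r'_ge r' \<rho>L] fin
        by (auto simp: link_def)
      then have "insert v \<tau> \<in> \<Delta>" "v \<notin> \<tau>"
        by (auto simp: link_def)
      moreover have "card (insert v \<tau>) = Suc r'"
        using \<open>v \<notin> \<tau>\<close> \<tau> fin[OF \<open>insert v \<tau> \<in> \<Delta>\<close>] by simp
      ultimately show "card \<rho> \<le> Suc r' \<and> (\<exists>\<tau>\<in>\<Delta>. \<rho> \<subseteq> \<tau> \<and> card \<tau> = Suc r')"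
        using \<open>card \<rho> \<le> Suc r'\<close> \<tau>(2) by blast
    qed
  next
    case False
    then have "v \<notin> \<rho>" if "\<rho> \<in> \<Delta>" for \<rho>
      using that dc by (auto intro: down_closedD)
    then show ?thesis
      by auto
  qed
  then obtain g where g: "\<And>v \<rho>. \<rho> \<in> \<Delta> \<Longrightarrow> v \<in> \<rho> \<Longrightarrow> card \<rho> \<le> g v \<and> (\<exists>\<tau>\<in>\<Delta>. \<rho> \<subseteq> \<tau> \<and> card \<tau> = g v)"
    by metis
  obtain F where F: "F \<in> \<Delta>" "card F = r"
    using less.prems(6) by auto
  show ?case
  proof (cases "\<sigma> = {}")
    case True
    then show ?thesis
      using F by auto
  next
    case False
    then obtain w where w: "w \<in> \<sigma>"
      by auto
    then have wD: "{w} \<in> \<Delta>"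
      using less.prems(7) dc by (auto intro: down_closedD)
    have le: "g v \<le> r" if "{v} \<in> \<Delta>" for v
      using g[OF that, of v] less.prems(5) by (metis insertI1)
    have "g w = r"
    proof (rule ccontr)
      assume gw: "g w \<noteq> r"
      have "1 \<le> g w"
        using g[OF wD] by auto
      with gw le[OF wD] have "2 \<le> r"
        by simp
      then obtain a where a: "a \<in> F"
        using F by fastforce
      \<comment> \<open>r is at least 2 because 1 \<le> g w < r, so degree 0 lies below the
        dimension r - 1.\<close>
      have "reduced_homology_vanishes TYPE('k) \<Delta> 0"
      proof -
        have "complex_dim \<Delta> = int r - 1"
          using complex_dim_eq[OF fin\<Delta> F] less.prems(5) by simp
        moreover have "{} \<in> \<Delta>"
          using F dc by (auto intro: down_closedD)
        ultimately show ?thesis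
          using CM \<open>2 \<le> r\<close> unfolding Cohen_Macaulay_complex_def
          by (metis link_empty diff_gt_0_iff_gt of_nat_1 of_nat_less_iff one_less_numeral_iff order_less_le_trans semiring_norm(76))
      qed
      then show False
      proof (rule homology_0_connected[where a = a and w = w and A = "{v. g v = r}"])
        show "finite (\<Union>\<Delta>)" "\<Delta> \<subseteq> Pow (\<Union>\<Delta>)"
          using fin\<Delta> fin by auto
        show "{w} \<in> \<Delta>" "{a} \<in> \<Delta>"
          using wD a F dc by (auto intro: down_closedD)
        show "a \<in> {v. g v = r}"
          using g[OF F(1) a] le[OF \<open>{a} \<in> \<Delta>\<close>] F by auto
        show "w \<notin> {v. g v = r}"
          using gw by simp
        \<comment> \<open>The edge lies in a face of size g u = r. That face contains v as well, so
          g v is r.\<close>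
        fix u v
        assume uv: "{u, v} \<in> \<Delta>" "u \<in> {v. g v = r}"
        then obtain \<tau> where "\<tau> \<in> \<Delta>" "{u, v} \<subseteq> \<tau>" "card \<tau> = r"
          using g[OF uv(1), of u] by auto
        moreover have "{v} \<in> \<Delta>"
          using uv dc by (auto intro: down_closedD)
        ultimately show "v \<in> {v. g v = r}"
          using g[of \<tau> v] le[of v] by auto
      qed
    qed
    with g[OF less.prems(7) w] show ?thesis
      by auto
  qed
qed

text \<open>Purity gives the link of \<sigma> dimension exactly d - card \<sigma>, so both bounds
  coincide.\<close>

lemma strong_CM_of_Cohen_Macaulay:
  assumes CM: "Cohen_Macaulay_complex TYPE('k::field) \<Delta>" and "simplicial_complex_on V \<Delta>"
    and dim: "complex_dim \<Delta> = int d"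
  shows "strong_CM TYPE('k) \<Delta> (Suc d)"
proof -
  have dc: "down_closed \<Delta>" and finV: "finite V" "\<Delta> \<subseteq> Pow V" and e: "{} \<in> \<Delta>"
    using assms(2) by (auto simp: simplicial_complex_on_def down_closed_def)
  then have fin\<Delta>: "finite \<Delta>" and fin: "\<And>\<sigma>. \<sigma> \<in> \<Delta> \<Longrightarrow> finite \<sigma>"
    by (auto intro: finite_subset)
  have "face_dim \<tau> \<le> int d" if "\<tau> \<in> \<Delta>" for \<tau>
    using that fin\<Delta> unfolding dim[symmetric] complex_dim_def by simp
  then have le: "card \<tau> \<le> Suc d" if "\<tau> \<in> \<Delta>" for \<tau>
    using that by (fastforce simp: face_dim_def)
  have "complex_dim \<Delta> \<in> face_dim ` \<Delta>"
    unfolding complex_dim_def using fin\<Delta> e by (intro Max_in) auto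
  then obtain \<tau> where "\<tau> \<in> \<Delta>" "int d = int (card \<tau>) - 1"
    unfolding dim by (auto simp: face_dim_def)
  then have ex: "\<exists>\<tau>\<in>\<Delta>. card \<tau> = Suc d"
    by (intro bexI[of _ \<tau>]) linarith+
  have "reduced_homology_vanishes TYPE('k) (link \<Delta> \<sigma>) i"
    if \<sigma>: "\<sigma> \<in> \<Delta>" and i: "i < int (Suc d) - int (card \<sigma>) - 1" for \<sigma> i
  proof -
    obtain \<tau> where \<tau>: "\<tau> \<in> \<Delta>" "\<sigma> \<subseteq> \<tau>" "card \<tau> = Suc d"
      using Cohen_Macaulay_pure[OF CM dc fin\<Delta> fin le ex \<sigma>] by blast
    have "complex_dim (link \<Delta> \<sigma>) = int (Suc d - card \<sigma>) - 1"
    proof (rule complex_dim_eq)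
      show "finite (link \<Delta> \<sigma>)"
        using fin\<Delta> by (auto simp: link_def)
      have "\<tau> - \<sigma> \<union> \<sigma> = \<tau>"
        using \<tau>(2) by auto
      with \<tau> show "\<tau> - \<sigma> \<in> link \<Delta> \<sigma>"
        using dc by (auto simp: link_def intro: down_closedD)
      show "card (\<tau> - \<sigma>) = Suc d - card \<sigma>"
        using \<tau> fin[OF \<sigma>] by (simp add: card_Diff_subset)
      fix \<rho>
      assume "\<rho> \<in> link \<Delta> \<sigma>"
      then have "\<rho> \<union> \<sigma> \<in> \<Delta>" "\<rho> \<in> \<Delta>" "\<rho> \<inter> \<sigma> = {}"
        by (auto simp: link_def)
      then have "card (\<rho> \<union> \<sigma>) = card \<rho> + card \<sigma>"
        using fin[OF \<sigma>] fin[of \<rho>] by (intro card_Un_disjoint) auto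
      moreover have "card (\<rho> \<union> \<sigma>) \<le> Suc d"
        by (rule le) fact
      ultimately show "card \<rho> \<le> Suc d - card \<sigma>"
        by simp
    qed
    moreover have "card \<sigma> \<le> Suc d"
      by (rule le[OF \<sigma>])
    ultimately show ?thesis
      using CM \<sigma> i unfolding Cohen_Macaulay_complex_def by simp
  qed
  then show ?thesis
    using dc fin\<Delta> fin e by (simp add: strong_CM_def)
qed

section \<open>The polynomial ring\<close>

lemma mpoly_ring_simps [simp]:
  "mult (mpoly_ring n) = (*)" "one (mpoly_ring n) = 1" "zero (mpoly_ring n) = 0" "add (mpoly_ring n) = (+)"
  by (simp_all add: mpoly_ring_def)

lemma mem_mpoly_ring:
  "p \<in> carrier (mpoly_ring n) \<longleftrightarrow> (\<forall>m\<in>Poly_Mapping.keys p. Poly_Mapping.keys m \<subseteq> {1..n})"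
  by (simp add: mpoly_ring_def)

lemma mpoly_ring_closed:
  fixes p q :: "'k::field mpoly"
  assumes "p \<in> carrier (mpoly_ring n)" "q \<in> carrier (mpoly_ring n)"
  shows "p + q \<in> carrier (mpoly_ring n)" "p * q \<in> carrier (mpoly_ring n)"
proof -
  show "p + q \<in> carrier (mpoly_ring n)"
    using assms Poly_Mapping.keys_add[of p q] unfolding mem_mpoly_ring by blast
  have "Poly_Mapping.keys m \<subseteq> {1..n}" if "m \<in> Poly_Mapping.keys (p * q)" for m
  proof -
    obtain a b where "a \<in> Poly_Mapping.keys p" "b \<in> Poly_Mapping.keys q" "m = a + b"
      using \<open>m \<in> Poly_Mapping.keys (p * q)\<close> keys_mult[of p q] by blast
    then show ?thesis
      using assms unfolding mem_mpoly_ring by (simp add: keys_add_nat)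
  qed
  then show "p * q \<in> carrier (mpoly_ring n)"
    by (simp add: mem_mpoly_ring)
qed

lemma mpoly_ring_uminus: "p \<in> carrier (mpoly_ring n) \<Longrightarrow> - p \<in> carrier (mpoly_ring n)"
  unfolding mem_mpoly_ring by (simp add: in_keys_iff)

lemma cring_mpoly_ring: "cring (mpoly_ring n :: 'k::field mpoly ring)"
proof (rule cringI)
  show "abelian_group (mpoly_ring n :: 'k mpoly ring)"
  proof (rule abelian_groupI)
    fix x :: "'k mpoly"
    assume "x \<in> carrier (mpoly_ring n)"
    then show "\<exists>y\<in>carrier (mpoly_ring n). y \<oplus>\<^bsub>mpoly_ring n\<^esub> x = \<zero>\<^bsub>mpoly_ring n\<^esub>"
      by (intro bexI[of _ "- x"] mpoly_ring_uminus) auto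
  qed (simp_all add: mpoly_ring_closed add_ac, simp add: mem_mpoly_ring)
  show "comm_monoid (mpoly_ring n :: 'k mpoly ring)"
    by (rule comm_monoidI) (simp_all add: mpoly_ring_closed mult_ac, simp add: mem_mpoly_ring)
qed (simp add: distrib_right)

lemma single_mem_mpoly_ring: "Poly_Mapping.keys m \<subseteq> {1..n} \<Longrightarrow> Poly_Mapping.single m c \<in> carrier (mpoly_ring n)"
  by (simp add: mem_mpoly_ring)

lemma prod_Var:
  assumes "finite \<sigma>"
  shows "(\<Prod>i\<in>\<sigma>. Var i :: 'k::field mpoly) = Poly_Mapping.single (\<Sum>i\<in>\<sigma>. Poly_Mapping.single i (Suc 0)) 1"
  using assms by induction (simp_all add: Var_def mult_single)

lemma Var_power: "(Var i :: 'k::field mpoly) ^ a = Poly_Mapping.single (Poly_Mapping.single i a) 1"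
  by (induction a) (simp_all add: Var_def mult_single flip: single_add)

lemma lookup_sum_single:
  "finite \<sigma> \<Longrightarrow> Poly_Mapping.lookup (\<Sum>i\<in>\<sigma>. Poly_Mapping.single i (Suc 0)) j = (if j \<in> \<sigma> then 1 else (0::nat))"
  by (simp add: lookup_sum lookup_single when_def)

lemma keys_sum_single: "finite \<sigma> \<Longrightarrow> Poly_Mapping.keys (\<Sum>i\<in>\<sigma>. Poly_Mapping.single i (Suc 0)) = \<sigma>"
  by (auto simp: in_keys_iff lookup_sum_single split: if_splits)

lemma SR_generators_subset:
  "{\<Prod>i\<in>\<sigma>. Var i :: 'k::field mpoly |\<sigma>. \<sigma> \<subseteq> {1..n} \<and> \<sigma> \<notin> \<Delta>} \<subseteq> carrier (mpoly_ring n)"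
proof clarify
  fix \<sigma> :: "nat set"
  assume "\<sigma> \<subseteq> {1..n}" "\<sigma> \<notin> \<Delta>"
  moreover from this(1) have "finite \<sigma>"
    by (rule finite_subset) simp
  ultimately show "(\<Prod>i\<in>\<sigma>. Var i :: 'k mpoly) \<in> carrier (mpoly_ring n)"
    by (simp add: prod_Var single_mem_mpoly_ring keys_sum_single)
qed

lemma ideal_stanley_reisner: "ideal (stanley_reisner_ideal n \<Delta> :: 'k::field mpoly set) (mpoly_ring n)"
  unfolding stanley_reisner_ideal_def
  using cring.axioms(1)[OF cring_mpoly_ring] SR_generators_subset by (rule ring.genideal_ideal)

lemma ideal_SR_plus:
  assumes "S \<subseteq> carrier (mpoly_ring n)"
  shows "ideal (SR_plus n \<Delta> S :: 'k::field mpoly set) (mpoly_ring n)"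
  unfolding SR_plus_def using cring.axioms(1)[OF cring_mpoly_ring] ideal_stanley_reisner assms
  by (intro ring.add_ideals ring.genideal_ideal)

lemma mpoly_ideal_closed:
  fixes J :: "'k::field mpoly set"
  assumes "ideal J (mpoly_ring n)"
  shows "0 \<in> J" "p \<in> J \<Longrightarrow> q \<in> J \<Longrightarrow> p + q \<in> J" "p \<in> J \<Longrightarrow> q \<in> carrier (mpoly_ring n) \<Longrightarrow> q * p \<in> J"
    "J \<subseteq> carrier (mpoly_ring n)"
proof -
  interpret ideal J "mpoly_ring n" by fact
  show "0 \<in> J" "p \<in> J \<Longrightarrow> q \<in> J \<Longrightarrow> p + q \<in> J"
    using additive_subgroup.zero_closed[OF is_additive_subgroup]
      additive_subgroup.a_closed[OF is_additive_subgroup] by simp_all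
  show "p \<in> J \<Longrightarrow> q \<in> carrier (mpoly_ring n) \<Longrightarrow> q * p \<in> J"
    using I_l_closed by simp
  show "J \<subseteq> carrier (mpoly_ring n)"
    by (rule a_subset)
qed

lemma mpoly_ideal_diff:
  fixes J :: "'k::field mpoly set"
  assumes "ideal J (mpoly_ring n)" "p \<in> J" "q \<in> J"
  shows "p - q \<in> J"
proof -
  have "- 1 \<in> carrier (mpoly_ring n)"
    by (simp add: mem_mpoly_ring)
  then have "- 1 * q \<in> J"
    by (rule mpoly_ideal_closed(3)[OF assms(1,3)])
  then have "p + (- 1 * q) \<in> J"
    using mpoly_ideal_closed(2)[OF assms(1,2)] by blast
  then show ?thesis
    by simp
qed

lemma mpoly_ideal_sum:
  fixes J :: "'k::field mpoly set"
  assumes "ideal J (mpoly_ring n)" "\<And>i. i \<in> I \<Longrightarrow> f i \<in> J"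
  shows "sum f I \<in> J"
  using assms(2)
  by (induction I rule: infinite_finite_induct) (auto intro: mpoly_ideal_closed[OF assms(1)])

text \<open>Such a monomial is a multiple of the squarefree monomial on its support, a generator of
  the ideal.\<close>

lemma nonface_mem_SR_ideal:
  assumes "Poly_Mapping.keys m \<subseteq> {1..n}" "Poly_Mapping.keys m \<notin> \<Delta>"
  shows "(Poly_Mapping.single m c :: 'k::field mpoly) \<in> stanley_reisner_ideal n \<Delta>"
proof -
  let ?\<sigma> = "Poly_Mapping.keys m" and ?R = "mpoly_ring n :: 'k mpoly ring"
  let ?e = "\<Sum>i\<in>?\<sigma>. Poly_Mapping.single i (Suc 0)"
  have "(\<Prod>i\<in>?\<sigma>. Var i :: 'k mpoly) \<in> {\<Prod>i\<in>\<sigma>. Var i |\<sigma>. \<sigma> \<subseteq> {1..n} \<and> \<sigma> \<notin> \<Delta>}"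
    using assms by blast
  then have gen: "(\<Prod>i\<in>?\<sigma>. Var i :: 'k mpoly) \<in> stanley_reisner_ideal n \<Delta>"
    unfolding stanley_reisner_ideal_def
    using ring.genideal_self[OF cring.axioms(1)[OF cring_mpoly_ring] SR_generators_subset] by blast
  have eq: "(m - ?e) + ?e = m"
  proof (rule poly_mapping_eqI)
    fix i
    show "Poly_Mapping.lookup ((m - ?e) + ?e) i = Poly_Mapping.lookup m i"
      using lookup_sum_single[of ?\<sigma> i] by (auto simp add: lookup_add lookup_minus in_keys_iff)
  qed
  have "?\<sigma> = Poly_Mapping.keys (m - ?e) \<union> Poly_Mapping.keys ?e"
    using keys_add_nat[of "m - ?e" ?e] by (simp only: eq)
  then have "Poly_Mapping.keys (m - ?e) \<subseteq> {1..n}"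
    using assms(1) by blast
  then have "Poly_Mapping.single (m - ?e) c * (\<Prod>i\<in>?\<sigma>. Var i) \<in> stanley_reisner_ideal n \<Delta>"
    by (intro mpoly_ideal_closed(3)[OF ideal_stanley_reisner gen] single_mem_mpoly_ring)
  then show ?thesis
    by (simp add: prod_Var mult_single eq)
qed

text \<open>The polynomials all of whose monomials have nonface support form an ideal that contains
  the generators; this uses that supersets of nonfaces are nonfaces.\<close>

lemma SR_ideal_nonface:
  fixes p :: "'k::field mpoly"
  assumes "p \<in> stanley_reisner_ideal n \<Delta>" "m \<in> Poly_Mapping.keys p" "down_closed \<Delta>"
  shows "Poly_Mapping.keys m \<notin> \<Delta>"
proof -
  let ?R = "mpoly_ring n :: 'k mpoly ring"
  let ?I = "{p \<in> carrier ?R. \<forall>m\<in>Poly_Mapping.keys p. Poly_Mapping.keys m \<notin> \<Delta>}"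
  interpret cring ?R by (rule cring_mpoly_ring)
  have mult: "q * p \<in> ?I" if "p \<in> ?I" "q \<in> carrier ?R" for p q
  proof -
    have "Poly_Mapping.keys m \<notin> \<Delta>" if "m \<in> Poly_Mapping.keys (q * p)" for m
    proof -
      obtain a b where "b \<in> Poly_Mapping.keys p" "m = a + b"
        using \<open>m \<in> Poly_Mapping.keys (q * p)\<close> keys_mult[of q p] by blast
      with \<open>p \<in> ?I\<close> assms(3) show ?thesis
        by (auto simp: keys_add_nat intro: down_closedD)
    qed
    with that show ?thesis
      by (simp add: mpoly_ring_closed)
  qed
  have "ideal ?I ?R"
  proof (rule idealI[OF ring_axioms])
    have minus: "\<ominus>\<^bsub>?R\<^esub> x = - x" if "x \<in> carrier ?R" for x
      by (rule minus_equality) (use that in \<open>auto simp: mpoly_ring_uminus\<close>)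
    show "subgroup ?I (add_monoid ?R)"
    proof (rule add.subgroupI)
      show "\<ominus>\<^bsub>?R\<^esub> x \<in> ?I" if "x \<in> ?I" for x
        using that minus[of x] by (auto simp: mpoly_ring_uminus in_keys_iff)
      show "x \<oplus>\<^bsub>?R\<^esub> y \<in> ?I" if "x \<in> ?I" "y \<in> ?I" for x y
        using that Poly_Mapping.keys_add[of x y] by (auto simp: mpoly_ring_closed)
      show "?I \<noteq> {}"
        by (auto intro!: exI[of _ 0] simp: mem_mpoly_ring)
    qed auto
    show "x \<otimes>\<^bsub>?R\<^esub> y \<in> ?I" "y \<otimes>\<^bsub>?R\<^esub> x \<in> ?I" if "y \<in> ?I" "x \<in> carrier ?R" for x y
      using mult[OF that] by (simp_all add: mult.commute)
  qed
  moreover have "{\<Prod>i\<in>\<sigma>. Var i :: 'k mpoly |\<sigma>. \<sigma> \<subseteq> {1..n} \<and> \<sigma> \<notin> \<Delta>} \<subseteq> ?I"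
  proof clarify
    fix \<sigma> :: "nat set"
    assume \<sigma>: "\<sigma> \<subseteq> {1..n}" "\<sigma> \<notin> \<Delta>"
    then have "finite \<sigma>"
      by (auto intro: finite_subset)
    moreover have "(\<Prod>i\<in>\<sigma>. Var i :: 'k mpoly) \<in> carrier ?R"
      using \<sigma> by (intro subsetD[OF SR_generators_subset[of n \<Delta>]]) auto
    ultimately show "(\<Prod>i\<in>\<sigma>. Var i :: 'k mpoly) \<in> carrier ?R \<and>
        (\<forall>m\<in>Poly_Mapping.keys (\<Prod>i\<in>\<sigma>. Var i :: 'k mpoly). Poly_Mapping.keys m \<notin> \<Delta>)"
      using \<sigma> by (simp add: prod_Var keys_sum_single)
  qed
  ultimately have "stanley_reisner_ideal n \<Delta> \<subseteq> ?I"
    unfolding stanley_reisner_ideal_def by (rule genideal_minimal)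
  with assms show ?thesis
    by auto
qed

text \<open>The coefficients \<open>c\<close> may be arbitrary polynomials, since they serve only as
  operators on functionals and \<open>contraction\<close> accepts every polynomial.\<close>

lemma SR_plus_decompose:
  fixes \<theta> :: "nat \<Rightarrow> 'k::field mpoly"
  assumes "p \<in> SR_plus n \<Delta> (\<theta> ` {1..s})" and \<theta>: "\<And>j. j \<in> {1..s} \<Longrightarrow> \<theta> j \<in> carrier (mpoly_ring n)"
  shows "\<exists>q c. q \<in> stanley_reisner_ideal n \<Delta> \<and> p = q + (\<Sum>j\<in>{1..s}. c j * \<theta> j)"
proof -
  let ?R = "mpoly_ring n :: 'k mpoly ring"
  interpret cring ?R by (rule cring_mpoly_ring)
  let ?I = "{p \<in> carrier ?R. \<exists>c. p = (\<Sum>j\<in>{1..s}. c j * \<theta> j)}"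
  have "ideal ?I ?R"
  proof (rule idealI[OF ring_axioms])
    have minus: "\<ominus>\<^bsub>?R\<^esub> x = - x" if "x \<in> carrier ?R" for x
      by (rule minus_equality) (use that in \<open>auto simp: mpoly_ring_uminus\<close>)
    show "subgroup ?I (add_monoid ?R)"
    proof (rule add.subgroupI)
      show "\<ominus>\<^bsub>?R\<^esub> x \<in> ?I" if x: "x \<in> ?I" for x
      proof -
        obtain c where "x = (\<Sum>j\<in>{1..s}. c j * \<theta> j)"
          using x by blast
        then have "- x = (\<Sum>j\<in>{1..s}. (- c j) * \<theta> j)"
          by (simp add: sum_negf)
        then have "\<exists>c. - x = (\<Sum>j\<in>{1..s}. c j * \<theta> j)"
          by (intro exI[of _ "\<lambda>j. - c j"])
        then show ?thesis
          using x minus[of x] by (simp add: mpoly_ring_uminus)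
      qed
      show "x \<oplus>\<^bsub>?R\<^esub> y \<in> ?I" if x: "x \<in> ?I" and y: "y \<in> ?I" for x y
      proof -
        obtain c c' where "x = (\<Sum>j\<in>{1..s}. c j * \<theta> j)" "y = (\<Sum>j\<in>{1..s}. c' j * \<theta> j)"
          using x y by blast
        then have "x + y = (\<Sum>j\<in>{1..s}. (c j + c' j) * \<theta> j)"
          by (simp add: distrib_right sum.distrib)
        then have "\<exists>c. x + y = (\<Sum>j\<in>{1..s}. c j * \<theta> j)"
          by (intro exI[of _ "\<lambda>j. c j + c' j"])
        then show ?thesis
          using x y by (simp add: mpoly_ring_closed)
      qed
      have "0 \<in> ?I"
        by (auto intro!: exI[of _ "\<lambda>_. 0"] simp: mem_mpoly_ring)
      then show "?I \<noteq> {}"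
        by blast
    qed auto
    have mult: "x * y \<in> ?I" if y: "y \<in> ?I" and x: "x \<in> carrier ?R" for x y
    proof -
      obtain c where "y = (\<Sum>j\<in>{1..s}. c j * \<theta> j)"
        using y by blast
      then have "x * y = (\<Sum>j\<in>{1..s}. (x * c j) * \<theta> j)"
        by (simp add: sum_distrib_left mult.assoc)
      then have "\<exists>c. x * y = (\<Sum>j\<in>{1..s}. c j * \<theta> j)"
        by (intro exI[of _ "\<lambda>j. x * c j"])
      then show ?thesis
        using x y by (simp add: mpoly_ring_closed)
    qed
    show "x \<otimes>\<^bsub>?R\<^esub> y \<in> ?I" "y \<otimes>\<^bsub>?R\<^esub> x \<in> ?I" if "y \<in> ?I" "x \<in> carrier ?R" for x y
      using mult[OF that] by (simp_all add: mult.commute)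
  qed
  moreover have "\<theta> ` {1..s} \<subseteq> ?I"
  proof
    fix x
    assume "x \<in> \<theta> ` {1..s}"
    then obtain i where i: "i \<in> {1..s}" "x = \<theta> i"
      by blast
    have "(\<Sum>j\<in>{1..s}. (if j = i then 1 else 0) * \<theta> j) = (\<Sum>j\<in>{1..s}. if j = i then \<theta> j else 0)"
      by (intro sum.cong) auto
    then have "x = (\<Sum>j\<in>{1..s}. (if j = i then 1 else 0) * \<theta> j)"
      using i by simp
    then have "\<exists>c. x = (\<Sum>j\<in>{1..s}. c j * \<theta> j)"
      by (intro exI[of _ "\<lambda>j. if j = i then 1 else 0"])
    with i \<theta> show "x \<in> ?I"
      by simp
  qed
  ultimately have "Idl\<^bsub>?R\<^esub> (\<theta> ` {1..s}) \<subseteq> ?I"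
    by (rule genideal_minimal)
  moreover obtain q r where "q \<in> stanley_reisner_ideal n \<Delta>" "r \<in> Idl\<^bsub>?R\<^esub> (\<theta> ` {1..s})" "p = q + r"
    using assms(1) unfolding SR_plus_def set_add_def' by auto
  ultimately show ?thesis
    by blast
qed

lemma contraction_SR_ideal:
  fixes \<phi> :: "(nat \<Rightarrow>\<^sub>0 nat) \<Rightarrow> 'k::field"
  assumes "q \<in> stanley_reisner_ideal n \<Delta>" "\<phi> \<in> SR_dual \<Delta>" "down_closed \<Delta>"
  shows "contraction q \<phi> = 0"
proof
  fix m
  have "\<phi> (m' + m) = 0" if "m' \<in> Poly_Mapping.keys q" for m'
  proof (rule ccontr)
    assume "\<phi> (m' + m) \<noteq> 0"
    then have "Poly_Mapping.keys (m' + m) \<in> \<Delta>"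
      using assms(2) by (auto simp: SR_dual_def)
    then have "Poly_Mapping.keys m' \<in> \<Delta>"
      using assms(3) by (auto simp: keys_add_nat intro: down_closedD)
    with SR_ideal_nonface[OF assms(1) that assms(3)] show False
      by simp
  qed
  then show "contraction q \<phi> m = 0 m"
    by (simp add: contraction_def)
qed

section \<open>Collapses\<close>

lemma monomial_degree_superset:
  assumes "finite A" "Poly_Mapping.keys m \<subseteq> A"
  shows "monomial_degree m = (\<Sum>i\<in>A. Poly_Mapping.lookup m i)"
  unfolding monomial_degree_def by (rule sum.mono_neutral_left[OF assms]) (simp add: in_keys_iff)

lemma monomial_degree_add [simp]: "monomial_degree (m + m') = monomial_degree m + monomial_degree m'"
  by (simp add: monomial_degree_superset[of "Poly_Mapping.keys m \<union> Poly_Mapping.keys m'"] keys_add_nat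
      lookup_add sum.distrib)

lemma monomial_degree_zero [simp]: "monomial_degree 0 = 0"
  by (simp add: monomial_degree_def)

lemma monomial_degree_single [simp]: "monomial_degree (Poly_Mapping.single i k) = k"
  by (simp add: monomial_degree_def)

text \<open>A monomial with support \<open>\<sigma>\<close> or \<open>\<tau> = \<sigma> \<union> {v}\<close> is rewritten modulo the sum of the variables so
  that the exponent of \<open>v\<close> decreases. When \<open>v\<close> is gone, the support is \<open>\<sigma>\<close>, which has at most
  \<open>d\<close> elements, so some exponent is at least \<open>a\<close>.\<close>
lemma collapse_step:
  fixes J :: "'k::field mpoly set"
  assumes J: "ideal J (mpoly_ring n)"
    and pow: "\<And>i. i \<in> {1..n} \<Longrightarrow> Var i ^ a \<in> J"
    and lin: "(\<Sum>i=1..n. Var i) \<in> J"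
    and \<Gamma>: "down_closed \<Gamma>" "\<Gamma> \<subseteq> Pow {1..n}" "\<And>\<tau>. \<tau> \<in> \<Gamma> \<Longrightarrow> card \<tau> \<le> Suc d"
    and IH: "\<And>m. \<lbrakk>Poly_Mapping.keys m \<subseteq> {1..n}; Poly_Mapping.keys m \<notin> \<Gamma>; d * (a - 1) < monomial_degree m\<rbrakk>
       \<Longrightarrow> Poly_Mapping.single m 1 \<in> J"
    and col: "\<sigma> \<in> \<Gamma>" "{\<rho> \<in> \<Gamma>. \<sigma> \<subset> \<rho>} = {\<tau>}"
    and m: "Poly_Mapping.keys m \<subseteq> {1..n}" "Poly_Mapping.keys m \<notin> \<Gamma> - {\<sigma>, \<tau>}" "d * (a - 1) < monomial_degree m"
  shows "Poly_Mapping.single m 1 \<in> J"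
proof -
  have "\<tau> \<in> \<Gamma>" "\<sigma> \<subset> \<tau>"
    using col(2) by auto
  then obtain v where v: "v \<in> \<tau>" "v \<notin> \<sigma>"
    by blast
  then have "insert v \<sigma> \<in> {\<rho> \<in> \<Gamma>. \<sigma> \<subset> \<rho>}"
    using \<open>\<tau> \<in> \<Gamma>\<close> \<open>\<sigma> \<subset> \<tau>\<close> \<Gamma>(1) by (auto intro: down_closedD)
  then have \<tau>: "\<tau> = insert v \<sigma>"
    using col(2) by auto
  have fin: "finite \<sigma>"
    using col(1) \<Gamma>(2) by (auto intro: finite_subset)
  \<comment> \<open>The free face misses v and so is smaller than \<tau>. This is why the degree
    bound has d and not d + 1.\<close>
  then have card_\<sigma>: "card \<sigma> \<le> d"
    using \<Gamma>(3)[OF \<open>\<tau> \<in> \<Gamma>\<close>] v by (simp add: \<tau>)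
  have vn: "v \<in> {1..n}"
    using \<open>\<tau> \<in> \<Gamma>\<close> \<Gamma>(2) v by blast
  \<comment> \<open>The claim covers every support containing \<sigma>, since rewriting may bring in
    further vertices. Once the exponent of v is 0, such a support is \<sigma> itself or a nonface,
    and nonfaces are covered by \<open>IH\<close>.\<close>
  have main: "Poly_Mapping.single m 1 \<in> J" if "\<sigma> \<subseteq> Poly_Mapping.keys m" "Poly_Mapping.keys m \<subseteq> {1..n}"
    "d * (a - 1) < monomial_degree m" "Poly_Mapping.lookup m v = k" for k m
    using that
  proof (induction k arbitrary: m)
    case 0
    show ?case
    proof (cases "Poly_Mapping.keys m \<in> \<Gamma>")
      case True
      have "v \<notin> Poly_Mapping.keys m"
        using 0 by (simp add: in_keys_iff)
      then have "Poly_Mapping.keys m \<noteq> \<tau>"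
        using v(1) by auto
      then have keys: "Poly_Mapping.keys m = \<sigma>"
        using True 0(1) col(2) by blast
      have "\<exists>i\<in>\<sigma>. a \<le> Poly_Mapping.lookup m i"
      proof (rule ccontr)
        assume "\<not> ?thesis"
        then have "Poly_Mapping.lookup m i \<le> a - 1" if "i \<in> \<sigma>" for i
          using that by fastforce
        then have "monomial_degree m \<le> card \<sigma> * (a - 1)"
          unfolding monomial_degree_def keys
          using sum_bounded_above[of \<sigma> "Poly_Mapping.lookup m" "a - 1"] by simp
        also have "\<dots> \<le> d * (a - 1)"
          using card_\<sigma> by simp
        finally show False
          using 0 by simp
      qed
      then obtain i where i: "i \<in> \<sigma>" "a \<le> Poly_Mapping.lookup m i"
        by blast
      let ?m = "m - Poly_Mapping.single i a"
      have eq: "?m + Poly_Mapping.single i a = m"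
        using i(2) by (intro poly_mapping_eqI) (auto simp: lookup_add lookup_minus lookup_single when_def)
      then have "Poly_Mapping.keys ?m \<subseteq> {1..n}"
        using 0(2) keys_add_nat[of ?m "Poly_Mapping.single i a"] by auto
      then have "Poly_Mapping.single ?m 1 * Var i ^ a \<in> J"
        using i keys 0(2) by (intro mpoly_ideal_closed(3)[OF J] pow single_mem_mpoly_ring) auto
      then show ?thesis
        by (simp add: Var_power mult_single eq)
    next
      case False
      with 0 IH show ?thesis
        by blast
    qed
  next
    case (Suc k)
    let ?m = "m - Poly_Mapping.single v (Suc 0)"
    have v_keys: "v \<in> Poly_Mapping.keys m"
      using Suc.prems by (simp add: in_keys_iff)
    have eq: "Poly_Mapping.single v (Suc 0) + ?m = m"
      by (rule exponent_remove[OF v_keys])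
    have keys: "Poly_Mapping.keys ?m \<subseteq> {1..n}" "\<sigma> \<subseteq> Poly_Mapping.keys ?m"
      using Suc.prems keys_single_add[of v ?m] v(2) by (auto simp: eq)
    have deg: "Suc (monomial_degree ?m) = monomial_degree m"
      using monomial_degree_add[of "Poly_Mapping.single v (Suc 0)" ?m] by (simp add: eq)
    \<comment> \<open>Multiplying the linear form by x^m / x_v expresses x^m by the monomials x_i
      x^m / x_v with i \<noteq> v. They have the same degree, are still divisible by every variable
      of \<sigma>, and have one x_v less.\<close>
    have "Poly_Mapping.single ?m 1 * (\<Sum>i=1..n. Var i) \<in> J"
      by (intro mpoly_ideal_closed(3)[OF J lin] single_mem_mpoly_ring keys)
    also have "Poly_Mapping.single ?m 1 * (\<Sum>i=1..n. Var i) =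
        (\<Sum>i\<in>{1..n}. Poly_Mapping.single (Poly_Mapping.single i (Suc 0) + ?m) (1 :: 'k))"
      by (simp add: sum_distrib_left Var_def mult_single add.commute)
    also have "\<dots> = Poly_Mapping.single m 1 +
        (\<Sum>i\<in>{1..n} - {v}. Poly_Mapping.single (Poly_Mapping.single i (Suc 0) + ?m) 1)"
      using vn by (subst sum.remove[of _ v]) (auto simp: eq)
    finally have "Poly_Mapping.single m 1 +
        (\<Sum>i\<in>{1..n} - {v}. Poly_Mapping.single (Poly_Mapping.single i (Suc 0) + ?m) 1) \<in> J" .
    moreover have "(\<Sum>i\<in>{1..n} - {v}. Poly_Mapping.single (Poly_Mapping.single i (Suc 0) + ?m) (1 :: 'k)) \<in> J"
    proof (rule mpoly_ideal_sum[OF J])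
      fix i
      assume i: "i \<in> {1..n} - {v}"
      show "Poly_Mapping.single (Poly_Mapping.single i (Suc 0) + ?m) (1 :: 'k) \<in> J"
      proof (rule Suc.IH)
        show "d * (a - 1) < monomial_degree (Poly_Mapping.single i (Suc 0) + ?m)"
          using Suc.prems deg by simp
        show "Poly_Mapping.lookup (Poly_Mapping.single i (Suc 0) + ?m) v = k"
          using Suc.prems i by (simp add: lookup_add lookup_minus lookup_single)
      qed (use keys i in \<open>auto simp: keys_single_add\<close>)
    qed
    ultimately show ?case
      using mpoly_ideal_diff[OF J] by fastforce
  qed
  show ?thesis
  proof (cases "Poly_Mapping.keys m \<in> \<Gamma>")
    case True
    then have "\<sigma> \<subseteq> Poly_Mapping.keys m"
      using m(2) \<tau> by auto
    from main[OF this m(1,3) refl] show ?thesis .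
  next
    case False
    with m IH show ?thesis
      by blast
  qed
qed

lemma down_closed_collapse:
  assumes "down_closed \<Gamma>" "{\<rho> \<in> \<Gamma>. \<sigma> \<subset> \<rho>} = {\<tau>}"
  shows "down_closed (\<Gamma> - {\<sigma>, \<tau>})"
  unfolding down_closed_def
proof (intro ballI allI impI)
  fix \<rho> \<rho>'
  assume \<rho>: "\<rho> \<in> \<Gamma> - {\<sigma>, \<tau>}" "\<rho>' \<subseteq> \<rho>"
  then have "\<rho>' \<in> \<Gamma>"
    using assms(1) by (auto intro: down_closedD)
  moreover have "\<not> \<sigma> \<subset> \<rho>"
    using assms(2) \<rho>(1) by auto
  then have "\<rho>' \<noteq> \<sigma>"
    using \<rho> by blast
  moreover have "\<sigma> \<subset> \<tau>"
    using assms(2) by auto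
  then have "\<rho>' \<noteq> \<tau>"
    using \<rho>(2) \<open>\<not> \<sigma> \<subset> \<rho>\<close> by blast
  ultimately show "\<rho>' \<in> \<Gamma> - {\<sigma>, \<tau>}"
    by simp
qed

lemma collapsible_monomial_mem:
  fixes J :: "'k::field mpoly set"
  assumes J: "ideal J (mpoly_ring n)" "stanley_reisner_ideal n \<Delta> \<subseteq> J"
    and pow: "\<And>i. i \<in> {1..n} \<Longrightarrow> Var i ^ a \<in> J"
    and lin: "(\<Sum>i=1..n. Var i) \<in> J"
    and \<Delta>: "down_closed \<Delta>" "\<Delta> \<subseteq> Pow {1..n}" "\<And>\<tau>. \<tau> \<in> \<Delta> \<Longrightarrow> card \<tau> \<le> Suc d"
    and col: "collapsible \<Delta>"
    and m: "Poly_Mapping.keys m \<subseteq> {1..n}" "d * (a - 1) < monomial_degree m"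
  shows "Poly_Mapping.single m 1 \<in> J"
proof -
  \<comment> \<open>The invariant of the collapse: large monomials supported outside \<Gamma> are in
    J. It starts at \<Delta> with the nonfaces and at \<Gamma> = {} covers every support.\<close>
  define P where "P \<Gamma> \<longleftrightarrow> down_closed \<Gamma> \<and> \<Gamma> \<subseteq> \<Delta> \<and> (\<forall>m. Poly_Mapping.keys m \<subseteq> {1..n} \<and>
    Poly_Mapping.keys m \<notin> \<Gamma> \<and> d * (a - 1) < monomial_degree m \<longrightarrow> (Poly_Mapping.single m 1 :: 'k mpoly) \<in> J)" for \<Gamma>
  have step: "P \<Gamma>'" if "P \<Gamma>" and ec: "elementary_collapse \<Gamma> \<Gamma>'" for \<Gamma> \<Gamma>'
  proof -
    obtain \<sigma> \<tau> where c: "\<sigma> \<in> \<Gamma>" "{\<rho> \<in> \<Gamma>. \<sigma> \<subset> \<rho>} = {\<tau>}" "\<Gamma>' = \<Gamma> - {\<sigma>, \<tau>}"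
      using ec unfolding elementary_collapse_def by blast
    have \<Gamma>: "down_closed \<Gamma>" "\<Gamma> \<subseteq> Pow {1..n}" "\<And>\<tau>. \<tau> \<in> \<Gamma> \<Longrightarrow> card \<tau> \<le> Suc d"
      using \<open>P \<Gamma>\<close> \<Delta> unfolding P_def by blast+
    have "Poly_Mapping.single m 1 \<in> J"
      if m: "Poly_Mapping.keys m \<subseteq> {1..n}" "Poly_Mapping.keys m \<notin> \<Gamma>'" "d * (a - 1) < monomial_degree m" for m
    proof (rule collapse_step[OF J(1) pow lin \<Gamma> _ c(1,2) m(1) _ m(3)])
      show "Poly_Mapping.single m 1 \<in> J"
        if "Poly_Mapping.keys m \<subseteq> {1..n}" "Poly_Mapping.keys m \<notin> \<Gamma>" "d * (a - 1) < monomial_degree m" for m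
        using that \<open>P \<Gamma>\<close> unfolding P_def by blast
      show "Poly_Mapping.keys m \<notin> \<Gamma> - {\<sigma>, \<tau>}"
        using m(2) c(3) by simp
    qed
    moreover have "down_closed \<Gamma>'"
      unfolding c(3) by (rule down_closed_collapse[OF \<Gamma>(1) c(2)])
    moreover have "\<Gamma>' \<subseteq> \<Delta>"
      using \<open>P \<Gamma>\<close> c(3) unfolding P_def by blast
    ultimately show ?thesis
      unfolding P_def by blast
  qed
  have "P \<Delta>"
    using \<Delta>(1) J(2) nonface_mem_SR_ideal unfolding P_def by blast
  obtain v where "elementary_collapse\<^sup>*\<^sup>* \<Delta> {{}, {v}}"
    using col unfolding collapsible_def by blast
  then have "P {{}, {v}}"
    by (induction rule: rtranclp_induct) (auto intro: \<open>P \<Delta>\<close> step)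
  \<comment> \<open>The empty face is free in a single vertex, so the same step removes this last
    pair too.\<close>
  moreover have "elementary_collapse {{}, {v}} {}"
    unfolding elementary_collapse_def by (intro bexI[of _ "{}"] exI[of _ "{v}"]) auto
  ultimately have "P {}"
    by (rule step)
  with m show ?thesis
    unfolding P_def by blast
qed

section \<open>Euler characteristic of the Koszul complex\<close>

context vector_space
begin

lemma independent_disjoint_span_Int:
  assumes B: "independent B" "C \<subseteq> B" "D \<subseteq> B" "C \<inter> D = {}" and x: "x \<in> span C" "x \<in> span D"
  shows "x = 0"
proof -
  have "representation B x = representation C x" "representation B x = representation D x"
    using representation_extend[OF B(1)] B x by metis+
  then have "representation B x b = 0" for b
    using representation_ne_zero[of C x b] representation_ne_zero[of D x b] B(4) by (metis disjoint_iff)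
  moreover have "x \<in> span B"
    using x(1) span_mono[OF B(2)] by blast
  ultimately show ?thesis
    using sum_nonzero_representation_eq[OF B(1)] by fastforce
qed

end

text \<open>A basis of the kernel is extended to one of S, and f is injective on the span of the
  added vectors. The ambient function spaces are infinite dimensional, so finiteness is imposed on S
  through a finite W.\<close>

lemma rank_nullity:
  assumes lin: "Vector_Spaces.linear s1 s2 f" and S: "Modules.module.subspace s1 S"
    and W: "finite W" "S \<subseteq> Modules.module.span s1 W"
  shows "vector_space.dim s1 S =
    vector_space.dim s1 {x \<in> S. f x = 0} + vector_space.dim s2 (f ` S)"
proof -
  interpret Vector_Spaces.linear s1 s2 f by fact
  interpret vector_space_pair s1 s2 ..
  let ?N = "{x \<in> S. f x = 0}"
  obtain B0 where B0: "B0 \<subseteq> ?N" "vs1.independent B0" "?N \<subseteq> vs1.span B0" "card B0 = vs1.dim ?N"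
    by (rule vs1.basis_exists)
  have "B0 \<subseteq> S"
    using B0 by auto
  then obtain B where B: "B0 \<subseteq> B" "B \<subseteq> S" "vs1.independent B" "S \<subseteq> vs1.span B"
    using vs1.maximal_independent_subset_extend[OF _ B0(2)] by blast
  have finB: "finite B"
    using vs1.independent_span_bound[OF W(1) B(3)] B(2) W(2) by auto
  let ?C = "B - B0"
  have spanC: "vs1.span ?C \<subseteq> S"
    using B(2) S by (intro vs1.span_minimal) auto
  have inj: "inj_on f (vs1.span ?C)"
  proof (subst linear_inj_on_iff_eq_0[OF lin])
    show "\<forall>x\<in>vs1.span ?C. f x = 0 \<longrightarrow> x = 0"
    proof (intro ballI impI)
      fix x
      assume "x \<in> vs1.span ?C" "f x = 0"
      moreover from this have "x \<in> vs1.span B0"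
        using spanC B0(3) by auto
      ultimately show "x = 0"
        using vs1.independent_disjoint_span_Int[OF B(3), of ?C B0] B(1) by blast
    qed
  qed simp
  have ind: "vs2.independent (f ` ?C)"
    by (rule linear_independent_injective_image[OF lin vs1.independent_mono[OF B(3) Diff_subset] inj])
  have "f ` S \<subseteq> vs2.span (f ` ?C)"
  proof -
    have "f ` B \<subseteq> vs2.span (f ` ?C)"
    proof
      fix y
      assume "y \<in> f ` B"
      then obtain b where "b \<in> B" "y = f b"
        by blast
      moreover have "f b = 0" if "b \<in> B0"
        using that B0(1) by blast
      ultimately show "y \<in> vs2.span (f ` ?C)"
        by (cases "b \<in> B0") (auto intro: vs2.span_base vs2.span_zero)
    qed
    then have "vs2.span (f ` B) \<subseteq> vs2.span (f ` ?C)"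
      by (intro vs2.span_minimal) auto
    then show ?thesis
      using B(4) linear_span_image[OF lin, of B] by blast
  qed
  moreover have "f ` ?C \<subseteq> f ` S"
    using B(2) by blast
  ultimately have "vs2.dim (f ` S) = card (f ` ?C)"
    using vs2.basis_card_eq_dim[OF _ _ ind] by metis
  also have "\<dots> = card ?C"
    by (rule card_image[OF inj_on_subset[OF inj vs1.span_superset]])
  also have "\<dots> = card B - card B0"
    using B(1) finB by (intro card_Diff_subset) (auto intro: finite_subset)
  finally have "vs2.dim (f ` S) = card B - card B0" .
  moreover have "vs1.dim S = card B"
    using vs1.basis_card_eq_dim[OF B(2,4,3)] by simp
  moreover have "card B0 \<le> card B"
    using B(1) finB by (rule card_mono[rotated])
  ultimately show ?thesis
    using B0(4) by simp
qed

section \<open>Spaces of functions supported on a finite set\<close>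

definition fscale :: "'k::field \<Rightarrow> ('c \<Rightarrow> 'k) \<Rightarrow> 'c \<Rightarrow> 'k" where
  "fscale c f x = c * f x"

global_interpretation fs: vector_space fscale
  by unfold_locales (auto simp: fscale_def fun_eq_iff algebra_simps)

definition supported :: "'c set \<Rightarrow> ('c \<Rightarrow> 'k::field) set" where
  "supported A = {f. \<forall>x. f x \<noteq> 0 \<longrightarrow> x \<in> A}"

lemma subspace_supported: "fs.subspace (supported A)"
  by (rule fs.subspaceI) (auto simp: supported_def fscale_def, metis add.right_neutral)

lemma supported_basis:
  fixes A :: "'c set"
  assumes "finite A"
  shows "supported A \<subseteq> fs.span ((\<lambda>a x. (if x = a then 1 else 0 :: 'k::field)) ` A)"
    "fs.independent ((\<lambda>a x. (if x = a then 1 else 0 :: 'k)) ` A)"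
    "inj_on (\<lambda>a x. (if x = a then 1 else 0 :: 'k)) A"
proof -
  let ?d = "\<lambda>a x. (if x = a then 1 else 0 :: 'k)"
  show inj: "inj_on ?d A"
    by (rule inj_onI) (metis (no_types, lifting) zero_neq_one)
  have ev: "(\<Sum>a\<in>A. fscale (u a) (?d a)) x = (if x \<in> A then u x else 0)" for u x
    using assms by (simp add: sum_fun_apply fscale_def if_distrib cong: if_cong)
  show "supported A \<subseteq> fs.span (?d ` A)"
  proof
    fix f :: "'c \<Rightarrow> 'k"
    assume "f \<in> supported A"
    then have "f = (\<Sum>a\<in>A. fscale (f a) (?d a))"
      unfolding fun_eq_iff ev by (auto simp: supported_def)
    also have "\<dots> \<in> fs.span (?d ` A)"
      by (intro fs.span_sum fs.span_scale fs.span_base) auto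
    finally show "f \<in> fs.span (?d ` A)" .
  qed
  show "fs.independent (?d ` A)"
  proof (rule fs.independent_if_scalars_zero)
    fix u and w
    assume 0: "(\<Sum>w\<in>?d ` A. fscale (u w) w) = 0" and w: "w \<in> ?d ` A"
    then obtain a where a: "a \<in> A" "w = ?d a"
      by blast
    have "(\<Sum>b\<in>A. fscale (u (?d b)) (?d b)) = 0"
      using 0 by (simp add: sum.reindex[OF inj])
    from fun_cong[OF this, of a] have "u (?d a) = 0"
      unfolding ev using a(1) by simp
    then show "u w = 0"
      using a(2) by simp
  qed (use assms in simp)
qed

lemma dim_supported:
  assumes "finite A"
  shows "fs.dim (supported A :: ('c \<Rightarrow> 'k::field) set) = card A"
proof (rule fs.dim_unique)
  show "(\<lambda>a x. (if x = a then 1 else 0 :: 'k)) ` A \<subseteq> supported A"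
    by (auto simp: supported_def split: if_splits)
  show "card ((\<lambda>a x. (if x = a then 1 else 0 :: 'k)) ` A) = card A"
    by (rule card_image) (rule supported_basis[OF assms])
qed (rule supported_basis[OF assms])+

text \<open>A complex folded into two parts exchanged by D. Kernel equals image in both parts, so by
  rank-nullity each dimension is the sum of the same two ranks.\<close>

lemma exact_card_eq:
  fixes D :: "('c \<Rightarrow> 'k::field) \<Rightarrow> 'c \<Rightarrow> 'k"
  assumes lin: "Vector_Spaces.linear fscale fscale D" and fin: "finite A" "finite B"
    and AB: "\<And>f. f \<in> supported A \<Longrightarrow> D f \<in> supported B"
    and BA: "\<And>f. f \<in> supported B \<Longrightarrow> D f \<in> supported A"
    and DD: "\<And>f. D (D f) = 0"
    and exA: "\<And>f. f \<in> supported A \<Longrightarrow> D f = 0 \<Longrightarrow> \<exists>g\<in>supported B. f = D g"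
    and exB: "\<And>f. f \<in> supported B \<Longrightarrow> D f = 0 \<Longrightarrow> \<exists>g\<in>supported A. f = D g"
  shows "card A = card B"
proof -
  have "{f \<in> supported A. D f = 0} = D ` supported B"
    using BA DD exA by blast
  moreover have "{f \<in> supported B. D f = 0} = D ` supported A"
    using AB DD exB by blast
  moreover have "fs.dim (supported A :: ('c \<Rightarrow> 'k) set) =
      fs.dim {f \<in> supported A. D f = 0} + fs.dim (D ` supported A)"
    by (rule rank_nullity[OF lin subspace_supported _ supported_basis(1)[OF fin(1)]]) (use fin in simp)
  moreover have "fs.dim (supported B :: ('c \<Rightarrow> 'k) set) =
      fs.dim {f \<in> supported B. D f = 0} + fs.dim (D ` supported B)"
    by (rule rank_nullity[OF lin subspace_supported _ supported_basis(1)[OF fin(2)]]) (use fin in simp)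
  ultimately show ?thesis
    using dim_supported[OF fin(1), where 'k = 'k] dim_supported[OF fin(2), where 'k = 'k] by simp
qed

section \<open>The Koszul complex in one total degree\<close>

lemma finite_monomials:
  assumes "finite V"
  shows "finite {m. Poly_Mapping.keys m \<subseteq> V \<and> monomial_degree m \<le> t}"
proof -
  let ?M = "{m. Poly_Mapping.keys m \<subseteq> V \<and> monomial_degree m \<le> t}"
  have "Poly_Mapping.lookup ` ?M \<subseteq> {f. \<forall>x. (x \<in> V \<longrightarrow> f x \<in> {..t}) \<and> (x \<notin> V \<longrightarrow> f x = 0)}"
  proof clarify
    fix m x
    assume m: "Poly_Mapping.keys m \<subseteq> V" "monomial_degree m \<le> t"
    have "Poly_Mapping.lookup m x \<le> monomial_degree m" if "x \<in> V"
      unfolding monomial_degree_superset[OF assms m(1)]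
      using that assms by (intro member_le_sum) auto
    with m show "(x \<in> V \<longrightarrow> Poly_Mapping.lookup m x \<in> {..t}) \<and> (x \<notin> V \<longrightarrow> Poly_Mapping.lookup m x = 0)"
      by (auto simp: in_keys_iff)
  qed
  then have "finite (Poly_Mapping.lookup ` ?M)"
    by (rule finite_subset) (rule finite_set_of_finite_funs; use assms in simp)
  then show ?thesis
    by (rule finite_imageD) (simp add: inj_on_def lookup_inject)
qed

lemma koszul_eval:
  "contr.koszul \<theta> s f T m = (\<Sum>j\<in>{1..s} \<inter> T. \<Sum>m'\<in>Poly_Mapping.keys (\<theta> j).
     Poly_Mapping.lookup (\<theta> j) m' * (ksign j T * f (T - {j}) (m' + m)))"
proof -
  have "contr.koszul \<theta> s f T m = (\<Sum>j\<in>{1..s}. if j \<in> T then \<Sum>m'\<in>Poly_Mapping.keys (\<theta> j).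
     Poly_Mapping.lookup (\<theta> j) m' * (ksign j T * f (T - {j}) (m' + m)) else 0)"
    unfolding contr.koszul_def sum_fun_apply
    by (rule sum.cong) (auto simp: contr.wedge_def contraction_def[of "\<theta> _"] contraction_ksign)
  then show ?thesis
    by (simp add: sum.inter_restrict[symmetric] Int_commute)
qed

text \<open>Contraction by \<theta>_j lowers the degree by e j while j enters T, so the differential
  preserves the degree plus the sum of e over T. Total degree t is thus a finite-dimensional exact
  complex with basis the pairs (T, m), whose alternating count is 0.\<close>

theorem koszul_euler:
  fixes \<theta> :: "nat \<Rightarrow> 'k::field mpoly"
  assumes dc: "down_closed \<Delta>" and V: "\<Delta> \<subseteq> Pow V" "finite V"
    and hom: "\<And>j. j \<in> {1..s} \<Longrightarrow> homogeneous (e j) (\<theta> j)"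
    and ex: "\<And>i. contr.koszul_exact \<theta> s (SR_dual \<Delta>) i"
    and H0: "\<And>\<phi>. \<phi> \<in> SR_dual \<Delta> \<Longrightarrow> (\<And>m. \<phi> m \<noteq> 0 \<Longrightarrow> monomial_degree m = t) \<Longrightarrow>
      (\<And>j. j \<in> {1..s} \<Longrightarrow> contraction (\<theta> j) \<phi> = 0) \<Longrightarrow> \<phi> = 0"
  shows "(\<Sum>T\<in>Pow {1..s}. (-1) ^ card T *
    int (card {m. Poly_Mapping.keys m \<in> \<Delta> \<and> monomial_degree m + sum e T = t})) = 0"
proof -
  let ?\<kappa> = "contr.koszul \<theta> s"
  define M where "M T = {m. Poly_Mapping.keys m \<in> \<Delta> \<and> monomial_degree m + sum e T = t}" for T
  \<comment> \<open>The basis pairs split by the parity of \<open>card T\<close>: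
    \<open>S True\<close> is the even part.\<close>
  define S where "S b = {(T, m). T \<subseteq> {1..s} \<and> m \<in> M T \<and> even (card T) = b}" for b
  define D :: "(nat set \<times> (nat \<Rightarrow>\<^sub>0 nat) \<Rightarrow> 'k) \<Rightarrow> _" where
    "D f x = ?\<kappa> (\<lambda>T m. f (T, m)) (fst x) (snd x)" for f x
  have finM: "finite (M T)" for T
    by (rule finite_subset[OF _ finite_monomials[OF V(2), of t]]) (use V(1) in \<open>auto simp: M_def\<close>)
  have S_Sigma: "S b = Sigma {T \<in> Pow {1..s}. even (card T) = b} M" for b
    by (auto simp: S_def)
  have finS: "finite (S b)" for b
    unfolding S_Sigma by (intro finite_SigmaI finM) auto
  have lin: "Vector_Spaces.linear fscale fscale D"
  proof unfold_locales
    show "D (f + g) = D f + D g" for f g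
      by (rule ext) (simp add: D_def koszul_eval algebra_simps sum.distrib)
    show "D (fscale c f) = fscale c (D f)" for c f
      by (rule ext) (simp add: D_def koszul_eval fscale_def sum_distrib_left mult_ac)
  qed
  have par: "even (card (T - {j})) \<longleftrightarrow> odd (card T)" if "T \<subseteq> {1..s}" "j \<in> T" for T j
  proof -
    have "finite T"
      using that(1) by (rule finite_subset) simp
    then show ?thesis
      using card.remove[OF _ that(2)] by (metis even_Suc)
  qed
  have deg: "monomial_degree (m' + m) + sum e (T - {j}) = monomial_degree m + sum e T"
    if "T \<subseteq> {1..s}" "j \<in> T" "m' \<in> Poly_Mapping.keys (\<theta> j)" for T j m m'
  proof -
    have "finite T"
      using that(1) by (rule finite_subset) simp
    then have "sum e T = e j + sum e (T - {j})"
      using that(2) by (rule sum.remove)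
    moreover have "monomial_degree m' = e j"
      using hom[of j] that by (auto simp: homogeneous_def)
    ultimately show ?thesis
      by simp
  qed
  have D_supp: "D f \<in> supported (S (\<not> b))" if f: "f \<in> supported (S b)" for f b
    unfolding supported_def
  proof (intro CollectI allI impI)
    fix x
    assume nz: "D f x \<noteq> 0"
    obtain T m where x: "x = (T, m)"
      by (cases x)
    from nz obtain j m' where j: "j \<in> {1..s} \<inter> T" "m' \<in> Poly_Mapping.keys (\<theta> j)" "f (T - {j}, m' + m) \<noteq> 0"
      unfolding D_def koszul_eval x by (auto elim!: sum.not_neutral_contains_not_neutral)
    then have "(T - {j}, m' + m) \<in> S b"
      using f by (auto simp: supported_def)
    then have 1: "T - {j} \<subseteq> {1..s}" "m' + m \<in> M (T - {j})" "even (card (T - {j})) = b"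
      by (auto simp: S_def)
    then have T: "T \<subseteq> {1..s}"
      using j(1) by auto
    have "Poly_Mapping.keys m \<in> \<Delta>"
      using 1(2) dc by (auto simp: M_def keys_add_nat intro: down_closedD)
    then have "m \<in> M T"
      using 1(2) deg[OF T _ j(2), of m] j(1) by (simp add: M_def)
    then show "x \<in> S (\<not> b)"
      using par[OF T, of j] T 1(3) j(1) by (auto simp: x S_def)
  qed
  have exact: "\<exists>g\<in>supported (S (\<not> b)). f = D g" if f: "f \<in> supported (S b)" and 0: "D f = 0" for f b
  proof -
    \<comment> \<open>The components by size of T. The differential raises this size by one, so each
      component of a cocycle is a cocycle and exactness applies to it.\<close>
    define F where "F i T m = (if card T = i then f (T, m) else 0)" for i T m
    have fS: "(T, m) \<in> S b" if "f (T, m) \<noteq> 0" for T m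
      using f that by (auto simp: supported_def)
    have Fc: "F i \<in> contr.cochains s i (SR_dual \<Delta>)" for i
      using fS by (fastforce simp: contr.cochains_def F_def SR_dual_def S_def M_def fun_eq_iff)
    have f0: "?\<kappa> (\<lambda>T m. f (T, m)) = (\<lambda>T. 0)"
      using 0 by (auto simp: D_def fun_eq_iff)
    have F0: "?\<kappa> (F i) T = 0" for i T
    proof (cases "T \<subseteq> {1..s} \<and> card T = Suc i")
      case True
      then have fin: "finite T"
        by (auto intro: finite_subset)
      have "?\<kappa> (F i) T m = ?\<kappa> (\<lambda>T m. f (T, m)) T m" for m
        unfolding koszul_eval
        by (intro sum.cong refl) (use True fin in \<open>auto simp: F_def\<close>)
      then show ?thesis
        using f0 by (simp add: fun_eq_iff)
    next
      case False
      then show ?thesis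
        using contr.koszul_cochains[OF subspace_SR_dual[OF dc] Fc, of \<theta>] unfolding contr.cochains_def by blast
    qed
    have "\<exists>g\<in>contr.cochains s i (SR_dual \<Delta>). F (Suc i) = ?\<kappa> g" for i
      using ex[of i] Fc[of "Suc i"] F0 unfolding contr.koszul_exact_def by blast
    then obtain g where g: "\<And>i. g i \<in> contr.cochains s i (SR_dual \<Delta>)" "\<And>i. F (Suc i) = ?\<kappa> (g i)"
      by metis
    \<comment> \<open>The component at T = {} is a functional of degree t killed by every
      \<theta>_j, so \<open>H0\<close> removes it.\<close>
    have f_empty: "f ({}, m) = 0" for m
    proof -
      have "F 0 {} = 0"
      proof (rule H0)
        show "F 0 {} \<in> SR_dual \<Delta>"
          using Fc[of 0] by (auto simp: contr.cochains_def)
        show "monomial_degree m = t" if "F 0 {} m \<noteq> 0" for m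
          using that fS[of "{}" m] by (auto simp: F_def S_def M_def)
        show "contraction (\<theta> j) (F 0 {}) = 0" if j: "j \<in> {1..s}" for j
        proof -
          have "?\<kappa> (F 0) {j} m = ksign j {j} * contraction (\<theta> j) (F 0 {}) m" for m
            unfolding koszul_eval contraction_def using j by (simp add: sum_distrib_left mult.left_commute)
          then have "ksign j {j} * contraction (\<theta> j) (F 0 {}) m = 0" for m
            using F0[of 0 "{j}"] by (metis zero_fun_apply)
          moreover have "ksign j {j} = (1 :: 'k)"
            by (subst ksign_singleton) simp
          ultimately show ?thesis
            by (simp add: fun_eq_iff)
        qed
      qed
      then show ?thesis
        by (auto simp: F_def fun_eq_iff)
    qed
    \<comment> \<open>The primitives of all sizes are assembled and cut down to total degree t and
      the opposite parity. The cut does not affect the differential at the pairs in question, as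
      total degree is preserved.\<close>
    define G where "G x = (if x \<in> S (\<not> b) then g (card (fst x)) (fst x) (snd x) else 0)" for x
    have G_eq: "G (T, m) = (if monomial_degree m + sum e T = t \<and> even (card T) = (\<not> b) then g (card T) T m else 0)" for T m
    proof -
      have "m \<in> M T" if "g (card T) T m \<noteq> 0" "monomial_degree m + sum e T = t"
        using that g(1)[of "card T"] by (auto simp: contr.cochains_def SR_dual_def M_def)
      moreover have "T \<subseteq> {1..s}" if "g (card T) T m \<noteq> 0"
      proof -
        have "g (card T) T \<noteq> 0"
          using that by auto
        then show ?thesis
          using g(1)[of "card T"] unfolding contr.cochains_def by blast
      qed
      ultimately show ?thesis
        unfolding G_def S_def by (auto simp: M_def)
    qed
    have "G \<in> supported (S (\<not> b))"
      by (auto simp: supported_def G_def)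
    moreover have "f (T, m) = D G (T, m)" for T m
    proof (cases "T \<subseteq> {1..s}")
      case False
      have "f (T, m) = 0"
        using fS[of T m] False by (auto simp: S_def)
      moreover have "(T, m) \<notin> S b"
        using False by (auto simp: S_def)
      then have "D G (T, m) = 0"
        using D_supp[OF \<open>G \<in> supported (S (\<not> b))\<close>] unfolding supported_def by auto
      ultimately show ?thesis
        by simp
    next
      case T: True
      then have fin: "finite T"
        by (rule finite_subset) simp
      show ?thesis
      proof (cases "monomial_degree m + sum e T = t \<and> even (card T) = b")
        case True
        show ?thesis
        proof (cases "card T")
          case 0
          then have "T = {}"
            using fin by simp
          then show ?thesis
            by (simp add: f_empty D_def koszul_eval)
        next
          case (Suc i)
          have "D G (T, m) = ?\<kappa> (g i) T m"
            unfolding D_def koszul_eval fst_conv snd_conv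
          proof (intro sum.cong refl)
            fix j m'
            assume j: "j \<in> {1..s} \<inter> T" and m': "m' \<in> Poly_Mapping.keys (\<theta> j)"
            have "card (T - {j}) = i"
              using Suc j by simp
            then have "G (T - {j}, m' + m) = g i (T - {j}) (m' + m)"
              using deg[OF T _ m', of m] par[OF T, of j] True j by (simp add: G_eq)
            then show "Poly_Mapping.lookup (\<theta> j) m' * (ksign j T * G (T - {j}, m' + m)) =
                Poly_Mapping.lookup (\<theta> j) m' * (ksign j T * g i (T - {j}) (m' + m))"
              by simp
          qed
          also have "\<dots> = F (Suc i) T m"
            by (simp add: g(2))
          finally show ?thesis
            by (simp add: F_def Suc)
        qed
      next
        case False
        then have "f (T, m) = 0"
          using fS[of T m] by (auto simp: S_def M_def)
        moreover have "D G (T, m) = 0"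
        proof (rule ccontr)
          assume "D G (T, m) \<noteq> 0"
          then have "(T, m) \<in> S b"
            using D_supp[OF \<open>G \<in> supported (S (\<not> b))\<close>] by (auto simp: supported_def)
          with False show False
            by (auto simp: S_def M_def)
        qed
        ultimately show ?thesis
          by simp
      qed
    qed
    ultimately show ?thesis
      by (intro bexI[of _ G]) auto
  qed
  have "D (D f) = 0" for f
  proof
    fix x
    have "(\<lambda>T m. D f (T, m)) = ?\<kappa> (\<lambda>T m. f (T, m))"
      by (simp add: D_def)
    then show "D (D f) x = 0 x"
      unfolding D_def[of "D f"] by (simp add: contr.koszul_koszul)
  qed
  then have eq: "card (S True) = card (S False)"
    using lin finS D_supp[of _ True] D_supp[of _ False] exact[of _ True] exact[of _ False]
    by (intro exact_card_eq[of D]) auto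
  have card_S: "int (card (S b)) = (\<Sum>T\<in>{T \<in> Pow {1..s}. even (card T) = b}. int (card (M T)))" for b
    unfolding S_Sigma by (subst card_SigmaI) (auto simp: finM)
  have "(\<Sum>T\<in>Pow {1..s}. (-1) ^ card T * int (card (M T))) =
     (\<Sum>T\<in>{T \<in> Pow {1..s}. even (card T) = True}. (-1) ^ card T * int (card (M T))) +
     (\<Sum>T\<in>{T \<in> Pow {1..s}. even (card T) = False}. (-1) ^ card T * int (card (M T)))"
    by (subst sum.union_disjoint[symmetric]) (auto intro!: sum.cong)
  also have "\<dots> = int (card (S True)) - int (card (S False))"
    unfolding card_S by (simp add: sum_negf[symmetric])
  finally show ?thesis
    using eq by (simp add: M_def)
qed

section \<open>The Hilbert series of the Stanley-Reisner ring\<close>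

definition face_monomials :: "nat set set \<Rightarrow> nat \<Rightarrow> (nat \<Rightarrow>\<^sub>0 nat) set" where
  "face_monomials \<Delta> k = {m. Poly_Mapping.keys m \<in> \<Delta> \<and> monomial_degree m = k}"

lemma finite_face_monomials:
  assumes "finite V" "\<Delta> \<subseteq> Pow V"
  shows "finite (face_monomials \<Delta> k)"
  by (rule finite_subset[OF _ finite_monomials[OF assms(1), of k]]) (use assms(2) in \<open>auto simp: face_monomials_def\<close>)

lemma subfield_Const: "subfield (range Const) (mpoly_ring n :: 'k::field mpoly ring)"
proof -
  let ?R = "mpoly_ring n :: 'k mpoly ring"
  interpret cring ?R by (rule cring_mpoly_ring)
  have C: "Const c \<in> carrier ?R" for c :: 'k
    by (simp add: Const_def single_mem_mpoly_ring)
  have minus: "\<ominus>\<^bsub>?R\<^esub> Const c = Const (- c)" for c :: 'k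
    by (rule minus_equality) (auto simp: C, simp add: Const_def flip: single_add)
  have sub: "subring (range Const) ?R"
  proof (rule subringI)
    show "range Const \<subseteq> carrier ?R"
      using C by auto
    show "\<one>\<^bsub>?R\<^esub> \<in> range Const"
      by (auto simp: Const_def intro!: image_eqI[of _ _ 1])
    show "\<ominus>\<^bsub>?R\<^esub> h \<in> range Const" if "h \<in> range Const" for h
      using that minus by auto
    show "h1 \<otimes>\<^bsub>?R\<^esub> h2 \<in> range Const" if "h1 \<in> range Const" "h2 \<in> range Const" for h1 h2
      using that by (auto simp: Const_def mult_single)
    show "h1 \<oplus>\<^bsub>?R\<^esub> h2 \<in> range Const" if "h1 \<in> range Const" "h2 \<in> range Const" for h1 h2
      using that by (auto simp: Const_def simp flip: single_add)
  qed
  show ?thesis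
  proof (rule subfieldI)
    show "subcring (range Const) ?R"
      using sub by (rule subcringI) (simp add: mult.commute)
    have units: "Const c \<in> Units (?R\<lparr>carrier := range Const\<rparr>)" if "c \<noteq> 0" for c :: 'k
      unfolding Units_def
    proof (intro CollectI conjI bexI[of _ "Const (inverse c)"])
      show "Const (inverse c) \<otimes>\<^bsub>?R\<lparr>carrier := range Const\<rparr>\<^esub> Const c = \<one>\<^bsub>?R\<lparr>carrier := range Const\<rparr>\<^esub>"
        "Const c \<otimes>\<^bsub>?R\<lparr>carrier := range Const\<rparr>\<^esub> Const (inverse c) = \<one>\<^bsub>?R\<lparr>carrier := range Const\<rparr>\<^esub>"
        using that by (simp_all add: Const_def mult_single)
    qed simp_all
    show "Units (?R\<lparr>carrier := range Const\<rparr>) = range Const - {\<zero>\<^bsub>?R\<^esub>}"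
    proof (intro equalityI subsetI)
      fix x
      assume "x \<in> range Const - {\<zero>\<^bsub>?R\<^esub>}"
      then obtain c where c: "x = Const c" "x \<noteq> 0"
        by auto
      then have "c \<noteq> 0"
        by (auto simp: Const_def)
      with units c(1) show "x \<in> Units (?R\<lparr>carrier := range Const\<rparr>)"
        by simp
    qed (auto simp: Units_def)
  qed
qed

lemma dimension_monomial_span:
  assumes "finite A" "\<And>m. m \<in> A \<Longrightarrow> Poly_Mapping.keys m \<subseteq> {1..n}"
  shows "ring.dimension (mpoly_ring n :: 'k::field mpoly ring) (card A) (range Const) {p. Poly_Mapping.keys p \<subseteq> A}"
  using assms
proof (induction A rule: finite_induct)
  case empty
  interpret cring "mpoly_ring n :: 'k mpoly ring" by (rule cring_mpoly_ring)
  have "{p :: 'k mpoly. Poly_Mapping.keys p \<subseteq> {}} = {\<zero>\<^bsub>mpoly_ring n\<^esub>}"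
    by auto
  then show ?case
    by (metis card.empty zero_dim)
next
  case (insert u A)
  let ?R = "mpoly_ring n :: 'k mpoly ring"
  let ?E = "\<lambda>A. {p :: 'k mpoly. Poly_Mapping.keys p \<subseteq> A}"
  interpret cring ?R by (rule cring_mpoly_ring)
  have "line_extension (range Const) (Poly_Mapping.single u 1) (?E A) = ?E (insert u A)"
  proof (intro equalityI subsetI)
    fix p
    assume "p \<in> line_extension (range Const) (Poly_Mapping.single u 1) (?E A)"
    then obtain c q where "p = Poly_Mapping.single u c + q" "Poly_Mapping.keys q \<subseteq> A"
      by (auto simp: line_extension_mem_iff Const_def mult_single)
    then show "p \<in> ?E (insert u A)"
      using Poly_Mapping.keys_add[of "Poly_Mapping.single u c" q] by (auto split: if_splits)
  next
    fix p
    assume p: "p \<in> ?E (insert u A)"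
    let ?c = "Poly_Mapping.lookup p u"
    have "p = Const ?c \<otimes>\<^bsub>?R\<^esub> Poly_Mapping.single u 1 \<oplus>\<^bsub>?R\<^esub> (p - Poly_Mapping.single u ?c)"
      by (simp add: Const_def mult_single)
    moreover have "p - Poly_Mapping.single u ?c \<in> ?E A"
      using p insert.hyps(2) by (auto simp: in_keys_iff lookup_minus lookup_single when_def split: if_splits)
    ultimately show "p \<in> line_extension (range Const) (Poly_Mapping.single u 1) (?E A)"
      unfolding line_extension_mem_iff by blast
  qed
  moreover have "dimension (Suc (card A)) (range Const) (line_extension (range Const) (Poly_Mapping.single u 1) (?E A))"
  proof (rule Suc_dim)
    show "Poly_Mapping.single u 1 \<in> carrier ?R"
      using insert.prems by (intro single_mem_mpoly_ring) auto
    show "Poly_Mapping.single u 1 \<notin> ?E A"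
      using insert.hyps(2) by simp
    show "dimension (card A) (range Const) (?E A)"
      using insert by simp
  qed
  ultimately show ?case
    using insert.hyps by simp
qed

text \<open>The face monomials of degree k are a basis: the quotient map is injective on their span
  and still reaches the whole graded piece, as nonface monomials become 0.\<close>

lemma hilbert_function_SR:
  assumes dc: "down_closed \<Delta>" and V: "\<Delta> \<subseteq> Pow {1..n}" and e: "{} \<in> \<Delta>"
  shows "hilbert_function n (stanley_reisner_ideal n \<Delta> :: 'k::field mpoly set) k = card (face_monomials \<Delta> k)"
proof -
  let ?R = "mpoly_ring n :: 'k mpoly ring"
  let ?I = "stanley_reisner_ideal n \<Delta> :: 'k mpoly set"
  let ?E = "{p :: 'k mpoly. Poly_Mapping.keys p \<subseteq> face_monomials \<Delta> k}"
  interpret R: cring ?R by (rule cring_mpoly_ring)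
  interpret I: ideal ?I ?R by (rule ideal_stanley_reisner)
  interpret S: ring "?R Quot ?I" by (rule I.quotient_is_ring)
  let ?h = "(+>\<^bsub>?R\<^esub>) ?I"
  interpret h: ring_hom_ring ?R "?R Quot ?I" ?h by (rule I.rcos_ring_hom_ring)
  have E_carrier: "?E \<subseteq> carrier ?R"
    using V unfolding mem_mpoly_ring face_monomials_def subset_iff by blast
  have coset: "?h p = (\<lambda>i. i + p) ` ?I" for p
    by (auto simp: a_r_coset_def')
  have coset_eq: "?h p = ?h q \<longleftrightarrow> p - q \<in> ?I" for p q
  proof
    assume "?h p = ?h q"
    moreover have "p \<in> ?h p"
      using mpoly_ideal_closed(1)[OF ideal_stanley_reisner] by (force simp: coset)
    ultimately show "p - q \<in> ?I"
      by (auto simp: coset)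
  next
    assume pq: "p - q \<in> ?I"
    then have qp: "q - p \<in> ?I"
      using mpoly_ideal_diff[OF ideal_stanley_reisner mpoly_ideal_closed(1)[OF ideal_stanley_reisner]] by force
    have "i + p \<in> ?h q" "i + q \<in> ?h p" if "i \<in> ?I" for i
    proof -
      have "i + (p - q) \<in> ?I" "i + (q - p) \<in> ?I"
        using mpoly_ideal_closed(2)[OF ideal_stanley_reisner that] pq qp by blast+
      then show "i + p \<in> ?h q" "i + q \<in> ?h p"
        unfolding coset by (force intro: image_eqI)+
    qed
    then show "?h p = ?h q"
      unfolding coset by blast
  qed
  \<comment> \<open>The empty face keeps 1 out of the ideal; the quotient is then nonzero and its
    scalars form a field.\<close>
  have "1 \<notin> ?I"
    using SR_ideal_nonface[OF _ _ dc, of 1 n 0] e by auto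
  then have one: "\<one>\<^bsub>?R Quot ?I\<^esub> \<noteq> \<zero>\<^bsub>?R Quot ?I\<^esub>"
    using coset_eq[of 1 0] h.hom_one h.hom_zero by simp
  have inj: "inj_on ?h ?E"
  proof (rule inj_onI)
    fix p q
    assume pq: "p \<in> ?E" "q \<in> ?E" "?h p = ?h q"
    then have "p - q \<in> ?I"
      using coset_eq by blast
    then have "Poly_Mapping.keys m \<notin> \<Delta>" if "m \<in> Poly_Mapping.keys (p - q)" for m
      using SR_ideal_nonface that dc by blast
    moreover have "Poly_Mapping.keys m \<in> \<Delta>" if "m \<in> Poly_Mapping.keys (p - q)" for m
      using that pq(1,2) keys_diff[of p q] by (auto simp: face_monomials_def)
    ultimately have "Poly_Mapping.keys (p - q) = {}"
      by blast
    then show "p = q"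
      by simp
  qed
  have graded: "?h ` ?E = quot_graded n ?I k"
    unfolding quot_graded_def
  proof (intro equalityI subsetI)
    fix x
    assume "x \<in> ?h ` ?E"
    then obtain p where p: "p \<in> ?E" "x = ?h p"
      by blast
    then have "homogeneous k p"
      by (auto simp: homogeneous_def face_monomials_def)
    with p E_carrier show "x \<in> ?h ` {p \<in> carrier ?R. homogeneous k p}"
      by blast
  next
    fix x
    assume "x \<in> ?h ` {p \<in> carrier ?R. homogeneous k p}"
    then obtain p where p: "p \<in> carrier ?R" "homogeneous k p" "x = ?h p"
      by blast
    let ?q = "\<Sum>m\<in>Poly_Mapping.keys p \<inter> face_monomials \<Delta> k. Poly_Mapping.single m (Poly_Mapping.lookup p m)"
    let ?r = "\<Sum>m\<in>Poly_Mapping.keys p - face_monomials \<Delta> k. Poly_Mapping.single m (Poly_Mapping.lookup p m)"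
    have pq: "p = ?q + ?r"
      by (subst mpoly_sum_monomials[of p], subst sum.Int_Diff[of _ _ "face_monomials \<Delta> k"]) simp_all
    have q: "?q \<in> ?E"
      by (auto simp: in_keys_iff lookup_sum lookup_single when_def split: if_splits)
    have "?r \<in> ?I"
    proof (rule mpoly_ideal_sum[OF ideal_stanley_reisner])
      fix m
      assume "m \<in> Poly_Mapping.keys p - face_monomials \<Delta> k"
      then show "Poly_Mapping.single m (Poly_Mapping.lookup p m) \<in> ?I"
        using p(1,2) by (intro nonface_mem_SR_ideal) (auto simp: mem_mpoly_ring homogeneous_def face_monomials_def)
    qed
    moreover have "p - ?q = ?r"
      using pq by (metis add_diff_cancel_left')
    ultimately have "?h p = ?h ?q"
      using coset_eq[of p ?q] by simp
    with p(3) q show "x \<in> ?h ` ?E"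
      by blast
  qed
  have "R.dimension (card (face_monomials \<Delta> k)) (range Const) ?E"
    using V by (intro dimension_monomial_span finite_face_monomials) (auto simp: face_monomials_def)
  then have "S.dimension (card (face_monomials \<Delta> k)) (?h ` range Const) (?h ` ?E)"
    by (rule h.inj_hom_dimension[OF subfield_Const one inj])
  moreover have "quot_scalars n ?I = ?h ` range Const"
    by (auto simp: quot_scalars_def)
  ultimately show ?thesis
    using S.dimI[OF h.img_is_subfield(2)[OF subfield_Const one]]
    unfolding hilbert_function_def graded over_def by simp
qed

section \<open>Counting face monomials and the h-polynomial\<close>

lemma face_monomials_insert_card:
  assumes "finite \<sigma>" "v \<notin> \<sigma>"
  shows "card (face_monomials {insert v \<sigma>} (Suc k)) =
    card (face_monomials {insert v \<sigma>} k) + card (face_monomials {\<sigma>} k)"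
proof -
  \<comment> \<open>Division by x_v either keeps v in the support or removes it, which gives the two
    summands.\<close>
  let ?f = "\<lambda>m. Poly_Mapping.single v (Suc 0) + m"
  have fin: "finite (face_monomials {\<rho>} k)" if "finite \<rho>" for \<rho> k
    by (rule finite_face_monomials[OF that]) auto
  have "face_monomials {insert v \<sigma>} (Suc k) = ?f ` (face_monomials {insert v \<sigma>} k \<union> face_monomials {\<sigma>} k)"
  proof (intro equalityI subsetI)
    fix m
    assume m: "m \<in> face_monomials {insert v \<sigma>} (Suc k)"
    let ?m = "m - Poly_Mapping.single v (Suc 0)"
    have "v \<in> Poly_Mapping.keys m"
      using m by (simp add: face_monomials_def)
    then have eq: "?f ?m = m"
      by (rule exponent_remove)
    then have "insert v (Poly_Mapping.keys ?m) = insert v \<sigma>" "monomial_degree ?m = k"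
      using m keys_single_add[of v ?m] monomial_degree_add[of "Poly_Mapping.single v (Suc 0)" ?m]
      by (simp_all add: face_monomials_def)
    then have "?m \<in> face_monomials {insert v \<sigma>} k \<union> face_monomials {\<sigma>} k"
    proof (cases "v \<in> Poly_Mapping.keys ?m")
      case True
      then have "Poly_Mapping.keys ?m = insert v \<sigma>"
        using \<open>insert v (Poly_Mapping.keys ?m) = insert v \<sigma>\<close> by (metis insert_absorb)
      then show ?thesis
        using \<open>monomial_degree ?m = k\<close> unfolding face_monomials_def by blast
    next
      case False
      then have "Poly_Mapping.keys ?m = \<sigma>"
        using \<open>insert v (Poly_Mapping.keys ?m) = insert v \<sigma>\<close> assms(2) by (metis insert_ident)
      then show ?thesis
        using \<open>monomial_degree ?m = k\<close> unfolding face_monomials_def by blast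
    qed
    then show "m \<in> ?f ` (face_monomials {insert v \<sigma>} k \<union> face_monomials {\<sigma>} k)"
      by (rule image_eqI[where x = ?m, rotated]) (rule eq[symmetric])
  next
    fix m
    assume "m \<in> ?f ` (face_monomials {insert v \<sigma>} k \<union> face_monomials {\<sigma>} k)"
    then obtain m' where "m = ?f m'" "monomial_degree m' = k"
      "insert v (Poly_Mapping.keys m') = insert v \<sigma>"
      by (auto simp: face_monomials_def)
    then show "m \<in> face_monomials {insert v \<sigma>} (Suc k)"
      by (simp add: face_monomials_def)
  qed
  then have "card (face_monomials {insert v \<sigma>} (Suc k)) = card (face_monomials {insert v \<sigma>} k \<union> face_monomials {\<sigma>} k)"
    by (simp add: card_image)
  also have "\<dots> = card (face_monomials {insert v \<sigma>} k) + card (face_monomials {\<sigma>} k)"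
    using assms by (intro card_Un_disjoint fin) (auto simp: face_monomials_def)
  finally show ?thesis .
qed

definition face_series :: "nat set set \<Rightarrow> int fps" where
  "face_series \<Delta> = Abs_fps (\<lambda>k. int (card (face_monomials \<Delta> k)))"

text \<open>Every vertex of the support contributes a positive exponent, that is, a factor x / (1 -
  x).\<close>

lemma face_series_single:
  assumes "finite \<sigma>"
  shows "face_series {\<sigma>} * (1 - fps_X) ^ card \<sigma> = fps_X ^ card \<sigma>"
  using assms
proof induction
  case empty
  have "face_monomials {{}} k = (if k = 0 then {0} else {})" for k
    by (auto simp: face_monomials_def)
  then show ?case
    by (intro fps_ext) (simp add: face_series_def)
next
  case (insert v \<sigma>)
  have "face_series {insert v \<sigma>} * (1 - fps_X) = fps_X * face_series {\<sigma>}"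
  proof (rule fps_ext)
    fix k
    show "fps_nth (face_series {insert v \<sigma>} * (1 - fps_X)) k = fps_nth (fps_X * face_series {\<sigma>}) k"
    proof (cases k)
      case 0
      have "monomial_degree m \<noteq> 0" if "Poly_Mapping.keys m = insert v \<sigma>" for m
      proof -
        have "v \<in> Poly_Mapping.keys m"
          using that by simp
        then have "Suc 0 + monomial_degree (m - Poly_Mapping.single v (Suc 0)) = monomial_degree m"
          using monomial_degree_add[of "Poly_Mapping.single v (Suc 0)" "m - Poly_Mapping.single v (Suc 0)"]
          by (simp only: exponent_remove monomial_degree_single)
        then show ?thesis
          by simp
      qed
      then have "face_monomials {insert v \<sigma>} 0 = {}"
        by (auto simp: face_monomials_def)
      then show ?thesis
        using 0 by (simp add: face_series_def algebra_simps)
    next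
      case (Suc k)
      then show ?thesis
        using face_monomials_insert_card[OF insert.hyps, of k] by (simp add: face_series_def algebra_simps)
    qed
  qed
  then have "face_series {insert v \<sigma>} * (1 - fps_X) ^ card (insert v \<sigma>) =
      fps_X * (face_series {\<sigma>} * (1 - fps_X) ^ card \<sigma>)"
    using insert.hyps by (simp add: mult.assoc[symmetric])
  then show ?case
    using insert by simp
qed

lemma face_series_sum:
  assumes "finite V" "\<Delta> \<subseteq> Pow V"
  shows "face_series \<Delta> = (\<Sum>\<sigma>\<in>\<Delta>. face_series {\<sigma>})"
proof (rule fps_ext)
  fix k
  have "finite \<Delta>"
    using assms by (auto intro: finite_subset)
  have "face_monomials \<Delta> k = (\<Union>\<sigma>\<in>\<Delta>. face_monomials {\<sigma>} k)"
    by (auto simp: face_monomials_def)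
  then have "card (face_monomials \<Delta> k) = (\<Sum>\<sigma>\<in>\<Delta>. card (face_monomials {\<sigma>} k))"
    using \<open>finite \<Delta>\<close> assms
    by (simp only:) (intro card_UN_disjoint ballI finite_face_monomials[of V]; auto simp: face_monomials_def)
  then show "fps_nth (face_series \<Delta>) k = fps_nth (\<Sum>\<sigma>\<in>\<Delta>. face_series {\<sigma>}) k"
    by (simp add: face_series_def fps_sum_nth)
qed

lemma face_series_polynomial:
  assumes V: "finite V" "\<Delta> \<subseteq> Pow V" and r: "\<And>\<sigma>. \<sigma> \<in> \<Delta> \<Longrightarrow> card \<sigma> \<le> r"
  shows "\<exists>h. face_series \<Delta> * (1 - fps_X) ^ r = fps_of_poly h"
proof -
  \<comment> \<open>The contribution of one face in the usual passage from face numbers to the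
    h-polynomial.\<close>
  let ?g = "\<lambda>\<sigma>. Polynomial.monom 1 (card \<sigma>) * (1 - Polynomial.monom 1 1) ^ (r - card \<sigma>) :: int poly"
  have "face_series \<Delta> * (1 - fps_X) ^ r = (\<Sum>\<sigma>\<in>\<Delta>. face_series {\<sigma>} * (1 - fps_X) ^ r)"
    by (simp add: face_series_sum[OF V] sum_distrib_right)
  also have "\<dots> = (\<Sum>\<sigma>\<in>\<Delta>. fps_of_poly (?g \<sigma>))"
  proof (rule sum.cong[OF refl])
    fix \<sigma>
    assume \<sigma>: "\<sigma> \<in> \<Delta>"
    then have "finite \<sigma>"
      using V by (auto intro: finite_subset)
    have "(1 - fps_X :: int fps) ^ r = (1 - fps_X) ^ card \<sigma> * (1 - fps_X) ^ (r - card \<sigma>)"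
      using r[OF \<sigma>] by (simp flip: power_add)
    then have "face_series {\<sigma>} * (1 - fps_X) ^ r = fps_X ^ card \<sigma> * (1 - fps_X) ^ (r - card \<sigma>)"
      using face_series_single[OF \<open>finite \<sigma>\<close>] by (metis mult.assoc)
    also have "\<dots> = fps_of_poly (?g \<sigma>)"
      by (simp add: fps_of_poly_mult fps_of_poly_power fps_of_poly_diff fps_of_poly_monom')
    finally show "face_series {\<sigma>} * (1 - fps_X) ^ r = fps_of_poly (?g \<sigma>)" .
  qed
  also have "\<dots> = fps_of_poly (\<Sum>\<sigma>\<in>\<Delta>. ?g \<sigma>)"
    by (simp add: fps_of_poly_sum)
  finally show ?thesis
    by blast
qed

text \<open>Existence of such a polynomial and injectivity of \<open>fps_of_poly\<close> justify the
  definite description.\<close>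

lemma h_polynomial_eq:
  assumes \<Delta>: "simplicial_complex_on {1..n} \<Delta>" and dim: "complex_dim \<Delta> = int d"
    and le: "\<And>\<sigma>. \<sigma> \<in> \<Delta> \<Longrightarrow> card \<sigma> \<le> Suc d"
  shows "face_series \<Delta> * (1 - fps_X) ^ Suc d = fps_of_poly (h_polynomial TYPE('k::field) n \<Delta>)"
proof -
  have V: "\<Delta> \<subseteq> Pow {1..n}" "{} \<in> \<Delta>" "down_closed \<Delta>"
    using \<Delta> by (auto simp: simplicial_complex_on_def down_closed_def)
  have "hilbert_series n (stanley_reisner_ideal n \<Delta> :: 'k mpoly set) = face_series \<Delta>"
    using hilbert_function_SR[OF V(3,1,2), where 'k = 'k] by (simp add: hilbert_series_def face_series_def)
  moreover have "nat (complex_dim \<Delta> + 1) = Suc d"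
    using dim by simp
  moreover obtain h where h: "face_series \<Delta> * (1 - fps_X) ^ Suc d = fps_of_poly h"
    using face_series_polynomial[OF _ V(1) le] by auto
  moreover have "(THE h'. fps_of_poly h = fps_of_poly h') = h"
    by (rule the_equality) (auto simp: fps_of_poly_eq_iff)
  ultimately show ?thesis
    unfolding h_polynomial_def by simp
qed

text \<open>The graded Euler characteristic of the Koszul complex is the coefficient of \<open>h\<close> times
  \<open>(1 - X ^ e j) / (1 - X)\<close> over all \<open>j\<close>, which is the leading one in the degree in question.\<close>
lemma euler_coefficient_nonzero:
  assumes h: "face_series \<Delta> * (1 - fps_X) ^ s = fps_of_poly h"
    and e: "\<And>j. j \<in> {1..s} \<Longrightarrow> 0 < e j" and "{} \<in> \<Delta>"
    and t: "t + s = (\<Sum>j\<in>{1..s}. e j) + Polynomial.degree h"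
  shows "(\<Sum>T\<in>Pow {1..s}. (-1) ^ card T *
    int (card {m. Poly_Mapping.keys m \<in> \<Delta> \<and> monomial_degree m + sum e T = t})) \<noteq> 0"
proof -
  let ?x = "Polynomial.monom 1 1 :: int poly"
  define g :: "nat \<Rightarrow> int poly" where "g j = (\<Sum>i<e j. ?x ^ i)" for j
  have g: "1 - Polynomial.monom 1 (e j) = (1 - ?x) * g j" for j
    using one_diff_power_eq[of ?x "e j"] by (simp add: g_def monom_power)
  have deg1: "Polynomial.degree (1 - Polynomial.monom 1 k :: int poly) = k" if "0 < k" for k
  proof (rule antisym)
    show "Polynomial.degree (1 - Polynomial.monom 1 k :: int poly) \<le> k"
      by (rule degree_diff_le) (simp_all add: degree_monom_le)
    show "k \<le> Polynomial.degree (1 - Polynomial.monom 1 k :: int poly)"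
      by (rule le_degree) (use that in simp)
  qed
  have gj: "g j \<noteq> 0 \<and> Polynomial.degree (g j) + 1 = e j" if "j \<in> {1..s}" for j
  proof -
    have "(1 - ?x) * g j \<noteq> 0"
      using deg1[OF e[OF that]] e[OF that] unfolding g[symmetric] by auto
    then have "g j \<noteq> 0" "1 - ?x \<noteq> 0"
      by auto
    then show ?thesis
      using deg1[OF e[OF that]] deg1[of 1] unfolding g by (simp add: degree_mult_eq)
  qed
  \<comment> \<open>The constant term 1 shows that the series, and with it h, is nonzero.\<close>
  have "face_monomials \<Delta> 0 = {0}"
    using \<open>{} \<in> \<Delta>\<close> by (auto simp: face_monomials_def monomial_degree_def poly_mapping_eq_iff fun_eq_iff in_keys_iff)
  then have "fps_nth (face_series \<Delta>) 0 = 1"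
    by (simp add: face_series_def)
  then have "face_series \<Delta> \<noteq> 0"
    by auto
  moreover have "(1 - fps_X :: int fps) \<noteq> 0"
    by (metis diff_zero fps_X_nth fps_one_nth fps_sub_nth fps_zero_nth zero_neq_one)
  ultimately have "fps_of_poly h \<noteq> 0"
    unfolding h[symmetric] by simp
  then have h0: "h \<noteq> 0"
    by auto
  let ?q = "h * (\<Prod>j\<in>{1..s}. g j)"
  have "(\<Sum>j\<in>{1..s}. Polynomial.degree (g j)) + s = (\<Sum>j\<in>{1..s}. Polynomial.degree (g j) + 1)"
    by (subst sum.distrib) simp
  also have "\<dots> = (\<Sum>j\<in>{1..s}. e j)"
    by (rule sum.cong) (use gj in auto)
  finally have "(\<Sum>j\<in>{1..s}. Polynomial.degree (g j)) + s = (\<Sum>j\<in>{1..s}. e j)" .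
  moreover have prod0: "(\<Prod>j\<in>{1..s}. g j) \<noteq> 0"
    using gj by simp
  then have "Polynomial.degree ?q = Polynomial.degree h + (\<Sum>j\<in>{1..s}. Polynomial.degree (g j))"
    using h0 gj degree_prod_sum_eq[of "{1..s}" g] by (simp add: degree_mult_eq)
  \<comment> \<open>Each factor \<open>g j\<close> has degree e j - 1, so t is the degree of the
    product and its coefficient there is the leading one.\<close>
  ultimately have "Polynomial.degree ?q = t"
    using t by simp
  moreover have "?q \<noteq> 0"
    using h0 prod0 by simp
  ultimately have "Polynomial.coeff ?q t \<noteq> 0"
    by auto
  have fps_g: "1 - fps_X ^ e j = (1 - fps_X) * fps_of_poly (g j)" for j
    using arg_cong[OF g[of j], of fps_of_poly] by (simp add: fps_of_poly_mult fps_of_poly_diff fps_of_poly_monom')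
  have "face_series \<Delta> * (\<Prod>j\<in>{1..s}. 1 - fps_X ^ e j) =
      face_series \<Delta> * ((1 - fps_X) ^ s * (\<Prod>j\<in>{1..s}. fps_of_poly (g j)))"
    by (simp add: fps_g prod.distrib)
  also have "\<dots> = fps_of_poly ?q"
    unfolding fps_of_poly_mult fps_of_poly_prod h[symmetric] by (simp only: mult.assoc)
  finally have P: "face_series \<Delta> * (\<Prod>j\<in>{1..s}. 1 - fps_X ^ e j) = fps_of_poly ?q" .
  have "(\<Prod>j\<in>{1..s}. 1 - fps_X ^ e j :: int fps) = (\<Prod>j\<in>{1..s}. - (fps_X ^ e j) + 1)"
    by (simp only: uminus_add_conv_diff)
  also have "\<dots> = (\<Sum>T\<in>Pow {1..s}. \<Prod>j\<in>T. - (fps_X ^ e j))"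
    by (subst prod_add) simp_all
  also have "\<dots> = (\<Sum>T\<in>Pow {1..s}. (-1) ^ card T * fps_X ^ sum e T)"
    by (simp add: prod_uminus power_sum)
  finally have "fps_of_poly ?q = (\<Sum>T\<in>Pow {1..s}. face_series \<Delta> * ((-1) ^ card T * fps_X ^ sum e T))"
    unfolding P[symmetric] by (simp add: sum_distrib_left)
  then have "Polynomial.coeff ?q t = (\<Sum>T\<in>Pow {1..s}. fps_nth (face_series \<Delta> * ((-1) ^ card T * fps_X ^ sum e T)) t)"
    by (simp only: fps_sum_nth flip: fps_of_poly_nth)
  also have "\<dots> = (\<Sum>T\<in>Pow {1..s}. (-1) ^ card T *
    int (card {m. Poly_Mapping.keys m \<in> \<Delta> \<and> monomial_degree m + sum e T = t}))"
  proof (rule sum.cong[OF refl])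
    fix T
    \<comment> \<open>The case distinction guards the truncated subtraction.\<close>
    have "{m. Poly_Mapping.keys m \<in> \<Delta> \<and> monomial_degree m + sum e T = t} =
      (if t < sum e T then {} else face_monomials \<Delta> (t - sum e T))"
      by (auto simp: face_monomials_def)
    moreover have "face_series \<Delta> * ((-1) ^ card T * fps_X ^ sum e T) =
        (if even (card T) then face_series \<Delta> * fps_X ^ sum e T else - (face_series \<Delta> * fps_X ^ sum e T))"
      by simp
    ultimately show "fps_nth (face_series \<Delta> * ((-1) ^ card T * fps_X ^ sum e T)) t = (-1) ^ card T *
      int (card {m. Poly_Mapping.keys m \<in> \<Delta> \<and> monomial_degree m + sum e T = t})"
      by (simp add: fps_X_power_mult_right_nth face_series_def)
  qed
  finally show ?thesis
    using \<open>Polynomial.coeff ?q t \<noteq> 0\<close> by simp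
qed

section \<open>Systems of parameters\<close>

text \<open>The zero polynomial is homogeneous of every degree, so \<open>total_degree\<close> would
  not be a correct weight for it. If \<theta>_j were 0, the constant-term functional placed at T =
  {j} would be a cocycle, as no \<theta>_k has a constant term, but not a coboundary, as those
  vanish at {j}.\<close>

lemma koszul_exact_nonzero:
  fixes \<theta> :: "nat \<Rightarrow> 'k::field mpoly"
  assumes ex: "contr.koszul_exact \<theta> s (SR_dual \<Delta>) 0" and e: "{} \<in> \<Delta>" and j: "j \<in> {1..s}"
    and hom: "\<And>k. k \<in> {1..s} \<Longrightarrow> \<exists>e>0. homogeneous e (\<theta> k)"
  shows "\<theta> j \<noteq> 0"
proof
  assume 0: "\<theta> j = 0"
  define \<epsilon> :: "(nat \<Rightarrow>\<^sub>0 nat) \<Rightarrow> 'k" where "\<epsilon> m = (if m = 0 then 1 else 0)" for m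
  define f where "f T = (if T = {j} then \<epsilon> else 0)" for T
  have "\<epsilon> \<in> SR_dual \<Delta>"
    using e by (auto simp: SR_dual_def \<epsilon>_def)
  then have "f \<in> contr.cochains s (Suc 0) (SR_dual \<Delta>)"
    using j by (auto simp: contr.cochains_def f_def SR_dual_def)
  moreover have "contr.koszul \<theta> s f = (\<lambda>T. 0)"
  proof (intro ext)
    fix T m
    have "f (T - {k}) (m' + m) = 0" if "k \<in> {1..s}" "m' \<in> Poly_Mapping.keys (\<theta> k)" for k m'
    proof -
      have "monomial_degree m' \<noteq> 0"
        using hom[OF that(1)] that(2) by (auto simp: homogeneous_def)
      then have "m' + m \<noteq> 0"
        using monomial_degree_add[of m' m] by (metis add_is_0 monomial_degree_zero)
      then show ?thesis
        by (simp add: f_def \<epsilon>_def)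
    qed
    then show "contr.koszul \<theta> s f T m = 0 m"
      unfolding koszul_eval by (auto intro!: sum.neutral)
  qed
  ultimately obtain g where "f = contr.koszul \<theta> s g"
    using ex unfolding contr.koszul_exact_def by blast
  then have "f {j} 0 = contr.koszul \<theta> s g {j} 0"
    by simp
  also have "\<dots> = 0"
    unfolding koszul_eval using 0 by (intro sum.neutral) auto
  finally show False
    by (simp add: f_def \<epsilon>_def)
qed

lemma homogeneous_total_degree:
  assumes "homogeneous e p" "p \<noteq> 0"
  shows "total_degree p = e"
proof -
  have "monomial_degree ` Poly_Mapping.keys p = {e}"
    using assms unfolding homogeneous_def by (auto simp: image_iff) (metis keys_eq_empty ex_in_conv)
  then show ?thesis
    by (simp add: total_degree_def)
qed

theorem corollary1p4:
  fixes n d a t :: nat and \<Delta> :: "nat set set"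
  assumes "simplicial_complex_on {1..n} \<Delta>"
    and "complex_dim \<Delta> = int d"
    and "Cohen_Macaulay_complex TYPE('k::field_char_0) \<Delta>"
    and "collapsible \<Delta>"
    and "a > 0"
    and "t > d * (a - 1)"
  shows "\<not> (\<exists>\<theta> :: nat \<Rightarrow> 'k mpoly.
    hsop n \<Delta> d \<theta> \<and>
    (\<forall>i\<in>{1..n}. Var i ^ a \<in> SR_plus n \<Delta> (\<theta> ` {1..d+1})) \<and>
    (\<Sum>i=1..n. Var i) \<in> SR_plus n \<Delta> (\<theta> ` {1..d+1}) \<and>
    (\<Sum>i=1..d+1. int (total_degree (\<theta> i))) + int (degree (h_polynomial TYPE('k) n \<Delta>))
      - int d - 1 = int t \<and>
    hilbert_function n (A_ideal n \<Delta> a :: ('k mpoly) set) (t - 1)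
      \<ge> hilbert_function n (A_ideal n \<Delta> a :: ('k mpoly) set) t)"
proof (intro notI, elim exE conjE)
  fix \<theta> :: "nat \<Rightarrow> 'k mpoly"
  let ?J = "SR_plus n \<Delta> (\<theta> ` {1..d+1})"
  define s where "s = d + 1"
  assume hsop: "hsop n \<Delta> d \<theta>" and pow: "\<forall>i\<in>{1..n}. Var i ^ a \<in> ?J" and lin: "(\<Sum>i=1..n. Var i) \<in> ?J"
    and deg: "(\<Sum>i=1..d+1. int (total_degree (\<theta> i))) + int (degree (h_polynomial TYPE('k) n \<Delta>))
      - int d - 1 = int t"
  have dc: "down_closed \<Delta>" and V: "\<Delta> \<subseteq> Pow {1..n}" "{} \<in> \<Delta>"
    using assms(1) by (auto simp: simplicial_complex_on_def down_closed_def)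
  have fin\<Delta>: "finite \<Delta>"
    using V(1) by (rule finite_subset) simp
  have le: "card \<sigma> \<le> Suc d" if "\<sigma> \<in> \<Delta>" for \<sigma>
  proof -
    have "face_dim \<sigma> \<le> complex_dim \<Delta>"
      unfolding complex_dim_def using that fin\<Delta> by (intro Max_ge) auto
    then show ?thesis
      by (simp add: assms(2) face_dim_def)
  qed
  have \<theta>: "\<theta> j \<in> carrier (mpoly_ring n)" "\<exists>e>0. homogeneous e (\<theta> j)" if "j \<in> {1..s}" for j
    using hsop that by (auto simp: hsop_def s_def)
  have J: "ideal ?J (mpoly_ring n)"
    by (rule ideal_SR_plus) (use \<theta>(1) in \<open>auto simp: s_def\<close>)
  have SR_J: "stanley_reisner_ideal n \<Delta> \<subseteq> ?J"
  proof
    fix p :: "'k mpoly"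
    assume "p \<in> stanley_reisner_ideal n \<Delta>"
    moreover have "ideal (Idl\<^bsub>mpoly_ring n\<^esub> (\<theta> ` {1..d+1})) (mpoly_ring n)"
      by (rule ring.genideal_ideal[OF cring.axioms(1)[OF cring_mpoly_ring]])
        (use \<theta>(1) in \<open>auto simp: s_def\<close>)
    then have "0 \<in> Idl\<^bsub>mpoly_ring n\<^esub> (\<theta> ` {1..d+1})"
      by (rule mpoly_ideal_closed(1))
    ultimately have "p + 0 \<in> ?J"
      unfolding SR_plus_def set_add_def' mpoly_ring_simps by blast
    then show "p \<in> ?J"
      by simp
  qed
  \<comment> \<open>I_\<Delta> acts as 0 on these functionals, so an element of J acts as its
    \<theta>-part.\<close>
  have act: "\<exists>c. \<forall>\<phi>\<in>SR_dual \<Delta>. contraction p \<phi> = contraction (\<Sum>j\<in>{1..s}. c j * \<theta> j) \<phi>" if p: "p \<in> ?J" for p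
  proof -
    obtain q c where "q \<in> stanley_reisner_ideal n \<Delta>" "p = q + (\<Sum>j\<in>{1..s}. c j * \<theta> j)"
      using SR_plus_decompose[OF p[folded s_def] \<theta>(1)] by blast
    then have "contraction p \<phi> = contraction (\<Sum>j\<in>{1..s}. c j * \<theta> j) \<phi>" if "\<phi> \<in> SR_dual \<Delta>" for \<phi>
      using contraction_SR_ideal[OF _ that dc] by (simp only: contr.scale_left_distrib add_0_left)
    then show ?thesis
      by blast
  qed
  have nil: "nilpotent_mod \<theta> s \<Delta>"
    unfolding nilpotent_mod_def
  proof (intro allI impI)
    fix v
    assume "{v} \<in> \<Delta>"
    then have "Var v ^ a \<in> ?J"
      using V(1) pow by auto
    from act[OF this] show "\<exists>N c. \<forall>\<phi>\<in>SR_dual \<Delta>.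
        contraction (Var v ^ N) \<phi> = contraction (\<Sum>j\<in>{1..s}. c j * \<theta> j) \<phi>"
      by blast
  qed
  have CM: "strong_CM TYPE('k) \<Delta> (Suc d)"
    by (rule strong_CM_of_Cohen_Macaulay) fact+
  \<comment> \<open>Here s and the depth bound are both d + 1, so the range covers all positive
    cohomological degrees.\<close>
  have ex: "contr.koszul_exact \<theta> s (SR_dual \<Delta>) i" for i
    using CM nil by (rule koszul_exact_SR_dual) (simp add: s_def)
  define e where "e j = total_degree (\<theta> j)" for j
  have e: "homogeneous (e j) (\<theta> j)" "0 < e j" if j: "j \<in> {1..s}" for j
  proof -
    have "\<theta> j \<noteq> 0"
      using koszul_exact_nonzero[OF ex V(2) j \<theta>(2)] .
    then show "homogeneous (e j) (\<theta> j)" "0 < e j"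
      using \<theta>(2)[OF j] homogeneous_total_degree unfolding e_def by metis+
  qed
  have "(\<Sum>T\<in>Pow {1..s}. (-1) ^ card T *
    int (card {m. Poly_Mapping.keys m \<in> \<Delta> \<and> monomial_degree m + sum e T = t})) = 0"
  proof (rule koszul_euler[OF dc V(1) _ e(1) ex])
    fix \<phi> :: "(nat \<Rightarrow>\<^sub>0 nat) \<Rightarrow> 'k"
    assume \<phi>: "\<phi> \<in> SR_dual \<Delta>" "\<And>m. \<phi> m \<noteq> 0 \<Longrightarrow> monomial_degree m = t"
      "\<And>j. j \<in> {1..s} \<Longrightarrow> contraction (\<theta> j) \<phi> = 0"
    show "\<phi> = 0"
    proof
      fix m
      show "\<phi> m = 0 m"
      proof (rule ccontr)
        assume "\<phi> m \<noteq> 0 m"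
        then have m: "Poly_Mapping.keys m \<in> \<Delta>" "monomial_degree m = t"
          using \<phi>(1,2) by (auto simp: SR_dual_def)
        \<comment> \<open>A functional killed by all \<theta>_j is killed by J, which contains x^m
          by the collapses. Contracting by x^m and evaluating at exponent 0 gives back the value of
          \<phi> at m.\<close>
        have "Poly_Mapping.single m 1 \<in> ?J"
          using collapsible_monomial_mem[OF J SR_J _ lin dc V(1) le assms(4)] pow m V(1) assms(6) by blast
        then obtain c where "contraction (Poly_Mapping.single m 1) \<phi> = contraction (\<Sum>j\<in>{1..s}. c j * \<theta> j) \<phi>"
          using act \<phi>(1) by blast
        also have "\<dots> = (\<Sum>j\<in>{1..s}. contraction (c j) (contraction (\<theta> j) \<phi>))"
          by (simp add: contr.scale_sum_left)
        also have "\<dots> = 0"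
          using \<phi>(3) by simp
        finally have "contraction (Poly_Mapping.single m 1) \<phi> 0 = 0"
          by simp
        with \<open>\<phi> m \<noteq> 0 m\<close> show False
          by (simp add: contraction_single)
      qed
    qed
  qed simp_all
  moreover have "t + s = (\<Sum>j\<in>{1..s}. e j) + degree (h_polynomial TYPE('k) n \<Delta>)"
  proof -
    have "int (\<Sum>j\<in>{1..s}. e j) = (\<Sum>i=1..d+1. int (total_degree (\<theta> i)))"
      by (simp add: e_def s_def)
    with deg show ?thesis
      unfolding s_def by linarith
  qed
  ultimately show False
    using euler_coefficient_nonzero[of \<Delta> s "h_polynomial TYPE('k) n \<Delta>" e t] e(2) V(2)
      h_polynomial_eq[OF assms(1,2) le, where 'k = 'k] by (simp add: s_def)
qed

end
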